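(* Let $\mathcal{L}$ be a modular semilattice of finite rank. Then the orthoscheme complex $K(\mathcal{L})$ is a CAT(0) space.
   Context: In a poset, $q$ covers $p$ if $p\prec q$ and there is no $u$ with $p\prec u\prec q$. A poset $\mathcal{P}$ is graded if there is $r:\mathcal{P}\to\mathbb{Z}$ with $r(q)=r(p)+1$ whenever $q$ covers $p$. A (meet-)semilattice is a poset in which any two elements $p,q$ have a meet $p\wedge q$; semilattices are assumed graded, with minimum element $0$ and $r(0)=0$; the rank of the semilattice is the maximum of $r$; finite rank means that the lengths of chains are bounded by a finite number. The join $p\vee q$ is the least common upper bound, if it exists. The principal ideal of $a$ is $\mathcal{I}(a)=\{p: p\preceq a\}$. A modular lattice (graded, chains of bounded length) is a lattice with $r(a)+r(b)=r(a\vee b)+r(a\wedge b)$ for all $a,b$. A modular semilattice is a semilattice in which every principal ideal is a modular lattice and such that for all $u,v,w$, the join $u\vee v\vee w$ exists if and only if all of $u\vee v$, $v\vee w$, $w\vee u$ exist. Orthoscheme complex: for a graded poset $\mathcal{P}$ with chains of bounded length, $K(\mathcal{P})$ is the set of formal convex combinations $x=\sum_p\lambda_p p$ ($\lambda_p\ge 0$, $\sum_p\lambda_p=1$) whose support is a chain of $\mathcal{P}$. The simplex of a chain $p_0\prec\cdots\prec p_n$ is the set of points with support in that chain. For $x=\sum_i\lambda_ip_i$ in it put $\varphi(x)=\sum_{i=1}^n\lambda_i(e_1+\cdots+e_{r(p_i)-r(p_0)})$ in Euclidean space ($e_j$ the unit vectors). For two points $x,y$ in a common simplex, their distance in the simplex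 is $\|\varphi(x)-\varphi(y)\|_2$. The metric of $K(\mathcal{P})$ is the induced length metric: $d(x,y)$ is the infimum of lengths of paths from $x$ to $y$ (equivalently, the infimum of $\sum_i\|\varphi(x_{i})-\varphi(x_{i-1})\|$ over finite sequences $x=x_0,\dots,x_k=y$ with consecutive points in a common simplex). A geodesic metric space $K$ is CAT(0) if for every $x\in K$ and every geodesic $P:[0,1]\to K$ (parametrized proportionally to length), $d(x,P(t))^2\le(1-t)d(x,P(0))^2+t\,d(x,P(1))^2-t(1-t)d(P(0),P(1))^2$ for all $t\in[0,1]$. *)

theory Defs
  imports "HOL-Analysis.Analysis" "HOL-Library.Lub_Glb"
begin

section \<open>Graded posets and modular semilattices\<close>

text \<open>
  A poset is a subset \<open>P\<close> of a partially ordered type, with the induced order. Joins and meets are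
  taken relative to the carrier, with \<^const>\<open>isLub\<close> and \<^const>\<open>isGlb\<close>. Rank functions are
  explicit parameters; only their values on the carrier matter.
\<close>

definition covers :: "'a::order set \<Rightarrow> 'a \<Rightarrow> 'a \<Rightarrow> bool" where
  "covers P q p \<longleftrightarrow> p \<in> P \<and> q \<in> P \<and> p < q \<and> \<not> (\<exists>u\<in>P. p < u \<and> u < q)"

definition graded_poset :: "'a::order set \<Rightarrow> ('a \<Rightarrow> int) \<Rightarrow> bool" where
  "graded_poset P r \<longleftrightarrow> (\<forall>p q. covers P q p \<longrightarrow> r q = r p + 1)"

text \<open>The length of a finite chain is its cardinality minus one.\<close>

definition bounded_chains :: "'a::order set \<Rightarrow> bool" where
  "bounded_chains P \<longleftrightarrow>
     (\<exists>n. \<forall>C. C \<subseteq> P \<and> Complete_Partial_Order.chain (\<le>) C \<longrightarrow> finite C \<and> card C \<le> n + 1)"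

definition has_join :: "'a::order set \<Rightarrow> 'a set \<Rightarrow> bool" where
  "has_join P S \<longleftrightarrow> (\<exists>j. isLub P S j)"

definition has_meet :: "'a::order set \<Rightarrow> 'a set \<Rightarrow> bool" where
  "has_meet P S \<longleftrightarrow> (\<exists>m. isGlb P S m)"

definition principal_ideal :: "'a::order set \<Rightarrow> 'a \<Rightarrow> 'a set" where
  "principal_ideal P a = {p \<in> P. p \<le> a}"

definition graded_semilattice :: "'a::order set \<Rightarrow> ('a \<Rightarrow> int) \<Rightarrow> bool" where
  "graded_semilattice P r \<longleftrightarrow>
     (\<forall>p\<in>P. \<forall>q\<in>P. has_meet P {p, q}) \<and>
     graded_poset P r \<and>
     (\<exists>z\<in>P. (\<forall>p\<in>P. z \<le> p) \<and> r z = 0)"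

definition modular_lattice :: "'a::order set \<Rightarrow> ('a \<Rightarrow> int) \<Rightarrow> bool" where
  "modular_lattice P r \<longleftrightarrow>
     (\<forall>a\<in>P. \<forall>b\<in>P. has_join P {a, b} \<and> has_meet P {a, b}) \<and>
     graded_poset P r \<and>
     bounded_chains P \<and>
     (\<forall>a\<in>P. \<forall>b\<in>P. \<forall>j m. isLub P {a, b} j \<and> isGlb P {a, b} m \<longrightarrow> r a + r b = r j + r m)"

definition modular_semilattice :: "'a::order set \<Rightarrow> ('a \<Rightarrow> int) \<Rightarrow> bool" where
  "modular_semilattice P r \<longleftrightarrow>
     graded_semilattice P r \<and>
     (\<forall>a\<in>P. modular_lattice (principal_ideal P a) r) \<and>
     (\<forall>u\<in>P. \<forall>v\<in>P. \<forall>w\<in>P.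
        has_join P {u, v, w} \<longleftrightarrow> has_join P {u, v} \<and> has_join P {v, w} \<and> has_join P {w, u})"


section \<open>Orthoscheme complexes\<close>

definition finite_chains :: "'a::order set \<Rightarrow> 'a set set" where
  "finite_chains P = {C. C \<subseteq> P \<and> finite C \<and> C \<noteq> {} \<and> Complete_Partial_Order.chain (\<le>) C}"

text \<open>A formal convex combination is represented by its coefficient function.\<close>

definition orthoscheme_complex :: "'a::order set \<Rightarrow> ('a \<Rightarrow> real) set" where
  "orthoscheme_complex P =
     {x. {p. x p \<noteq> 0} \<in> finite_chains P \<and> (\<forall>p. 0 \<le> x p) \<and> (\<Sum>p | x p \<noteq> 0. x p) = 1}"

definition chain_simplex :: "'a::order set \<Rightarrow> 'a set \<Rightarrow> ('a \<Rightarrow> real) set" where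
  "chain_simplex P C = {x \<in> orthoscheme_complex P. {p. x p \<noteq> 0} \<subseteq> C}"

text \<open>
  For \<open>C = {p\<^sub>0 < \<dots> < p\<^sub>n}\<close>, the map \<open>\<phi>\<close> takes values in the Euclidean space with coordinates
  \<open>j \<in> {1..r p\<^sub>n - r p\<^sub>0}\<close>; the vector \<open>e\<^sub>1 + \<dots> + e\<^sub>k\<close> is the indicator function of \<open>{1..k}\<close>.
  The summand of \<open>p\<^sub>0\<close> vanishes.
\<close>

definition orthoscheme_map :: "('a::order \<Rightarrow> int) \<Rightarrow> 'a set \<Rightarrow> ('a \<Rightarrow> real) \<Rightarrow> int \<Rightarrow> real" where
  "orthoscheme_map r C x j = (\<Sum>p\<in>C. x p * indicator {1..r p - r (LEAST q. q \<in> C)} j)"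

definition simplex_dist :: "('a::order \<Rightarrow> int) \<Rightarrow> 'a set \<Rightarrow> ('a \<Rightarrow> real) \<Rightarrow> ('a \<Rightarrow> real) \<Rightarrow> real" where
  "simplex_dist r C x y =
     L2_set (\<lambda>j. orthoscheme_map r C x j - orthoscheme_map r C y j)
       {1..r (GREATEST q. q \<in> C) - r (LEAST q. q \<in> C)}"

text \<open>
  The induced length metric, as the infimum over finite sequences whose consecutive points
  \<open>z i\<close>, \<open>z (i + 1)\<close> lie in a common simplex, that of \<open>C i\<close>. It is set to \<open>0\<close> off the complex, since
  \<^locale>\<open>Metric_space\<close> constrains the distance function on the whole type. It is meaningful only for
  connected complexes, where the infimum is over a nonempty set; a poset with a minimum has one.
\<close>

definition orthoscheme_dist ::
    "'a::order set \<Rightarrow> ('a \<Rightarrow> int) \<Rightarrow> ('a \<Rightarrow> real) \<Rightarrow> ('a \<Rightarrow> real) \<Rightarrow> real" where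
  "orthoscheme_dist P r x y =
     (if x \<in> orthoscheme_complex P \<and> y \<in> orthoscheme_complex P
      then Inf {(\<Sum>i<k. simplex_dist r (C i) (z i) (z (Suc i))) | (k::nat) C z.
                  z 0 = x \<and> z k = y \<and>
                  (\<forall>i<k. C i \<in> finite_chains P \<and>
                     z i \<in> chain_simplex P (C i) \<and> z (Suc i) \<in> chain_simplex P (C i))}
      else 0)"


section \<open>CAT(0) spaces\<close>

text \<open>Geodesics are parametrized by the unit interval, proportionally to length.\<close>

definition geodesic :: "'a set \<Rightarrow> ('a \<Rightarrow> 'a \<Rightarrow> real) \<Rightarrow> (real \<Rightarrow> 'a) \<Rightarrow> bool" where
  "geodesic M d g \<longleftrightarrow>
     g ` {0..1} \<subseteq> M \<and>
     (\<forall>s\<in>{0..1}. \<forall>t\<in>{0..1}. d (g s) (g t) = \<bar>s - t\<bar> * d (g 0) (g 1))"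

definition geodesic_space :: "'a set \<Rightarrow> ('a \<Rightarrow> 'a \<Rightarrow> real) \<Rightarrow> bool" where
  "geodesic_space M d \<longleftrightarrow>
     Metric_space M d \<and> (\<forall>x\<in>M. \<forall>y\<in>M. \<exists>g. geodesic M d g \<and> g 0 = x \<and> g 1 = y)"

definition CAT0_space :: "'a set \<Rightarrow> ('a \<Rightarrow> 'a \<Rightarrow> real) \<Rightarrow> bool" where
  "CAT0_space M d \<longleftrightarrow>
     geodesic_space M d \<and>
     (\<forall>x\<in>M. \<forall>g. geodesic M d g \<longrightarrow>
        (\<forall>t\<in>{0..1}. (d x (g t))\<^sup>2 \<le>
           (1 - t) * (d x (g 0))\<^sup>2 + t * (d x (g 1))\<^sup>2 - t * (1 - t) * (d (g 0) (g 1))\<^sup>2))"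

end

theory Submission
  imports Defs
begin

text \<open>The idea is to develop the complex \<open>K\<close> onto a Euclidean space from each of its points \<open>m\<close>. The map
  \<open>dev\<close> from \<open>K\<close> to the space with coordinates \<open>{0..n}\<close>, where \<open>n\<close> is the rank of the greatest element
  \<open>c\<close> of the support of \<open>m\<close>, has three properties: it does not increase distances (\<open>dev_lipschitz\<close>), it
  is isometric on the simplex that carries \<open>m\<close> (\<open>dev_isometric\<close>), and every point \<open>z\<close> is reached from
  \<open>m\<close> by a polygonal path of length \<open>|dev z - dev m|\<close> (\<open>polygonal_dev\<close>). The last and the first
  property together show that \<open>dev\<close> preserves the distances from \<open>m\<close>, and that these are attained by
  polygonal paths.

  The CAT(0) inequality follows by developing at the point where it is tested. Let \<open>p\<close> be an interior
  point of a segment of a shortest polygonal path from \<open>x\<close> to \<open>y\<close>. Developing at \<open>p\<close> preserves the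
  distances from \<open>p\<close> to the other points of the path and the length of the segment around \<open>p\<close>, so the
  image of the path is a straight segment. For each further point \<open>z\<close> the inequality is an identity
  in the image, where the distance from \<open>z\<close> to \<open>p\<close> is preserved and those from \<open>z\<close> to \<open>x\<close> and \<open>y\<close> have
  not grown (\<open>cat0_generic\<close>). The finitely many vertices of the path follow by continuity
  (\<open>cat0_inequality\<close>), and the inequality for one geodesic forces each other geodesic between the
  same points to agree with it.

  The developing map comes from an optimisation problem. Complete the support of \<open>m\<close> to a flag
  \<open>k 0 < \<dots> < k n = c\<close>. An element \<open>p\<close> below \<open>c\<close> is measured by its jump set \<open>J p\<close>, the set of steps of
  the flag at which \<open>p\<close> grows; its size is the rank of \<open>p\<close>. The part of \<open>m\<close> below \<open>p\<close> has a squared norm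
  \<open>energy m p\<close>, which is supermodular in \<open>p\<close>. Travelling from \<open>m\<close> to \<open>z\<close>, the part of \<open>m\<close> that is
  incompatible with \<open>z\<close> has to shrink to zero before parts of \<open>z\<close> can grow. In which order this
  happens is governed by the pairs \<open>(p, q)\<close> of elements with a common upper bound and \<open>p \<le> c\<close> that
  maximise \<open>t * energy m p + energy z q\<close> for a parameter \<open>t\<close>. By the condition on joins of three
  elements these pairs form a lattice, with the order reversed in the second component. The objective
  is supermodular on it, hence optimal pairs can be combined and move monotonically with \<open>t\<close>
  (\<open>optimal_combine\<close>, \<open>optimal_mono\<close>). At each of finitely many parameters \<open>t\<close> a block \<open>A\<close> of
  coordinates of \<open>m\<close> is exchanged for a block \<open>B\<close> of coordinates of \<open>z\<close> whose squared norm is \<open>t\<close> times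
  that of \<open>A\<close>. The developing map replaces the block \<open>B\<close> of \<open>z\<close> by the vector of the same norm opposite
  to the block \<open>A\<close> of \<open>m\<close>. It keeps the part of \<open>z\<close> below \<open>c\<close>, and it folds the part of \<open>z\<close> that is
  compatible with \<open>c\<close> but not below \<open>c\<close> into the coordinate \<open>0\<close> by taking its norm.

  For a fixed system of blocks the developing map is built from norms of blocks, so it does not
  increase distances, by the reverse triangle inequality (\<open>dev_same_type\<close>). Only finitely many systems
  occur along a segment, each on a closed set of parameters, and the Lipschitz bound passes from these
  sets to the segment (\<open>lipschitz_from_closed_cover\<close>).

  For the polygonal path, meets of elements of the two flags with each other and with the optimal
  elements serve as generators, with coefficients that are affine in time: they interpolate between
  \<open>m\<close> and \<open>z\<close> on the common part, shrink a block \<open>A\<close> to zero until its breaking time \<open>1 / (1 + sqrt t)\<close>,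
  and let the block \<open>B\<close> grow afterwards. The point at time \<open>s\<close> is the step function that maps a
  threshold to the join of the generators whose coefficients reach it. These joins exist, because the
  generators of positive coefficient come from compatible optimal elements (\<open>upper_bounded\<close>), and their
  ranks can be counted in the two flags (\<open>label_elt\<close>), which makes the distances along the path
  computable. At each time either \<open>A\<close> or \<open>B\<close> moves, both with speed \<open>1 + sqrt t\<close> times the norm of \<open>A\<close>,
  so the path has the constant speed \<open>|dev z - dev m|\<close> (\<open>sdist_path\<close>).\<close>

section \<open>Modular semilattices of finite rank\<close>

lemma isLub_alt: "isLub P S j \<longleftrightarrow> j \<in> P \<and> (\<forall>s\<in>S. s \<le> j) \<and> (\<forall>w\<in>P. (\<forall>s\<in>S. s \<le> w) \<longrightarrow> j \<le> w)"
  by (auto simp: isLub_def leastP_def isUb_def setle_def setge_def)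

lemma isGlb_alt: "isGlb P S j \<longleftrightarrow> j \<in> P \<and> (\<forall>s\<in>S. j \<le> s) \<and> (\<forall>w\<in>P. (\<forall>s\<in>S. w \<le> s) \<longrightarrow> w \<le> j)"
  by (auto simp: isGlb_def greatestP_def isLb_def setle_def setge_def)

locale modular_semilattice_finite_rank =
  fixes L :: "'a::order set" and r :: "'a \<Rightarrow> int"
  assumes modular: "modular_semilattice L r"
    and chains: "bounded_chains L"
begin

definition meet :: "'a \<Rightarrow> 'a \<Rightarrow> 'a"  (infixl "\<sqinter>" 70) where
  "a \<sqinter> b = (THE m. isGlb L {a, b} m)"

definition lub :: "'a set \<Rightarrow> 'a" where
  "lub S = (THE j. isLub L S j)"

abbreviation join :: "'a \<Rightarrow> 'a \<Rightarrow> 'a"  (infixl "\<squnion>" 65) where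
  "a \<squnion> b \<equiv> lub {a, b}"

text \<open>The existence of a common upper bound is used in place of the existence of a join; the two agree,
  because principal ideals are lattices.\<close>

definition compat :: "'a \<Rightarrow> 'a \<Rightarrow> bool" where
  "compat a b \<longleftrightarrow> (\<exists>u\<in>L. a \<le> u \<and> b \<le> u)"

definition bottom :: 'a where
  "bottom = (THE z. z \<in> L \<and> (\<forall>p\<in>L. z \<le> p))"

definition rk :: "'a \<Rightarrow> nat" where
  "rk a = nat (r a)"

lemma isGlb_meet:
  assumes "a \<in> L" "b \<in> L"
  shows "isGlb L {a, b} (a \<sqinter> b)"
proof -
  obtain m where "isGlb L {a, b} m"
    using modular assms
    unfolding modular_semilattice_def graded_semilattice_def has_meet_def by blast
  then show ?thesis
    unfolding meet_def by (rule theI) (use \<open>isGlb L {a, b} m\<close> in \<open>auto simp: isGlb_alt intro: antisym\<close>)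
qed

lemma meet_in [simp, intro]: "a \<in> L \<Longrightarrow> b \<in> L \<Longrightarrow> a \<sqinter> b \<in> L"
  and meet_le1 [simp]: "a \<in> L \<Longrightarrow> b \<in> L \<Longrightarrow> a \<sqinter> b \<le> a"
  and meet_le2 [simp]: "a \<in> L \<Longrightarrow> b \<in> L \<Longrightarrow> a \<sqinter> b \<le> b"
  and meet_greatest: "a \<in> L \<Longrightarrow> b \<in> L \<Longrightarrow> w \<in> L \<Longrightarrow> w \<le> a \<Longrightarrow> w \<le> b \<Longrightarrow> w \<le> a \<sqinter> b"
  using isGlb_meet unfolding isGlb_alt by auto

lemma meet_commute: "a \<sqinter> b = b \<sqinter> a"
  unfolding meet_def by (simp add: insert_commute)

lemma meet_absorb1: "a \<in> L \<Longrightarrow> b \<in> L \<Longrightarrow> a \<le> b \<Longrightarrow> a \<sqinter> b = a"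
  by (meson antisym meet_greatest meet_le1 order_refl)

lemma meet_absorb2: "a \<in> L \<Longrightarrow> b \<in> L \<Longrightarrow> a \<le> b \<Longrightarrow> b \<sqinter> a = a"
  using meet_absorb1 meet_commute by metis

lemma meet_mono:
  "a \<in> L \<Longrightarrow> b \<in> L \<Longrightarrow> a' \<in> L \<Longrightarrow> b' \<in> L \<Longrightarrow> a \<le> a' \<Longrightarrow> b \<le> b' \<Longrightarrow> a \<sqinter> b \<le> a' \<sqinter> b'"
  by (meson meet_greatest meet_in meet_le1 meet_le2 order_trans)

lemma le_meet_iff: "a \<in> L \<Longrightarrow> b \<in> L \<Longrightarrow> w \<in> L \<Longrightarrow> w \<le> a \<sqinter> b \<longleftrightarrow> w \<le> a \<and> w \<le> b"
  by (meson meet_greatest meet_le1 meet_le2 order_trans)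

lemma meet_assoc: "a \<in> L \<Longrightarrow> b \<in> L \<Longrightarrow> c \<in> L \<Longrightarrow> a \<sqinter> b \<sqinter> c = a \<sqinter> (b \<sqinter> c)"
  by (rule antisym) (auto simp: le_meet_iff intro: order_trans[OF meet_le1] order_trans[OF meet_le2])

lemma bottom_in [simp]: "bottom \<in> L" and bottom_le [simp]: "p \<in> L \<Longrightarrow> bottom \<le> p"
  and r_bottom: "r bottom = 0"
proof -
  obtain z where z: "z \<in> L" "\<forall>p\<in>L. z \<le> p" "r z = 0"
    using modular unfolding modular_semilattice_def graded_semilattice_def by blast
  have "bottom = z"
    unfolding bottom_def by (rule the_equality) (use z in \<open>auto intro: antisym\<close>)
  with z show "bottom \<in> L" "p \<in> L \<Longrightarrow> bottom \<le> p" "r bottom = 0" by auto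
qed

subsection \<open>Joins of bounded sets\<close>

text \<open>The join in the ideal below \<open>u\<close> is a join in the whole semilattice, since its meet with any
  other upper bound lies in that ideal again.\<close>

lemma principal_join:
  assumes "a \<in> L" "b \<in> L" "u \<in> L" "a \<le> u" "b \<le> u"
  shows "\<exists>j. isLub L {a, b} j \<and> isLub (principal_ideal L u) {a, b} j"
proof -
  have "modular_lattice (principal_ideal L u) r"
    using modular assms(3) unfolding modular_semilattice_def by blast
  then obtain j where j: "isLub (principal_ideal L u) {a, b} j"
    using assms unfolding modular_lattice_def has_join_def principal_ideal_def by blast
  have jL: "j \<in> L" "j \<le> u" "a \<le> j" "b \<le> j"
    using j by (auto simp: isLub_alt principal_ideal_def)
  have "j \<le> w" if w: "w \<in> L" "a \<le> w" "b \<le> w" for w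
  proof -
    have "j \<le> j \<sqinter> w"
    proof -
      have "j \<sqinter> w \<in> principal_ideal L u"
        using jL w by (auto simp: principal_ideal_def intro: order_trans[OF meet_le1])
      moreover have "a \<le> j \<sqinter> w" "b \<le> j \<sqinter> w"
        using assms w jL by (auto intro: meet_greatest)
      ultimately show ?thesis using j by (auto simp: isLub_alt)
    qed
    then show ?thesis using meet_le2[OF jL(1) w(1)] by order
  qed
  then have "isLub L {a, b} j" using jL by (auto simp: isLub_alt)
  with j show ?thesis by blast
qed

lemma lub_eq: "isLub L S j \<Longrightarrow> lub S = j"
  unfolding lub_def by (rule the_equality) (auto simp: isLub_alt intro: antisym)

lemma isLub_lub:
  assumes "finite S" "S \<subseteq> L" "u \<in> L" "\<And>s. s \<in> S \<Longrightarrow> s \<le> u"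
  shows "isLub L S (lub S)"
proof -
  have "\<exists>j. isLub L S j"
    using assms
  proof (induction S rule: finite_induct)
    case empty
    show ?case by (rule exI[of _ bottom]) (auto simp: isLub_alt)
  next
    case (insert s S)
    then obtain j where j: "isLub L S j" by auto
    then have "j \<in> L" "j \<le> u" using insert.prems by (auto simp: isLub_alt)
    then obtain j' where "isLub L {s, j} j'"
      using principal_join[of s j u] insert.prems by auto
    then have "isLub L (insert s S) j'"
      using j unfolding isLub_alt by (auto intro: order_trans)
    then show ?case by blast
  qed
  then show ?thesis using lub_eq by auto
qed

lemma lub_in: "finite S \<Longrightarrow> S \<subseteq> L \<Longrightarrow> u \<in> L \<Longrightarrow> (\<And>s. s \<in> S \<Longrightarrow> s \<le> u) \<Longrightarrow> lub S \<in> L"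
  and lub_upper: "finite S \<Longrightarrow> S \<subseteq> L \<Longrightarrow> u \<in> L \<Longrightarrow> (\<And>s. s \<in> S \<Longrightarrow> s \<le> u) \<Longrightarrow> s \<in> S \<Longrightarrow> s \<le> lub S"
  and lub_least: "finite S \<Longrightarrow> S \<subseteq> L \<Longrightarrow> u \<in> L \<Longrightarrow> (\<And>s. s \<in> S \<Longrightarrow> s \<le> u) \<Longrightarrow> lub S \<le> u"
  using isLub_lub[of S u] unfolding isLub_alt by auto

lemma lub_empty: "lub {} = bottom"
  by (rule lub_eq) (auto simp: isLub_alt)

lemma lub_singleton: "a \<in> L \<Longrightarrow> lub {a} = a"
  by (rule lub_eq) (auto simp: isLub_alt)

lemma compat_sym: "compat a b \<Longrightarrow> compat b a"
  unfolding compat_def by blast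

lemma compatI: "u \<in> L \<Longrightarrow> a \<le> u \<Longrightarrow> b \<le> u \<Longrightarrow> compat a b"
  unfolding compat_def by blast

lemma compat_mono: "compat a b \<Longrightarrow> a' \<le> a \<Longrightarrow> b' \<le> b \<Longrightarrow> compat a' b'"
  unfolding compat_def by (meson order_trans)

lemma join_in: "a \<in> L \<Longrightarrow> b \<in> L \<Longrightarrow> compat a b \<Longrightarrow> a \<squnion> b \<in> L"
  and join_ge1: "a \<in> L \<Longrightarrow> b \<in> L \<Longrightarrow> compat a b \<Longrightarrow> a \<le> a \<squnion> b"
  and join_ge2: "a \<in> L \<Longrightarrow> b \<in> L \<Longrightarrow> compat a b \<Longrightarrow> b \<le> a \<squnion> b"
  unfolding compat_def using lub_in[of "{a,b}"] lub_upper[of "{a,b}"] by blast+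

lemma join_least:
  assumes "a \<in> L" "b \<in> L" "w \<in> L" "a \<le> w" "b \<le> w"
  shows "a \<squnion> b \<le> w"
  by (rule lub_least) (use assms in auto)

lemma has_join_compat: "a \<in> L \<Longrightarrow> b \<in> L \<Longrightarrow> has_join L {a, b} \<longleftrightarrow> compat a b"
proof
  assume "a \<in> L" "b \<in> L"
  assume "compat a b"
  then obtain u where "u \<in> L" "a \<le> u" "b \<le> u" unfolding compat_def by blast
  with \<open>a \<in> L\<close> \<open>b \<in> L\<close> show "has_join L {a, b}"
    unfolding has_join_def using isLub_lub[of "{a, b}" u] by blast
qed (auto simp: has_join_def compat_def isLub_alt)

lemma compat3:
  assumes "a \<in> L" "b \<in> L" "c \<in> L" "compat a b" "compat b c" "compat c a"
  shows "\<exists>u\<in>L. a \<le> u \<and> b \<le> u \<and> c \<le> u"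
proof -
  have "has_join L {a, b, c}"
    using modular assms has_join_compat unfolding modular_semilattice_def by blast
  then show ?thesis by (auto simp: has_join_def isLub_alt)
qed

text \<open>This is the condition on joins of three elements, in the form in which optimal pairs are combined.\<close>

lemma compat_join:
  assumes "a \<in> L" "b \<in> L" "c \<in> L" "compat a b" "compat a c" "compat b c"
  shows "compat (a \<squnion> b) c"
proof -
  obtain u where "u \<in> L" "a \<le> u" "b \<le> u" "c \<le> u"
    using compat3[of a b c] assms compat_sym by blast
  then show ?thesis using join_least[of a b u] assms by (auto intro: compatI)
qed

lemma lub_Un:
  assumes "finite S" "finite T" "S \<subseteq> L" "T \<subseteq> L" "u \<in> L" "\<And>s. s \<in> S \<union> T \<Longrightarrow> s \<le> u"
  shows "lub (S \<union> T) = lub S \<squnion> lub T"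
proof (rule sym, rule lub_eq)
  have S: "isLub L S (lub S)" and T: "isLub L T (lub T)"
    using isLub_lub assms by blast+
  then have "isLub L {lub S, lub T} (lub S \<squnion> lub T)"
    using assms by (intro isLub_lub[of _ u]) (auto simp: isLub_alt)
  then have *: "lub (S \<union> T) = lub S \<squnion> lub T"
    using S T by (intro lub_eq) (auto simp: isLub_alt intro: order_trans)
  show "isLub L {lub S, lub T} (lub (S \<union> T))"
    unfolding * by fact
qed

subsection \<open>Rank\<close>

lemma chain_finite: "C \<subseteq> L \<Longrightarrow> Complete_Partial_Order.chain (\<le>) C \<Longrightarrow> finite C"
  using chains unfolding bounded_chains_def by blast

text \<open>Finite rank is used through two forms of well-foundedness, which give covers and a strictly
  monotone rank function.\<close>

lemma wf_less: "wf {(x, y). x \<in> L \<and> y \<in> L \<and> x < y}"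
  and wf_greater: "wf {(x, y). x \<in> L \<and> y \<in> L \<and> y < x}"
proof -
  have *: False if f: "\<And>i. f i \<in> L" and mono: "\<And>i j. i < j \<Longrightarrow> f i < f j \<or> f j < f i" for f :: "nat \<Rightarrow> 'a"
  proof -
    have "Complete_Partial_Order.chain (\<le>) (range f)"
      unfolding Complete_Partial_Order.chain_def
      by (auto) (metis mono linorder_less_linear order_less_imp_le order_refl)
    then have "finite (range f)" using f by (intro chain_finite) auto
    moreover have "inj f"
      by (rule injI) (metis mono linorder_less_linear order_less_irrefl)
    ultimately show False using finite_imageD by blast
  qed
  show "wf {(x, y). x \<in> L \<and> y \<in> L \<and> x < y}"
    unfolding wf_iff_no_infinite_down_chain
  proof clarify
    fix f :: "nat \<Rightarrow> 'a" assume a: "\<forall>i. (f (Suc i), f i) \<in> {(x, y). x \<in> L \<and> y \<in> L \<and> x < y}"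
    then have "f j < f i" if "i < j" for i j
      using that by (induction j) (auto simp: less_Suc_eq intro: less_trans)
    then show False using *[of f] a by auto
  qed
  show "wf {(x, y). x \<in> L \<and> y \<in> L \<and> y < x}"
    unfolding wf_iff_no_infinite_down_chain
  proof clarify
    fix f :: "nat \<Rightarrow> 'a" assume a: "\<forall>i. (f (Suc i), f i) \<in> {(x, y). x \<in> L \<and> y \<in> L \<and> y < x}"
    then have "f i < f j" if "i < j" for i j
      using that by (induction j) (auto simp: less_Suc_eq intro: less_trans)
    then show False using *[of f] a by auto
  qed
qed

lemma ex_cover:
  assumes "a \<in> L" "b \<in> L" "a < b"
  obtains c where "c \<in> L" "a < c" "c \<le> b" "r c = r a + 1"
proof -
  define Q where "Q = {x \<in> L. a < x \<and> x \<le> b}"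
  have "b \<in> Q" using assms by (auto simp: Q_def)
  then obtain c where c: "c \<in> Q" "\<And>y. (y, c) \<in> {(x, y). x \<in> L \<and> y \<in> L \<and> x < y} \<Longrightarrow> y \<notin> Q"
    by (rule wfE_min[OF wf_less]) blast
  have c': "c \<in> L" "a < c" "c \<le> b" using c(1) by (auto simp: Q_def)
  have "\<not> (\<exists>u\<in>L. a < u \<and> u < c)"
  proof
    assume "\<exists>u\<in>L. a < u \<and> u < c"
    then obtain u where u: "u \<in> L" "a < u" "u < c" by blast
    then have "u \<le> b" using c' by order
    then have "u \<in> Q" using u by (simp add: Q_def)
    moreover have "u \<notin> Q" using c(2)[of u] u c' by blast
    ultimately show False by blast
  qed
  then have "covers L c a" using assms c' by (simp add: covers_def)
  then have "r c = r a + 1"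
    using modular unfolding modular_semilattice_def graded_semilattice_def graded_poset_def by blast
  with c' that show ?thesis by blast
qed

lemma r_strict: "a \<in> L \<Longrightarrow> b \<in> L \<Longrightarrow> a < b \<Longrightarrow> r a < r b"
proof (induction a rule: wf_induct_rule[OF wf_greater])
  case (1 a)
  obtain c where c: "c \<in> L" "a < c" "c \<le> b" "r c = r a + 1"
    using ex_cover 1 by metis
  show ?case
  proof (cases "c = b")
    case False
    then have "c < b" using c by order
    then have "r c < r b" using "1.IH"[of c] "1.prems" c(1,2) by blast
    then show ?thesis using c by simp
  qed (use c in simp)
qed

lemma r_nonneg: "a \<in> L \<Longrightarrow> 0 \<le> r a"
  using r_strict[of bottom a] r_bottom bottom_le[of a] by (cases "a = bottom") (auto simp: order_le_less)

lemma int_rk: "a \<in> L \<Longrightarrow> int (rk a) = r a"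
  unfolding rk_def using r_nonneg by simp

lemma rk_strict: "a \<in> L \<Longrightarrow> b \<in> L \<Longrightarrow> a < b \<Longrightarrow> rk a < rk b"
  using r_strict[of a b] int_rk[of a] int_rk[of b] by simp

lemma rk_mono: "a \<in> L \<Longrightarrow> b \<in> L \<Longrightarrow> a \<le> b \<Longrightarrow> rk a \<le> rk b"
  using rk_strict by (cases "a = b") (auto simp: order_le_less)

lemma rk_eqD: "a \<in> L \<Longrightarrow> b \<in> L \<Longrightarrow> a \<le> b \<Longrightarrow> rk b \<le> rk a \<Longrightarrow> a = b"
  using rk_strict[of a b] by (auto simp: order_le_less)

lemma rk_bottom [simp]: "rk bottom = 0"
  unfolding rk_def by (simp add: r_bottom)

lemma rk_join_meet:
  assumes "a \<in> L" "b \<in> L" "compat a b"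
  shows "rk a + rk b = rk (a \<squnion> b) + rk (a \<sqinter> b)"
proof -
  obtain u where u: "u \<in> L" "a \<le> u" "b \<le> u" using assms unfolding compat_def by blast
  obtain j where j: "isLub L {a, b} j" "isLub (principal_ideal L u) {a, b} j"
    using principal_join u assms by blast
  have "isGlb (principal_ideal L u) {a, b} (a \<sqinter> b)"
    using isGlb_meet[OF assms(1,2)] u by (auto simp: isGlb_alt principal_ideal_def intro: order_trans)
  moreover have "a \<in> principal_ideal L u" "b \<in> principal_ideal L u"
    using assms u by (auto simp: principal_ideal_def)
  moreover have "modular_lattice (principal_ideal L u) r"
    using modular u unfolding modular_semilattice_def by blast
  ultimately have "r a + r b = r j + r (a \<sqinter> b)"
    using j unfolding modular_lattice_def by blast
  moreover have "j = a \<squnion> b" using lub_eq[OF j(1)] by simp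
  ultimately show ?thesis
    using int_rk assms join_in[OF assms] meet_in[OF assms(1,2)]
    by (metis of_nat_add of_nat_eq_iff)
qed

text \<open>Meeting with \<open>e\<close> preserves meets, but the meet of a join with \<open>e\<close> may be larger than the join of
  the meets. This is why the energies below are supermodular rather than modular.\<close>

lemma rk_supermodular:
  assumes "a \<in> L" "b \<in> L" "e \<in> L" "compat a b"
  shows "rk (a \<sqinter> e) + rk (b \<sqinter> e) \<le> rk ((a \<squnion> b) \<sqinter> e) + rk ((a \<sqinter> b) \<sqinter> e)"
proof -
  have c: "compat (a \<sqinter> e) (b \<sqinter> e)" using assms by (auto intro: compat_mono)
  have j: "a \<squnion> b \<in> L" "a \<le> a \<squnion> b" "b \<le> a \<squnion> b" using assms join_in join_ge1 join_ge2 by auto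
  have "(a \<sqinter> e) \<squnion> (b \<sqinter> e) \<le> (a \<squnion> b) \<sqinter> e"
    using assms j by (intro join_least) (auto intro: meet_mono)
  then have "rk ((a \<sqinter> e) \<squnion> (b \<sqinter> e)) \<le> rk ((a \<squnion> b) \<sqinter> e)"
    using assms j c by (intro rk_mono join_in) auto
  moreover have "(a \<sqinter> e) \<sqinter> (b \<sqinter> e) \<le> (a \<sqinter> b) \<sqinter> e"
    using assms by (simp add: le_meet_iff) (meson meet_in meet_le1 meet_le2 order_trans)
  then have "rk ((a \<sqinter> e) \<sqinter> (b \<sqinter> e)) \<le> rk ((a \<sqinter> b) \<sqinter> e)"
    using assms by (intro rk_mono) auto
  ultimately show ?thesis
    using rk_join_meet[of "a \<sqinter> e" "b \<sqinter> e"] assms c by auto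
qed

section \<open>Flags and jump sets\<close>

definition flag :: "nat \<Rightarrow> (nat \<Rightarrow> 'a) \<Rightarrow> bool" where
  "flag n k \<longleftrightarrow> (\<forall>i\<le>n. k i \<in> L \<and> rk (k i) = i) \<and> (\<forall>i j. i \<le> j \<longrightarrow> j \<le> n \<longrightarrow> k i \<le> k j)"

definition jumps :: "nat \<Rightarrow> (nat \<Rightarrow> 'a) \<Rightarrow> 'a \<Rightarrow> nat set" where
  "jumps n k q = {i \<in> {1..n}. \<not> q \<sqinter> k i \<le> k (i - 1)}"

lemma flag_in: "flag n k \<Longrightarrow> i \<le> n \<Longrightarrow> k i \<in> L"
  and flag_rk: "flag n k \<Longrightarrow> i \<le> n \<Longrightarrow> rk (k i) = i"
  and flag_mono: "flag n k \<Longrightarrow> i \<le> j \<Longrightarrow> j \<le> n \<Longrightarrow> k i \<le> k j"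
  unfolding flag_def by auto

lemma flag_0: "flag n k \<Longrightarrow> k 0 = bottom"
  using rk_eqD[of bottom "k 0"] flag_in[of n k 0] flag_rk[of n k 0] by auto

text \<open>A chain below \<open>c\<close> that contains \<open>C\<close> and has the greatest cardinality has an element of each rank, because a missing rank
  could be filled by a cover.\<close>

lemma ex_flag:
  assumes C: "C \<subseteq> L" "Complete_Partial_Order.chain (\<le>) C"
    and c: "c \<in> C" "\<And>p. p \<in> C \<Longrightarrow> p \<le> c"
  obtains k where "flag (rk c) k" "\<And>p. p \<in> C \<Longrightarrow> k (rk p) = p"
proof -
  define \<M> where "\<M> = {M. insert bottom C \<subseteq> M \<and> M \<subseteq> {p \<in> L. p \<le> c} \<and> Complete_Partial_Order.chain (\<le>) M}"
  have cL: "c \<in> L" using c C by auto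
  have "insert bottom C \<in> \<M>"
    using C c cL unfolding \<M>_def Complete_Partial_Order.chain_def by auto
  moreover obtain N where N: "\<And>M. M \<subseteq> L \<Longrightarrow> Complete_Partial_Order.chain (\<le>) M \<Longrightarrow> finite M \<and> card M \<le> N + 1"
    using chains unfolding bounded_chains_def by blast
  then have "\<forall>M. M \<in> \<M> \<longrightarrow> card M < N + 2" 
  proof clarify
    fix M assume "M \<in> \<M>"
    then have "finite M \<and> card M \<le> N + 1" by (intro N) (auto simp: \<M>_def)
    then show "card M < N + 2" by simp
  qed
  ultimately have "\<exists>M. M \<in> \<M> \<and> (\<forall>M'. M' \<in> \<M> \<longrightarrow> card M' \<le> card M)"
    by (rule Lattices_Big.ex_has_greatest_nat)
  then obtain M where M: "M \<in> \<M>" "\<And>M'. M' \<in> \<M> \<Longrightarrow> card M' \<le> card M"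
    by blast
  have Mch: "p \<in> M \<Longrightarrow> q \<in> M \<Longrightarrow> p \<le> q \<or> q \<le> p" for p q
    using M(1) unfolding \<M>_def Complete_Partial_Order.chain_def by blast
  have MsL: "p \<in> M \<Longrightarrow> p \<in> L \<and> p \<le> c" for p using M(1) unfolding \<M>_def by blast
  have MC: "C \<subseteq> M" "bottom \<in> M" using M(1) unfolding \<M>_def by auto
  have Mfin: "finite M" using N[of M] M(1) unfolding \<M>_def by blast
  have rk_inj: "p = q" if "p \<in> M" "q \<in> M" "rk p = rk q" for p q
    using Mch[OF that(1,2)] rk_eqD[of p q] rk_eqD[of q p] MsL that by force
  have rk_le: "p \<le> q" if "p \<in> M" "q \<in> M" "rk p \<le> rk q" for p q
    using Mch[OF that(1,2)] rk_eqD[of q p] MsL that by force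
  have all_ranks: "\<exists>p\<in>M. rk p = j" if j: "j \<le> rk c" for j
  proof (rule ccontr)
    assume no: "\<not> (\<exists>p\<in>M. rk p = j)"
    define A where "A = {p \<in> M. rk p < j}"
    define B where "B = {p \<in> M. j < rk p}"
    have "0 < j" using no MC(2) rk_bottom by (metis gr0I)
    then have "bottom \<in> A" using MC by (simp add: A_def)
    moreover have "finite (rk ` A)" using Mfin by (simp add: A_def)
    ultimately obtain a where a: "a \<in> A" "rk a = Max (rk ` A)"
      by (metis (no_types, lifting) Max_in empty_iff imageE image_is_empty)
    have a': "\<And>p. p \<in> A \<Longrightarrow> rk p \<le> rk a" using a \<open>finite (rk ` A)\<close> by simp
    have "c \<in> B" using MC c j no unfolding B_def by (metis (mono_tags, lifting) le_neq_implies_less mem_Collect_eq subset_eq)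
    moreover have "finite (rk ` B)" using Mfin by (simp add: B_def)
    ultimately obtain b where b: "b \<in> B" "rk b = Min (rk ` B)"
      by (metis (no_types, lifting) Min_in empty_iff imageE image_is_empty)
    have b': "\<And>p. p \<in> B \<Longrightarrow> rk b \<le> rk p" using b \<open>finite (rk ` B)\<close> by simp
    have ab: "a \<in> M" "b \<in> M" "rk a < j" "j < rk b" using a b by (auto simp: A_def B_def)
    then have "a \<le> b" "a \<noteq> b" using rk_le by auto
    then have "a < b" by simp
    then obtain u where u: "u \<in> L" "a < u" "u \<le> b" "r u = r a + 1"
      using ex_cover ab MsL by metis
    have rku: "rk u = rk a + 1" using u int_rk[of u] int_rk[of a] MsL ab by simp
    have "u \<noteq> b" using rku ab by auto
    have cmp: "p \<le> a \<or> b \<le> p" if "p \<in> M" for p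
    proof -
      have "p \<in> A \<or> p \<in> B" using that no linorder_neqE_nat[of "rk p" j] by (auto simp: A_def B_def)
      then show ?thesis using a' b' ab rk_le that by blast
    qed
    have "u \<notin> M" using cmp[of u] u \<open>u \<noteq> b\<close> by (meson leD order_antisym_conv)
    have "insert u M \<in> \<M>"
    proof -
      have "u \<le> c" using u ab MsL by (meson order_trans)
      moreover have "Complete_Partial_Order.chain (\<le>) (insert u M)"
        unfolding Complete_Partial_Order.chain_def
        using Mch cmp u by (auto) (meson order_trans less_imp_le)+
      ultimately show ?thesis using M(1) u unfolding \<M>_def by auto
    qed
    then have "card (insert u M) \<le> card M" using M by blast
    then show False using \<open>u \<notin> M\<close> Mfin by simp
  qed
  define k where "k j = (SOME p. p \<in> M \<and> rk p = j)" for j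
  have k: "k j \<in> M \<and> rk (k j) = j" if "j \<le> rk c" for j
    unfolding k_def by (rule someI_ex) (use all_ranks[OF that] in blast)
  have "flag (rk c) k"
    unfolding flag_def using k MsL rk_le by auto
  moreover have "k (rk p) = p" if "p \<in> C" for p
  proof -
    have "p \<in> M" "rk p \<le> rk c" using that MC c C rk_mono[of p c] cL by auto
    then show ?thesis using rk_inj k by blast
  qed
  ultimately show ?thesis using that by blast
qed

lemma jumps_sub: "jumps n k q \<subseteq> {1..n}"
  unfolding jumps_def by auto

lemma finite_jumps [simp]: "finite (jumps n k q)"
  using finite_subset[OF jumps_sub] by auto

lemma jumps_mono:
  assumes "flag n k" "p \<in> L" "q \<in> L" "p \<le> q"
  shows "jumps n k p \<subseteq> jumps n k q"
proof -
  have "p \<sqinter> k i \<le> q \<sqinter> k i" if "i \<le> n" for i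
    using assms that by (intro meet_mono) (auto intro: flag_in)
  then show ?thesis unfolding jumps_def by (auto dest: order_trans)
qed

text \<open>By modularity, the join of \<open>q \<sqinter> k (i + 1)\<close> with \<open>k i\<close> lies between \<open>k i\<close> and its cover \<open>k (i + 1)\<close>,
  so the meet of \<open>q\<close> with the flag grows by at most one rank in each step. The jumps are the steps at
  which it does.\<close>

lemma rk_meet_flag_step:
  assumes "flag n k" "q \<in> L" "i < n"
  shows "rk (q \<sqinter> k (Suc i)) = rk (q \<sqinter> k i) + (if Suc i \<in> jumps n k q then 1 else 0)"
proof -
  have k: "k i \<in> L" "k (Suc i) \<in> L" "k i \<le> k (Suc i)" "rk (k i) = i" "rk (k (Suc i)) = Suc i"
    using assms flag_in[of n k] flag_rk[of n k] flag_mono[of n k i "Suc i"] by auto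
  define a where "a = q \<sqinter> k (Suc i)"
  have a: "a \<in> L" "a \<le> k (Suc i)" "a \<le> q" using k assms by (auto simp: a_def)
  have am: "a \<sqinter> k i = q \<sqinter> k i"
    using meet_assoc[of q "k (Suc i)" "k i"] meet_absorb2[of "k i" "k (Suc i)"] k assms
    by (simp add: a_def)
  have c: "compat a (k i)" using a k compatI by blast
  show ?thesis
  proof (cases "a \<le> k i")
    case True
    then have "a = q \<sqinter> k i" using am meet_absorb1 a k by metis
    moreover have "Suc i \<notin> jumps n k q" using True by (auto simp: jumps_def a_def)
    ultimately show ?thesis by (simp add: a_def)
  next
    case False
    have j: "k i \<le> a \<squnion> k i" "a \<le> a \<squnion> k i" "a \<squnion> k i \<in> L"
      using join_ge1[OF a(1) k(1) c] join_ge2[OF a(1) k(1) c] join_in[OF a(1) k(1) c] by auto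
    have "a \<squnion> k i \<le> k (Suc i)" using a k by (intro join_least) auto
    moreover have "k i < a \<squnion> k i" using False j by (metis order_le_less)
    ultimately have "rk (k i) < rk (a \<squnion> k i)" "rk (a \<squnion> k i) \<le> rk (k (Suc i))"
      using rk_strict[OF k(1) j(3)] rk_mono[OF j(3) k(2)] by auto
    then have "rk (a \<squnion> k i) = Suc i" using k by auto
    then have "rk a = rk (q \<sqinter> k i) + 1"
      using rk_join_meet[OF a(1) k(1) c] am k by simp
    moreover have "Suc i \<in> jumps n k q" using False assms by (auto simp: jumps_def a_def)
    ultimately show ?thesis by (simp add: a_def)
  qed
qed

lemma card_jumps_Int:
  assumes "flag n k" "q \<in> L" "i \<le> n"
  shows "card (jumps n k q \<inter> {1..i}) = rk (q \<sqinter> k i)"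
  using assms(3)
proof (induction i)
  case 0
  have "q \<sqinter> k 0 = bottom"
    using flag_0[OF assms(1)] assms by (simp add: meet_absorb2)
  then show ?case by simp
next
  case (Suc i)
  have eq: "jumps n k q \<inter> {1..Suc i} = (if Suc i \<in> jumps n k q then {Suc i} else {}) \<union> (jumps n k q \<inter> {1..i})"
    by (auto simp: le_Suc_eq)
  show ?case
    using rk_meet_flag_step[OF assms(1,2), of i] Suc unfolding eq by auto
qed

lemma card_jumps: "flag n k \<Longrightarrow> q \<in> L \<Longrightarrow> card (jumps n k q) = rk (q \<sqinter> k n)"
  using card_jumps_Int[of n k q n] jumps_sub[of n k q] by (simp add: Int_absorb2)

lemma card_jumps_below: "flag n k \<Longrightarrow> q \<in> L \<Longrightarrow> q \<le> k n \<Longrightarrow> card (jumps n k q) = rk q"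
  using card_jumps[of n k q] meet_absorb1[of q "k n"] by (simp add: flag_in)

lemma jumps_meet_flag:
  assumes "flag n k" "q \<in> L" "j \<le> n"
  shows "jumps n k (q \<sqinter> k j) = jumps n k q \<inter> {1..j}"
proof -
  have kj: "k j \<in> L" using assms flag_in by auto
  have "i \<in> jumps n k (q \<sqinter> k j) \<longleftrightarrow> i \<in> jumps n k q \<inter> {1..j}" for i
  proof (cases "i \<in> {1..n}")
    case True
    then have ki: "k i \<in> L" using assms flag_in by auto
    show ?thesis
    proof (cases "i \<le> j")
      case le: True
      have "q \<sqinter> k j \<sqinter> k i = q \<sqinter> k i"
        using meet_assoc[of q "k j" "k i"] meet_absorb2[of "k i" "k j"] flag_mono[of n k i j] assms le kj ki by simp
      then show ?thesis using True le by (auto simp: jumps_def)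
    next
      case False
      have "q \<sqinter> k j \<sqinter> k i \<le> k j" using assms kj ki by (meson meet_in meet_le1 meet_le2 order_trans)
      also have "k j \<le> k (i - 1)" using False True assms by (intro flag_mono) auto
      finally show ?thesis using False by (auto simp: jumps_def)
    qed
  qed (auto simp: jumps_def)
  then show ?thesis by blast
qed

lemma jumps_flag:
  assumes "flag n k" "j \<le> n"
  shows "jumps n k (k j) = {1..j}"
proof -
  have kn: "k n \<in> L" using assms flag_in by auto
  have "jumps n k (k n) = {1..n}"
    using card_subset_eq[OF _ jumps_sub] card_jumps_below[OF assms(1) kn] flag_rk[OF assms(1)] by simp
  moreover have "k n \<sqinter> k j = k j"
    using assms by (intro meet_absorb2) (auto intro: flag_in flag_mono)
  ultimately show ?thesis
    using jumps_meet_flag[OF assms(1) kn assms(2)] assms(2) by auto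
qed

lemma jumps_meet_top:
  "flag n k \<Longrightarrow> q \<in> L \<Longrightarrow> jumps n k (q \<sqinter> k n) = jumps n k q"
  using jumps_meet_flag[of n k q n] jumps_sub[of n k q] by (simp add: Int_absorb2)

lemma jumps_meet_sub:
  assumes "flag n k" "p \<in> L" "q \<in> L"
  shows "jumps n k (p \<sqinter> q) \<subseteq> jumps n k p \<inter> jumps n k q"
  using jumps_mono[of n k "p \<sqinter> q" p] jumps_mono[of n k "p \<sqinter> q" q] assms by auto

text \<open>Two chains in a modular lattice generate a distributive sublattice. For the flag and a second
  chain this means that jump sets turn joins of meets into unions of intersections. The point is that
  jump sets also respect the meet of \<open>A\<close> and \<open>B\<close> in the induction step: a common jump of both is
  already a jump of a generator below both. The ranks of \<open>A\<close>, \<open>B\<close> and \<open>A \<sqinter> B\<close> then determine the rank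
  of \<open>A \<squnion> B\<close>, which leaves no room for a further jump.\<close>

lemma jumps_lub_two_chains:
  assumes k: "flag n k" and G: "finite G" "G \<subseteq> {..n} \<times> D"
    and D: "D \<subseteq> L" "Complete_Partial_Order.chain (\<le>) D"
  shows "jumps n k (lub ((\<lambda>(i, q). k i \<sqinter> q) ` G)) = (\<Union>(i, q)\<in>G. {1..i} \<inter> jumps n k q)"
  using G
proof (induction "card G" arbitrary: G)
  case 0
  then have "G = {}" by simp
  then show ?case using jumps_flag[OF k, of 0] flag_0[OF k] by (simp add: lub_empty)
next
  case (Suc N)
  define h where "h = (\<lambda>(i, q). k i \<sqinter> q)"
  have hJ: "jumps n k (h (i, q)) = {1..i} \<inter> jumps n k q" if "i \<le> n" "q \<in> D" for i q
    using jumps_meet_flag[OF k, of q i] that D unfolding h_def by (auto simp: meet_commute)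
  have hL: "h g \<in> L" if "g \<in> {..n} \<times> D" for g
    using that D k flag_in unfolding h_def by auto
  have hb: "h g \<le> k n" if g: "g \<in> {..n} \<times> D" for g
  proof -
    obtain i q where "g = (i, q)" "i \<le> n" "q \<in> D" "q \<in> L" using g D by auto
    then show ?thesis
      using order_trans[OF meet_le1[of "k i" q] flag_mono[OF k, of i n]] flag_in[OF k, of i]
      unfolding h_def by simp
  qed
  have knL: "k n \<in> L" using k flag_in by auto
  have Lub: "isLub L (h ` G') (lub (h ` G'))" "lub (h ` G') \<le> k n" if "G' \<subseteq> G" for G'
  proof -
    have "G' \<subseteq> {..n} \<times> D" using that Suc.prems by blast
    then have "finite (h ` G')" "h ` G' \<subseteq> L" "\<And>s. s \<in> h ` G' \<Longrightarrow> s \<le> k n"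
      using finite_subset[OF that Suc.prems(1)] hL hb by blast+
    then show "isLub L (h ` G') (lub (h ` G'))" "lub (h ` G') \<le> k n"
      using isLub_lub[of "h ` G'" "k n"] lub_least[of "h ` G'" "k n"] knL by auto
  qed
  have Dch: "p \<in> D \<Longrightarrow> q \<in> D \<Longrightarrow> p \<le> q \<or> q \<le> p" for p q
    using D unfolding Complete_Partial_Order.chain_def by blast
  have "snd ` G \<subseteq> D" "finite (snd ` G)" "snd ` G \<noteq> {}" using Suc by auto
  \<comment> \<open>The generator to be split off has the greatest element of the second chain, so that the other
    generators with a common jump can be moved below it.\<close>
  then obtain q where q: "q \<in> snd ` G" "\<And>q'. q' \<in> snd ` G \<Longrightarrow> q' \<le> q"
  proof -
    obtain q where "q \<in> snd ` G" "\<And>q'. q' \<in> snd ` G \<Longrightarrow> q \<le> q' \<Longrightarrow> q' = q"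
      using finite_has_maximal[OF \<open>finite (snd ` G)\<close> \<open>snd ` G \<noteq> {}\<close>] by metis
    moreover have "q' \<le> q" if "q' \<in> snd ` G" for q'
    proof -
      have "q \<in> D" "q' \<in> D" using calculation(1) that \<open>snd ` G \<subseteq> D\<close> by blast+
      then show ?thesis using Dch[of q q'] calculation(2)[OF that] by auto
    qed
    ultimately show ?thesis using that by blast
  qed
  then obtain i where iq: "(i, q) \<in> G" by auto
  define G' where "G' = G - {(i, q)}"
  have G': "G = insert (i, q) G'" "finite G'" "card G' = N" "G' \<subseteq> {..n} \<times> D" "G' \<subseteq> G"
    using iq Suc.hyps(2) Suc.prems unfolding G'_def by auto
  have iq': "i \<le> n" "q \<in> D" "q \<in> L" using iq Suc.prems(2) D by auto
  define A where "A = lub (h ` G')"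
  define B where "B = h (i, q)"
  have AL: "A \<in> L" "A \<le> k n" and Aup: "\<And>g. g \<in> G' \<Longrightarrow> h g \<le> A"
    using Lub[OF G'(5)] unfolding A_def isLub_alt by auto
  have BL: "B \<in> L" "B \<le> k n" using hL[of "(i,q)"] hb[of "(i,q)"] iq' unfolding B_def by auto
  have JA: "jumps n k A = (\<Union>(i, q)\<in>G'. {1..i} \<inter> jumps n k q)"
    unfolding A_def h_def using Suc(1)[of G'] G' by simp
  have JB: "jumps n k B = {1..i} \<inter> jumps n k q" unfolding B_def using hJ iq' by auto
  have comp: "compat A B" using AL BL knL compatI by blast
  have lubG: "lub (h ` G) = A \<squnion> B"
  proof -
    have "lub (h ` G' \<union> {B}) = lub (h ` G') \<squnion> lub {B}"
      using hL hb subsetD[OF G'(4)] G'(2) BL knL by (intro lub_Un[of _ _ "k n"]) auto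
    moreover have "h ` G' \<union> {B} = h ` G" using G'(1) B_def by auto
    ultimately show ?thesis using lub_singleton[OF BL(1)] by (simp add: A_def)
  qed
  have JAB: "jumps n k (A \<sqinter> B) = jumps n k A \<inter> jumps n k B"
  proof
    show "jumps n k (A \<sqinter> B) \<subseteq> jumps n k A \<inter> jumps n k B" using jumps_meet_sub k AL BL by auto
    show "jumps n k A \<inter> jumps n k B \<subseteq> jumps n k (A \<sqinter> B)"
    proof
      fix l assume l: "l \<in> jumps n k A \<inter> jumps n k B"
      then obtain i' q' where g: "(i', q') \<in> G'" "l \<le> i'" "l \<in> jumps n k q'" "1 \<le> l"
        unfolding JA by auto
      have li: "l \<le> i" "l \<in> jumps n k q" using l JB by auto
      have g': "i' \<le> n" "q' \<in> D" "q' \<in> L" "q' \<le> q" 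
        using g G'(1,4) D q(2)[of q'] by (auto simp: rev_image_eqI)
      define w where "w = h (min i i', q')"
      have "l \<in> jumps n k w" unfolding w_def using hJ[of "min i i'" q'] g' g li iq' by auto
      moreover have "w \<le> A \<sqinter> B"
      proof -
        have wL: "w \<in> L" unfolding w_def using g' iq' by (intro hL) auto
        have "k (min i i') \<le> k i'" "k (min i i') \<le> k i" "k (min i i') \<in> L" "k i \<in> L" "k i' \<in> L"
          using g' iq' flag_in[OF k] flag_mono[OF k] by auto
        then have "w \<le> h (i', q')" "w \<le> B"
          unfolding w_def B_def h_def prod.case using g' iq' by (blast intro: meet_mono)+
        then show ?thesis using Aup[OF g(1)] wL AL BL by (auto intro: meet_greatest order_trans)
      qed
      moreover have "w \<in> L" unfolding w_def using g' iq' by (intro hL) auto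
      ultimately show "l \<in> jumps n k (A \<sqinter> B)" using jumps_mono[OF k, of w "A \<sqinter> B"] AL BL by auto
    qed
  qed
  have jL: "A \<squnion> B \<in> L" "A \<squnion> B \<le> k n" "A \<le> A \<squnion> B" "B \<le> A \<squnion> B"
    using join_in[OF _ _ comp] join_least[of A B "k n"] join_ge1[OF _ _ comp] join_ge2[OF _ _ comp] AL BL knL by auto
  have mL: "A \<sqinter> B \<in> L" "A \<sqinter> B \<le> k n" using AL BL by (auto intro: order_trans[OF meet_le1])
  have "card (jumps n k A \<union> jumps n k B) = card (jumps n k (A \<squnion> B))"
  proof -
    have "card (jumps n k A \<union> jumps n k B) + card (jumps n k (A \<sqinter> B)) = card (jumps n k A) + card (jumps n k B)"
      unfolding JAB using card_Un_Int[of "jumps n k A" "jumps n k B"] by simp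
    then have "card (jumps n k A \<union> jumps n k B) + rk (A \<sqinter> B) = rk A + rk B"
      using card_jumps_below[OF k] AL BL mL by simp
    then show ?thesis using rk_join_meet[OF AL(1) BL(1) comp] card_jumps_below[OF k jL(1,2)] by simp
  qed
  moreover have "jumps n k A \<union> jumps n k B \<subseteq> jumps n k (A \<squnion> B)"
    using jumps_mono[OF k] AL BL jL by blast
  ultimately have "jumps n k (A \<squnion> B) = jumps n k A \<union> jumps n k B"
    using card_subset_eq[OF finite_jumps, of "jumps n k A \<union> jumps n k B" n k "A \<squnion> B"] by simp
  then have "jumps n k (lub (h ` G)) = (\<Union>(i, q)\<in>G. {1..i} \<inter> jumps n k q)"
    unfolding lubG JA JB using G'(1) by auto
  then show ?case unfolding h_def .
qed

end

section \<open>The orthoscheme metric in coordinates\<close>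

text \<open>The squared norm of a combination of indicator functions only depends on the sizes of the
  pairwise intersections. Along a chain of sets these are the sizes of the sets themselves, which is
  why every rank-preserving labelling of a chain by sets computes the same distance.\<close>

lemma sum_square_labels:
  fixes w :: "'a \<Rightarrow> real"
  assumes "finite \<Omega>" "finite C" "\<And>p. p \<in> C \<Longrightarrow> lab p \<subseteq> \<Omega>"
  shows "(\<Sum>\<omega>\<in>\<Omega>. (\<Sum>p\<in>C. w p * of_bool (\<omega> \<in> lab p))\<^sup>2)
       = (\<Sum>p\<in>C. \<Sum>q\<in>C. w p * w q * real (card (lab p \<inter> lab q)))"
proof -
  have card: "real (card (lab p \<inter> lab q)) = (\<Sum>\<omega>\<in>\<Omega>. of_bool (\<omega> \<in> lab p) * of_bool (\<omega> \<in> lab q))"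
    if "p \<in> C" "q \<in> C" for p q
  proof -
    have "(\<Sum>\<omega>\<in>\<Omega>. of_bool (\<omega> \<in> lab p) * of_bool (\<omega> \<in> lab q) :: real) = (\<Sum>\<omega>\<in>\<Omega>. of_bool (\<omega> \<in> lab p \<inter> lab q))"
      by (intro sum.cong) auto
    also have "\<dots> = real (card (\<Omega> \<inter> (lab p \<inter> lab q)))"
      using assms(1) by (simp add: sum_of_bool_eq Int_def)
    also have "\<Omega> \<inter> (lab p \<inter> lab q) = lab p \<inter> lab q" using assms(3)[OF that(1)] by blast
    finally show ?thesis by simp
  qed
  have "(\<Sum>\<omega>\<in>\<Omega>. (\<Sum>p\<in>C. w p * of_bool (\<omega> \<in> lab p))\<^sup>2)
      = (\<Sum>\<omega>\<in>\<Omega>. \<Sum>p\<in>C. \<Sum>q\<in>C. w p * w q * (of_bool (\<omega> \<in> lab p) * of_bool (\<omega> \<in> lab q)))"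
    by (simp add: power2_eq_square sum_product mult_ac)
  also have "\<dots> = (\<Sum>p\<in>C. \<Sum>q\<in>C. \<Sum>\<omega>\<in>\<Omega>. w p * w q * (of_bool (\<omega> \<in> lab p) * of_bool (\<omega> \<in> lab q)))"
    by (subst sum.swap) (intro sum.cong refl, rule sum.swap)
  also have "\<dots> = (\<Sum>p\<in>C. \<Sum>q\<in>C. w p * w q * real (card (lab p \<inter> lab q)))"
    by (intro sum.cong refl) (simp add: card sum_distrib_left)
  finally show ?thesis .
qed

lemma card_Int_chain_labels:
  assumes "p \<le> q \<or> q \<le> p" "p \<le> q \<Longrightarrow> lab p \<subseteq> lab q" "q \<le> p \<Longrightarrow> lab q \<subseteq> lab p"
    "finite (lab p)" "finite (lab q)"
  shows "card (lab p \<inter> lab q) = min (card (lab p)) (card (lab q))"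
proof -
  consider "lab p \<subseteq> lab q" | "lab q \<subseteq> lab p" using assms by blast
  then show ?thesis
  proof cases
    case 1
    then show ?thesis using card_mono[OF assms(5) 1] by (simp add: Int_absorb2)
  next
    case 2
    then show ?thesis using card_mono[OF assms(4) 2] by (simp add: Int_absorb1)
  qed
qed

definition supp :: "('a \<Rightarrow> real) \<Rightarrow> 'a set" where
  "supp x = {p. x p \<noteq> 0}"

definition mass :: "('a \<Rightarrow> real) \<Rightarrow> ('a \<Rightarrow> bool) \<Rightarrow> real" where
  "mass x P = (\<Sum>p\<in>supp x. x p * of_bool (P p))"

lemma mass_eq_sum: "finite C \<Longrightarrow> supp x \<subseteq> C \<Longrightarrow> mass x P = (\<Sum>p\<in>C. x p * of_bool (P p))"
  unfolding mass_def by (rule sum.mono_neutral_left) (auto simp: supp_def)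

lemma mass_cong: "(\<And>p. p \<in> supp x \<Longrightarrow> P p = Q p) \<Longrightarrow> mass x P = mass x Q"
  unfolding mass_def by (intro sum.cong) auto

lemma mass_False [simp]: "mass x (\<lambda>p. False) = 0"
  unfolding mass_def by simp

lemma chain_subset: "Complete_Partial_Order.chain R C \<Longrightarrow> D \<subseteq> C \<Longrightarrow> Complete_Partial_Order.chain R D"
  unfolding Complete_Partial_Order.chain_def by blast

context modular_semilattice_finite_rank
begin

abbreviation K :: "('a \<Rightarrow> real) set" where
  "K \<equiv> orthoscheme_complex L"

lemma K_iff: "x \<in> K \<longleftrightarrow> supp x \<subseteq> L \<and> finite (supp x) \<and> supp x \<noteq> {} \<and>
    Complete_Partial_Order.chain (\<le>) (supp x) \<and> (\<forall>p. 0 \<le> x p) \<and> (\<Sum>p\<in>supp x. x p) = 1"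
  unfolding orthoscheme_complex_def finite_chains_def supp_def by auto

lemma K_supp: "x \<in> K \<Longrightarrow> supp x \<subseteq> L" "x \<in> K \<Longrightarrow> finite (supp x)" "x \<in> K \<Longrightarrow> supp x \<noteq> {}"
  "x \<in> K \<Longrightarrow> Complete_Partial_Order.chain (\<le>) (supp x)" "x \<in> K \<Longrightarrow> 0 \<le> x p"
  unfolding K_iff by auto

lemma K_pos: "x \<in> K \<Longrightarrow> p \<in> supp x \<Longrightarrow> 0 < x p"
  using K_supp(5)[of x p] by (auto simp: supp_def)

lemma mass_nonneg: "x \<in> K \<Longrightarrow> 0 \<le> mass x P"
  unfolding mass_def by (intro sum_nonneg) (auto simp: K_supp)

lemma mass_True: "x \<in> K \<Longrightarrow> mass x (\<lambda>p. True) = 1"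
  unfolding mass_def by (simp add: K_iff)

lemma mass_mono: "x \<in> K \<Longrightarrow> (\<And>p. p \<in> supp x \<Longrightarrow> P p \<Longrightarrow> Q p) \<Longrightarrow> mass x P \<le> mass x Q"
  unfolding mass_def by (intro sum_mono) (auto simp: K_supp)

lemma mass_pos: "x \<in> K \<Longrightarrow> p \<in> supp x \<Longrightarrow> P p \<Longrightarrow> 0 < mass x P"
  unfolding mass_def
  by (rule sum_pos2[of _ p]) (auto simp: K_supp K_pos)

text \<open>The definitions use the smallest chain that carries both points; the distance in any larger
  simplex is the same by \<open>simplex_dist_eq_sdist\<close>.\<close>

definition adjacent :: "('a \<Rightarrow> real) \<Rightarrow> ('a \<Rightarrow> real) \<Rightarrow> bool" where
  "adjacent x y \<longleftrightarrow> x \<in> K \<and> y \<in> K \<and> Complete_Partial_Order.chain (\<le>) (supp x \<union> supp y)"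

definition sdist :: "('a \<Rightarrow> real) \<Rightarrow> ('a \<Rightarrow> real) \<Rightarrow> real" where
  "sdist x y = simplex_dist r (supp x \<union> supp y) x y"

lemma adjacent_sym: "adjacent x y \<Longrightarrow> adjacent y x"
  unfolding adjacent_def by (simp add: Un_commute)

lemma adjacent_chain: "adjacent x y \<Longrightarrow> p \<in> supp x \<union> supp y \<Longrightarrow> q \<in> supp x \<union> supp y \<Longrightarrow> p \<le> q \<or> q \<le> p"
  unfolding adjacent_def Complete_Partial_Order.chain_def by blast

lemma adjacent_iff: "adjacent x y \<longleftrightarrow> (\<exists>C\<in>finite_chains L. x \<in> chain_simplex L C \<and> y \<in> chain_simplex L C)"
proof
  assume a: "adjacent x y"
  then have "supp x \<union> supp y \<in> finite_chains L"
    unfolding adjacent_def finite_chains_def K_iff by auto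
  moreover have "x \<in> chain_simplex L (supp x \<union> supp y)" "y \<in> chain_simplex L (supp x \<union> supp y)"
    using a unfolding adjacent_def chain_simplex_def by (auto simp: supp_def)
  ultimately show "\<exists>C\<in>finite_chains L. x \<in> chain_simplex L C \<and> y \<in> chain_simplex L C" by blast
next
  assume "\<exists>C\<in>finite_chains L. x \<in> chain_simplex L C \<and> y \<in> chain_simplex L C"
  then obtain C where C: "C \<in> finite_chains L" "x \<in> K" "y \<in> K" "supp x \<union> supp y \<subseteq> C"
    unfolding chain_simplex_def supp_def by auto
  then show "adjacent x y"
    unfolding adjacent_def finite_chains_def using chain_subset by blast
qed

lemma finite_chain_least_greatest:
  assumes "C \<in> finite_chains L"
  shows "(LEAST q. q \<in> C) \<in> C" "\<And>p. p \<in> C \<Longrightarrow> (LEAST q. q \<in> C) \<le> p"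
    "(GREATEST q. q \<in> C) \<in> C" "\<And>p. p \<in> C \<Longrightarrow> p \<le> (GREATEST q. q \<in> C)"
proof -
  have C: "finite C" "C \<noteq> {}" and ch: "p \<in> C \<Longrightarrow> q \<in> C \<Longrightarrow> p \<le> q \<or> q \<le> p" for p q
    using assms unfolding finite_chains_def Complete_Partial_Order.chain_def by auto
  obtain a where a: "a \<in> C" "\<And>q. q \<in> C \<Longrightarrow> q \<le> a \<Longrightarrow> q = a"
    using finite_has_minimal[OF C] by metis
  have a': "a \<le> p" if "p \<in> C" for p using ch[OF that a(1)] a(2)[OF that] by auto
  have "(LEAST q. q \<in> C) = a" using a a' by (intro Least_equality) auto
  then show "(LEAST q. q \<in> C) \<in> C" "\<And>p. p \<in> C \<Longrightarrow> (LEAST q. q \<in> C) \<le> p" using a a' by auto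
  obtain b where b: "b \<in> C" "\<And>q. q \<in> C \<Longrightarrow> b \<le> q \<Longrightarrow> q = b"
    using finite_has_maximal[OF C] by metis
  have b': "p \<le> b" if "p \<in> C" for p using ch[OF that b(1)] b(2)[OF that] by auto
  have "(GREATEST q. q \<in> C) = b" using b b' by (intro Greatest_equality) auto
  then show "(GREATEST q. q \<in> C) \<in> C" "\<And>p. p \<in> C \<Longrightarrow> p \<le> (GREATEST q. q \<in> C)" using b b' by auto
qed

text \<open>The differences of the coefficients sum to zero. Hence the rank of the least element of the chain,
  from which the coordinates are counted, cancels from the inner products.\<close>

lemma simplex_dist_gram:
  assumes C: "C \<in> finite_chains L" and x: "x \<in> chain_simplex L C" and y: "y \<in> chain_simplex L C"
  shows "(simplex_dist r C x y)\<^sup>2 =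
    (\<Sum>p\<in>C. \<Sum>q\<in>C. (x p - y p) * (x q - y q) * real (min (rk p) (rk q)))"
proof -
  define b where "b = (LEAST q. q \<in> C)"
  define t where "t = (GREATEST q. q \<in> C)"
  note bt = finite_chain_least_greatest[OF C, folded b_def t_def]
  have fin: "finite C" and CL: "C \<subseteq> L" and ch: "p \<in> C \<Longrightarrow> q \<in> C \<Longrightarrow> p \<le> q \<or> q \<le> p" for p q
    using C unfolding finite_chains_def Complete_Partial_Order.chain_def by auto
  define w where "w p = x p - y p" for p
  define lab where "lab p = {1..r p - r b}" for p
  have xy: "x \<in> K" "y \<in> K" "supp x \<subseteq> C" "supp y \<subseteq> C"
    using x y unfolding chain_simplex_def supp_def by auto
  have w0: "(\<Sum>p\<in>C. w p) = 0"
  proof -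
    have "(\<Sum>p\<in>C. x p) = 1" "(\<Sum>p\<in>C. y p) = 1"
      using mass_eq_sum[OF fin xy(3), of "\<lambda>_. True"] mass_eq_sum[OF fin xy(4), of "\<lambda>_. True"] mass_True xy by auto
    then show ?thesis by (simp add: w_def sum_subtractf)
  qed
  have rmono: "r p \<le> r q" if "p \<in> C" "q \<in> C" "p \<le> q" for p q
  proof -
    have "p \<in> L" "q \<in> L" using that CL by auto
    then show ?thesis using rk_mono[of p q] int_rk[of p] int_rk[of q] that by simp
  qed
  have lab_card: "card (lab p) = rk p - rk b" "rk b \<le> rk p" if "p \<in> C" for p
  proof -
    have "int (rk p) = r p" "int (rk b) = r b" using int_rk CL that bt(1) by auto
    then show "card (lab p) = rk p - rk b" by (simp add: lab_def)
    show "rk b \<le> rk p" using rk_mono CL that bt by auto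
  qed
  have "(simplex_dist r C x y)\<^sup>2 = (\<Sum>j\<in>{1..r t - r b}. (\<Sum>p\<in>C. w p * of_bool (j \<in> lab p))\<^sup>2)"
    unfolding simplex_dist_def L2_set_def orthoscheme_map_def b_def[symmetric] t_def[symmetric]
    by (subst real_sqrt_pow2) (auto simp: sum_nonneg w_def lab_def indicator_def sum_subtractf[symmetric]
        left_diff_distrib of_bool_def intro!: sum.cong)
  also have "\<dots> = (\<Sum>p\<in>C. \<Sum>q\<in>C. w p * w q * real (card (lab p \<inter> lab q)))"
    using fin bt rmono by (intro sum_square_labels) (auto simp: lab_def)
  also have "\<dots> = (\<Sum>p\<in>C. \<Sum>q\<in>C. w p * w q * (real (min (rk p) (rk q)) - real (rk b)))"
  proof (intro sum.cong refl arg_cong2[where f = "(*)"])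
    fix p q assume pq: "p \<in> C" "q \<in> C"
    have "card (lab p \<inter> lab q) = min (card (lab p)) (card (lab q))"
      using ch[OF pq] rmono pq by (intro card_Int_chain_labels) (auto simp: lab_def)
    also have "\<dots> = min (rk p) (rk q) - rk b" using lab_card pq by simp
    finally show "real (card (lab p \<inter> lab q)) = real (min (rk p) (rk q)) - real (rk b)"
      using lab_card(2)[OF pq(1)] lab_card(2)[OF pq(2)] by simp
  qed
  also have "\<dots> = (\<Sum>p\<in>C. \<Sum>q\<in>C. w p * w q * real (min (rk p) (rk q))) - real (rk b) * ((\<Sum>p\<in>C. w p) * (\<Sum>q\<in>C. w q))"
    by (simp add: right_diff_distrib sum_subtractf sum_product sum_distrib_left mult_ac)
  finally show ?thesis unfolding w0 by (simp add: w_def)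
qed

lemma simplex_dist_nonneg: "0 \<le> simplex_dist r C x y"
  unfolding simplex_dist_def by simp

lemma simplex_dist_eq_sdist:
  assumes C: "C \<in> finite_chains L" and x: "x \<in> chain_simplex L C" and y: "y \<in> chain_simplex L C"
  shows "simplex_dist r C x y = sdist x y"
proof -
  define S where "S = supp x \<union> supp y"
  have a: "adjacent x y" using assms adjacent_iff by blast
  have S: "S \<in> finite_chains L" "x \<in> chain_simplex L S" "y \<in> chain_simplex L S"
    using a unfolding S_def adjacent_def finite_chains_def K_iff chain_simplex_def by (auto simp: supp_def)
  have SC: "S \<subseteq> C" "finite C" using assms unfolding S_def chain_simplex_def supp_def finite_chains_def by auto
  have z: "x p - y p = 0" if "p \<notin> S" for p using that unfolding S_def supp_def by auto
  have "(simplex_dist r C x y)\<^sup>2 = (simplex_dist r S x y)\<^sup>2"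
    unfolding simplex_dist_gram[OF assms] simplex_dist_gram[OF S]
    using SC z by (intro sum.mono_neutral_cong_right sum.mono_neutral_right ballI) auto
  then show ?thesis
    unfolding sdist_def S_def by (simp add: power2_eq_iff_nonneg simplex_dist_nonneg)
qed

lemma sdist_nonneg: "0 \<le> sdist x y"
  unfolding sdist_def by (rule simplex_dist_nonneg)

lemma mass_labels_gram:
  assumes a: "adjacent x y" and \<Omega>: "finite \<Omega>" "\<And>p. p \<in> supp x \<union> supp y \<Longrightarrow> lab p \<subseteq> \<Omega>"
    and mono: "\<And>p q. p \<in> supp x \<union> supp y \<Longrightarrow> q \<in> supp x \<union> supp y \<Longrightarrow> p \<le> q \<Longrightarrow> lab p \<subseteq> lab q"
  shows "(\<Sum>\<omega>\<in>\<Omega>. (mass x (\<lambda>p. \<omega> \<in> lab p) - mass y (\<lambda>p. \<omega> \<in> lab p))\<^sup>2) =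
    (\<Sum>p\<in>supp x \<union> supp y. \<Sum>q\<in>supp x \<union> supp y. (x p - y p) * (x q - y q) * real (min (card (lab p)) (card (lab q))))"
proof -
  define S where "S = supp x \<union> supp y"
  have S: "finite S" "supp x \<subseteq> S" "supp y \<subseteq> S"
    using a unfolding S_def adjacent_def K_iff by auto
  have "(\<Sum>\<omega>\<in>\<Omega>. (mass x (\<lambda>p. \<omega> \<in> lab p) - mass y (\<lambda>p. \<omega> \<in> lab p))\<^sup>2)
      = (\<Sum>\<omega>\<in>\<Omega>. (\<Sum>p\<in>S. (x p - y p) * of_bool (\<omega> \<in> lab p))\<^sup>2)"
    by (simp add: mass_eq_sum[OF S(1,2)] mass_eq_sum[OF S(1,3)] sum_subtractf left_diff_distrib)
  also have "\<dots> = (\<Sum>p\<in>S. \<Sum>q\<in>S. (x p - y p) * (x q - y q) * real (card (lab p \<inter> lab q)))"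
    using S \<Omega> unfolding S_def by (intro sum_square_labels) auto
  also have "\<dots> = (\<Sum>p\<in>S. \<Sum>q\<in>S. (x p - y p) * (x q - y q) * real (min (card (lab p)) (card (lab q))))"
  proof (intro sum.cong refl arg_cong2[where f = "(*)"] arg_cong[where f = real])
    fix p q assume pq: "p \<in> S" "q \<in> S"
    show "card (lab p \<inter> lab q) = min (card (lab p)) (card (lab q))"
      using adjacent_chain[OF a] pq mono[of p q] mono[of q p] finite_subset[OF \<Omega>(2) \<Omega>(1)] unfolding S_def
      by (intro card_Int_chain_labels) auto
  qed
  finally show ?thesis unfolding S_def .
qed

text \<open>The distance only depends on the inner products of the chain elements, so it can be computed with
  any monotone labels whose sizes are the ranks. The levels, for which an element is labelled by the
  initial segment up to its rank, are the simplest choice; jump sets along two flags are another one.\<close>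

lemma sdist_labels:
  assumes a: "adjacent x y" and \<Omega>: "finite \<Omega>" "\<And>p. p \<in> supp x \<union> supp y \<Longrightarrow> lab p \<subseteq> \<Omega>"
    and mono: "\<And>p q. p \<in> supp x \<union> supp y \<Longrightarrow> q \<in> supp x \<union> supp y \<Longrightarrow> p \<le> q \<Longrightarrow> lab p \<subseteq> lab q"
    and card: "\<And>p. p \<in> supp x \<union> supp y \<Longrightarrow> card (lab p) = rk p"
  shows "(sdist x y)\<^sup>2 = (\<Sum>\<omega>\<in>\<Omega>. (mass x (\<lambda>p. \<omega> \<in> lab p) - mass y (\<lambda>p. \<omega> \<in> lab p))\<^sup>2)"
proof -
  have S: "supp x \<union> supp y \<in> finite_chains L" "x \<in> chain_simplex L (supp x \<union> supp y)" "y \<in> chain_simplex L (supp x \<union> supp y)"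
    using a unfolding adjacent_def finite_chains_def K_iff chain_simplex_def by (auto simp: supp_def)
  show ?thesis
    using mass_labels_gram[OF a \<Omega> mono] simplex_dist_gram[OF S] card by (simp add: sdist_def)
qed

lemma adjacent_rank_bound:
  assumes "adjacent x y"
  obtains N where "\<And>p. p \<in> supp x \<union> supp y \<Longrightarrow> rk p \<le> N"
proof -
  have "finite (supp x \<union> supp y)" using assms unfolding adjacent_def K_iff by auto
  then show ?thesis using that[of "Max (rk ` (supp x \<union> supp y))"] by simp
qed

lemma sdist_levels:
  assumes a: "adjacent x y" and N: "\<And>p. p \<in> supp x \<union> supp y \<Longrightarrow> rk p \<le> N"
  shows "(sdist x y)\<^sup>2 = (\<Sum>j\<in>{1..N}. (mass x (\<lambda>p. j \<le> rk p) - mass y (\<lambda>p. j \<le> rk p))\<^sup>2)"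
proof -
  have L: "supp x \<union> supp y \<subseteq> L" using a unfolding adjacent_def K_iff by auto
  have "(sdist x y)\<^sup>2 = (\<Sum>j\<in>{1..N}. (mass x (\<lambda>p. j \<in> {1..rk p}) - mass y (\<lambda>p. j \<in> {1..rk p}))\<^sup>2)"
  proof (rule sdist_labels[OF a])
    fix p q assume "p \<in> supp x \<union> supp y" "q \<in> supp x \<union> supp y" "p \<le> q"
    then have "rk p \<le> rk q" using L by (intro rk_mono) blast+
    then show "{1..rk p} \<subseteq> {1..rk q}" by simp
  qed (use N in auto)
  also have "\<dots> = (\<Sum>j\<in>{1..N}. (mass x (\<lambda>p. j \<le> rk p) - mass y (\<lambda>p. j \<le> rk p))\<^sup>2)"
    by (intro sum.cong) auto
  finally show ?thesis .
qed

lemma sdist_sym: "adjacent x y \<Longrightarrow> sdist x y = sdist y x"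
proof -
  assume a: "adjacent x y"
  obtain N where N: "\<And>p. p \<in> supp x \<union> supp y \<Longrightarrow> rk p \<le> N" using adjacent_rank_bound[OF a] by blast
  have "(sdist x y)\<^sup>2 = (sdist y x)\<^sup>2"
    using sdist_levels[OF a N] sdist_levels[OF adjacent_sym[OF a], of N] N by (simp add: Un_commute power2_commute)
  then show ?thesis by (simp add: power2_eq_iff_nonneg sdist_nonneg)
qed

lemma mass_rk_eq:
  assumes "adjacent x y" "p \<in> supp x \<union> supp y"
  shows "x p = mass x (\<lambda>q. rk p \<le> rk q) - mass x (\<lambda>q. Suc (rk p) \<le> rk q)"
proof -
  define S where "S = supp x \<union> supp y"
  have S: "finite S" "supp x \<subseteq> S" "S \<subseteq> L"
    using assms unfolding S_def adjacent_def K_iff by auto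
  have "mass x (\<lambda>q. rk p \<le> rk q) - mass x (\<lambda>q. Suc (rk p) \<le> rk q) = (\<Sum>q\<in>S. x q * of_bool (q = p))"
    unfolding mass_eq_sum[OF S(1,2)] sum_subtractf[symmetric]
  proof (intro sum.cong refl)
    fix q assume q: "q \<in> S"
    have "rk p = rk q \<longleftrightarrow> q = p"
    proof
      assume eq: "rk p = rk q"
      have "p \<in> L" "q \<in> L" "p \<le> q \<or> q \<le> p"
        using adjacent_chain[OF assms(1), of p q] assms(2) q S(3) unfolding S_def by blast+
      then show "q = p" using rk_eqD[of p q] rk_eqD[of q p] eq by auto
    qed simp
    then show "x q * of_bool (rk p \<le> rk q) - x q * of_bool (Suc (rk p) \<le> rk q) = x q * of_bool (q = p)"
      by auto
  qed
  also have "\<dots> = (\<Sum>q\<in>S. if q = p then x q else 0)" by (intro sum.cong) auto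
  also have "\<dots> = x p" using assms(2) S(1) by (simp add: S_def)
  finally show ?thesis by simp
qed

lemma sdist_eq_0:
  assumes a: "adjacent x y" and 0: "sdist x y = 0"
  shows "x = y"
proof
  fix p
  obtain N where N: "\<And>p. p \<in> supp x \<union> supp y \<Longrightarrow> rk p \<le> N" using adjacent_rank_bound[OF a] by blast
  have xy: "x \<in> K" "y \<in> K" using a unfolding adjacent_def by auto
  have eq: "mass x (\<lambda>p. j \<le> rk p) = mass y (\<lambda>p. j \<le> rk p)" for j
  proof -
    consider "j = 0" | "j \<in> {1..N}" | "j > N" by fastforce
    then show ?thesis
    proof cases
      case 1 then show ?thesis using mass_True xy by simp
    next
      case 2
      have "(\<Sum>j\<in>{1..N}. (mass x (\<lambda>p. j \<le> rk p) - mass y (\<lambda>p. j \<le> rk p))\<^sup>2) = 0"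
        using sdist_levels[OF a N] 0 by simp
      then show ?thesis using 2 by (simp add: sum_nonneg_eq_0_iff)
    next
      case 3
      have "mass x (\<lambda>p. j \<le> rk p) = mass x (\<lambda>p. False)" "mass y (\<lambda>p. j \<le> rk p) = mass y (\<lambda>p. False)"
        using N 3 by (intro mass_cong; force)+
      then show ?thesis by simp
    qed
  qed
  show "x p = y p"
  proof (cases "p \<in> supp x \<union> supp y")
    case True
    then show ?thesis
      using mass_rk_eq[OF a True] mass_rk_eq[OF adjacent_sym[OF a], of p] eq by (simp add: Un_commute)
  qed (auto simp: supp_def)
qed

text \<open>The energy is the squared norm of the part of \<open>x\<close> below \<open>p\<close>. Its expression by ranks of meets does
  not refer to a flag through the support, and it inherits supermodularity from the rank.\<close>

definition energy :: "('a \<Rightarrow> real) \<Rightarrow> 'a \<Rightarrow> real" where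
  "energy x p = (\<Sum>a\<in>supp x. \<Sum>b\<in>supp x. x a * x b * real (rk (p \<sqinter> (a \<sqinter> b))))"

abbreviation level :: "('a \<Rightarrow> real) \<Rightarrow> nat \<Rightarrow> real" where
  "level x j \<equiv> mass x (\<lambda>q. j \<le> rk q)"

text \<open>In the coordinates of a flag through the support, the part of \<open>x\<close> below \<open>p\<close> consists of the levels of
  \<open>x\<close> at the jumps of \<open>p\<close>.\<close>

lemma energy_flag:
  assumes k: "flag n k" and x: "x \<in> K" "supp x \<subseteq> k ` {..n}" and p: "p \<in> L"
  shows "energy x p = (\<Sum>j\<in>jumps n k p. (level x j)\<^sup>2)"
proof -
  have "(\<Sum>j\<in>jumps n k p. (level x j)\<^sup>2)
      = (\<Sum>j\<in>jumps n k p. (\<Sum>q\<in>supp x. x q * of_bool (j \<in> jumps n k p \<inter> {1..rk q}))\<^sup>2)"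
    unfolding mass_def using jumps_sub[of n k p] by (intro sum.cong refl arg_cong[where f = "\<lambda>t. t\<^sup>2"]) auto
  also have "\<dots> = (\<Sum>a\<in>supp x. \<Sum>b\<in>supp x. x a * x b * real (card ((jumps n k p \<inter> {1..rk a}) \<inter> (jumps n k p \<inter> {1..rk b}))))"
    using K_supp[OF x(1)] by (intro sum_square_labels) auto
  also have "\<dots> = energy x p"
    unfolding energy_def
  proof (intro sum.cong refl arg_cong2[where f = "(*)"] arg_cong[where f = real])
    fix a b assume "a \<in> supp x" "b \<in> supp x"
    then have "a \<in> k ` {..n}" "b \<in> k ` {..n}" using x(2) by blast+
    then obtain i j where ij: "i \<le> n" "a = k i" "j \<le> n" "b = k j" by blast
    have "a \<sqinter> b = k (min i j)"
    proof (cases "i \<le> j")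
      case True
      then show ?thesis using ij flag_mono[OF k True] flag_in[OF k] meet_absorb1 by (simp add: min_def)
    next
      case False
      then show ?thesis using ij flag_mono[OF k, of j i] flag_in[OF k] meet_absorb2 by (simp add: min_def)
    qed
    moreover have "(jumps n k p \<inter> {1..rk a}) \<inter> (jumps n k p \<inter> {1..rk b}) = jumps n k p \<inter> {1..min i j}"
      using ij flag_rk[OF k] by auto
    ultimately show "card ((jumps n k p \<inter> {1..rk a}) \<inter> (jumps n k p \<inter> {1..rk b})) = rk (p \<sqinter> (a \<sqinter> b))"
      using card_jumps_Int[OF k p, of "min i j"] ij by simp
  qed
  finally show ?thesis by simp
qed

lemma energy_supermodular:
  assumes "x \<in> K" "p \<in> L" "q \<in> L" "compat p q"
  shows "energy x p + energy x q \<le> energy x (p \<squnion> q) + energy x (p \<sqinter> q)"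
  unfolding energy_def sum.distrib[symmetric] distrib_left[symmetric]
proof (intro sum_mono)
  fix a b assume ab: "a \<in> supp x" "b \<in> supp x"
  then have "a \<sqinter> b \<in> L" "0 \<le> x a * x b" using K_supp[OF assms(1)] by auto
  then show "x a * x b * (real (rk (p \<sqinter> (a \<sqinter> b))) + real (rk (q \<sqinter> (a \<sqinter> b))))
      \<le> x a * x b * (real (rk ((p \<squnion> q) \<sqinter> (a \<sqinter> b))) + real (rk ((p \<sqinter> q) \<sqinter> (a \<sqinter> b))))"
    using rk_supermodular[OF assms(2,3) _ assms(4), of "a \<sqinter> b"]
    by (intro mult_left_mono) (simp_all flip: of_nat_add)
qed

lemma energy_mono:
  assumes "x \<in> K" "p \<in> L" "q \<in> L" "p \<le> q"
  shows "energy x p \<le> energy x q"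
  unfolding energy_def
proof (intro sum_mono mult_left_mono)
  fix a b assume ab: "a \<in> supp x" "b \<in> supp x"
  then have *: "a \<in> L" "b \<in> L" "a \<sqinter> b \<in> L" using K_supp[OF assms(1)] by auto
  show "0 \<le> x a * x b" using K_supp[OF assms(1)] by simp
  show "real (rk (p \<sqinter> (a \<sqinter> b))) \<le> real (rk (q \<sqinter> (a \<sqinter> b)))"
    using assms * by (auto intro!: rk_mono meet_mono)
qed

lemma energy_strict_mono:
  assumes x: "x \<in> K" and p: "p \<in> L" "q \<in> L" "p < q" and c: "c \<in> supp x" "q \<le> c"
  shows "energy x p < energy x q"
proof -
  have cL: "c \<in> L" using c K_supp[OF x] by auto
  have le: "x a * x b * real (rk (p \<sqinter> (a \<sqinter> b))) \<le> x a * x b * real (rk (q \<sqinter> (a \<sqinter> b)))"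
    if "a \<in> supp x" "b \<in> supp x" for a b
  proof (intro mult_left_mono)
    have *: "a \<in> L" "b \<in> L" "a \<sqinter> b \<in> L" using K_supp[OF x] that by auto
    show "0 \<le> x a * x b" using K_supp[OF x] by simp
    show "real (rk (p \<sqinter> (a \<sqinter> b))) \<le> real (rk (q \<sqinter> (a \<sqinter> b)))"
      using p * by (auto intro!: rk_mono meet_mono)
  qed
  have eqs: "c \<sqinter> c = c" "p \<sqinter> c = p" "q \<sqinter> c = q"
    using cL p c meet_absorb1 by auto
  have lt: "x c * x c * real (rk (p \<sqinter> (c \<sqinter> c))) < x c * x c * real (rk (q \<sqinter> (c \<sqinter> c)))"
    unfolding eqs using rk_strict[OF p] K_pos[OF x c(1)] by simp
  show ?thesis
    unfolding energy_def
  proof (rule sum_strict_mono_ex1)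
    show "finite (supp x)" using K_supp[OF x] by simp
    show "\<forall>a\<in>supp x. (\<Sum>b\<in>supp x. x a * x b * real (rk (p \<sqinter> (a \<sqinter> b)))) \<le> (\<Sum>b\<in>supp x. x a * x b * real (rk (q \<sqinter> (a \<sqinter> b))))"
      using le by (auto intro: sum_mono)
    show "\<exists>a\<in>supp x. (\<Sum>b\<in>supp x. x a * x b * real (rk (p \<sqinter> (a \<sqinter> b)))) < (\<Sum>b\<in>supp x. x a * x b * real (rk (q \<sqinter> (a \<sqinter> b))))"
    proof (rule bexI[OF _ c(1)], rule sum_strict_mono_ex1)
      show "finite (supp x)" using K_supp[OF x] by simp
    qed (use le lt c in auto)
  qed
qed

lemma energy_meet_top:
  assumes "x \<in> K" "q \<in> L" "c \<in> L" "\<And>p. p \<in> supp x \<Longrightarrow> p \<le> c"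
  shows "energy x (q \<sqinter> c) = energy x q"
  unfolding energy_def
proof (intro sum.cong refl arg_cong2[where f = "(*)"] arg_cong[where f = "\<lambda>p. real (rk p)"])
  fix a b assume "a \<in> supp x" "b \<in> supp x"
  then have ab: "a \<in> L" "b \<in> L" "a \<sqinter> b \<in> L" "a \<le> c" using K_supp[OF assms(1)] assms(4) by auto
  then have "a \<sqinter> b \<le> c" by (meson meet_le1 order_trans)
  then show "q \<sqinter> c \<sqinter> (a \<sqinter> b) = q \<sqinter> (a \<sqinter> b)"
    using meet_assoc[of q c "a \<sqinter> b"] meet_absorb2[of "a \<sqinter> b" c] ab assms by simp
qed

end

section \<open>Optimal compatible pairs\<close>

text \<open>A pair \<open>v\<close> stands for the line with slope \<open>fst v\<close> and value \<open>snd v\<close> at \<open>0\<close>. At \<open>0\<close> the upper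
  envelope of the first family does not exceed that of the second, for large parameters it is not
  below it, and both are continuous, so they meet.\<close>

lemma envelopes_cross:
  fixes V1 V2 :: "(real \<times> real) set"
  assumes fin: "finite V1" "finite V2" and v1: "v1 \<in> V1" "\<And>v. v \<in> V2 \<Longrightarrow> fst v < fst v1"
    and v2: "v2 \<in> V2" "\<And>v. v \<in> V1 \<Longrightarrow> snd v \<le> snd v2"
  obtains t w1 w2 where "0 \<le> t" "w1 \<in> V1" "w2 \<in> V2"
    "\<And>v. v \<in> V1 \<union> V2 \<Longrightarrow> t * fst v + snd v \<le> t * fst w1 + snd w1"
    "\<And>v. v \<in> V1 \<union> V2 \<Longrightarrow> t * fst v + snd v \<le> t * fst w2 + snd w2"
proof -
  define h where "h t v = t * fst v + snd v" for t :: real and v :: "real \<times> real"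
  define H1 where "H1 t = Max (h t ` V1)" for t
  define H2 where "H2 t = Max (h t ` V2)" for t
  have ne: "V1 \<noteq> {}" "V2 \<noteq> {}" using v1 v2 by auto
  have cont_Max: "continuous_on UNIV (\<lambda>t. Max (h t ` V))" if "finite V" "V \<noteq> {}" for V
    using that
  proof (induction V rule: finite_ne_induct)
    case (singleton v)
    show ?case by (auto simp: h_def intro!: continuous_intros)
  next
    case (insert v V)
    have "Max (h t ` insert v V) = max (h t v) (Max (h t ` V))" for t
      using insert by (simp add: Max_insert)
    moreover have "continuous_on UNIV (\<lambda>t. max (h t v) (Max (h t ` V)))"
      by (rule continuous_on_max[OF _ insert.IH]) (auto simp: h_def intro!: continuous_intros)
    ultimately show ?case by simp
  qed
  have le: "h t v \<le> H1 t" if "v \<in> V1" for t v unfolding H1_def using that fin by simp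
  have le2: "h t v \<le> H2 t" if "v \<in> V2" for t v unfolding H2_def using that fin by simp
  have at: "\<exists>v\<in>V1. h t v = H1 t" for t
    using Max_in[of "h t ` V1"] fin ne unfolding H1_def by (metis (no_types, lifting) finite_imageI image_iff image_is_empty)
  have at2: "\<exists>v\<in>V2. h t v = H2 t" for t
    using Max_in[of "h t ` V2"] fin ne unfolding H2_def by (metis (no_types, lifting) finite_imageI image_iff image_is_empty)
  have zero: "H1 0 \<le> H2 0"
  proof -
    obtain v where "v \<in> V1" "h 0 v = H1 0" using at by blast
    then show ?thesis using v2(2)[of v] le2[OF v2(1), of 0] by (simp add: h_def)
  qed
  obtain T where T: "0 \<le> T" "H2 T \<le> H1 T"
  proof -
    define M where "M = Max ((\<lambda>v. (snd v - snd v1) / (fst v1 - fst v)) ` V2)"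
    have M: "(snd v - snd v1) / (fst v1 - fst v) \<le> M" if "v \<in> V2" for v
      unfolding M_def using that fin by simp
    have "H2 (max 0 M) \<le> H1 (max 0 M)"
    proof -
      obtain v where v: "v \<in> V2" "h (max 0 M) v = H2 (max 0 M)" using at2 by blast
      have pos: "0 < fst v1 - fst v" using v1(2)[OF v(1)] by simp
      have "(snd v - snd v1) / (fst v1 - fst v) \<le> max 0 M" using M[OF v(1)] by simp
      then have "snd v - snd v1 \<le> max 0 M * (fst v1 - fst v)"
        using pos by (simp add: pos_divide_le_eq)
      then have "h (max 0 M) v \<le> h (max 0 M) v1" by (simp add: h_def right_diff_distrib)
      then show ?thesis using v le[OF v1(1), of "max 0 M"] by simp
    qed
    then show ?thesis using that[of "max 0 M"] by simp
  qed
  have "continuous_on {0..T} (\<lambda>t. H1 t - H2 t)"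
    using cont_Max[OF fin(1) ne(1)] cont_Max[OF fin(2) ne(2)] unfolding H1_def H2_def
    by (intro continuous_on_diff) (auto intro: continuous_on_subset)
  then obtain t where t: "0 \<le> t" "H1 t - H2 t = 0"
    using IVT'[of "\<lambda>t. H1 t - H2 t" 0 0 T] zero T by auto
  obtain w1 where w1: "w1 \<in> V1" "h t w1 = H1 t" using at by blast
  obtain w2 where w2: "w2 \<in> V2" "h t w2 = H2 t" using at2 by blast
  show ?thesis
  proof (rule that[OF t(1) w1(1) w2(1)])
    fix v assume "v \<in> V1 \<union> V2"
    then have "h t v \<le> H1 t" "h t v \<le> H2 t" using le[of v t] le2[of v t] t(2) by auto
    then show "t * fst v + snd v \<le> t * fst w1 + snd w1" "t * fst v + snd v \<le> t * fst w2 + snd w2"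
      using w1(2) w2(2) by (simp_all add: h_def)
  qed
qed

context modular_semilattice_finite_rank
begin

text \<open>A flag through the support of a point identifies the point with its decreasing sequence of levels.\<close>

definition flagged :: "('a \<Rightarrow> real) \<Rightarrow> nat \<Rightarrow> (nat \<Rightarrow> 'a) \<Rightarrow> bool" where
  "flagged z n k \<longleftrightarrow> z \<in> K \<and> flag n k \<and> supp z \<subseteq> k ` {..n}"

lemma flagged_le: "flagged z n k \<Longrightarrow> p \<in> supp z \<Longrightarrow> p \<le> k n"
proof -
  assume a: "flagged z n k" "p \<in> supp z"
  then obtain i where "i \<le> n" "p = k i" unfolding flagged_def by blast
  then show ?thesis using flag_mono[of n k i n] a unfolding flagged_def by simp
qed

lemma ex_flagged:
  assumes "adjacent x y"
  obtains n k where "flagged x n k" "flagged y n k" "k n \<in> supp x \<union> supp y"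
proof -
  have xy: "x \<in> K" "y \<in> K" using assms unfolding adjacent_def by auto
  define S where "S = supp x \<union> supp y"
  have S: "finite S" "S \<noteq> {}" "S \<subseteq> L" "Complete_Partial_Order.chain (\<le>) S"
    using assms unfolding S_def adjacent_def K_iff by auto
  then have "S \<in> finite_chains L" unfolding finite_chains_def by auto
  note g = finite_chain_least_greatest(3,4)[OF this]
  define c where "c = (GREATEST q. q \<in> S)"
  obtain k where k: "flag (rk c) k" "\<And>p. p \<in> S \<Longrightarrow> k (rk p) = p"
    using ex_flag[OF S(3,4) g] unfolding c_def by blast
  have "S \<subseteq> k ` {..rk c}"
  proof
    fix p assume p: "p \<in> S"
    then have "rk p \<le> rk c" using g S(3) unfolding c_def by (intro rk_mono) auto
    then show "p \<in> k ` {..rk c}" using k(2)[OF p] by (intro image_eqI[of _ _ "rk p"]) auto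
  qed
  then have "flagged x (rk c) k" "flagged y (rk c) k" using k xy unfolding flagged_def S_def by auto
  moreover have "k (rk c) \<in> S" using k(2) g(1) unfolding c_def by simp
  ultimately show ?thesis using that unfolding S_def by blast
qed

lemma adjacent_self: "x \<in> K \<Longrightarrow> adjacent x x"
  unfolding adjacent_def using K_supp(4) by simp

lemma flagged_energy: "flagged z n k \<Longrightarrow> p \<in> L \<Longrightarrow> energy z p = (\<Sum>j\<in>jumps n k p. (level z j)\<^sup>2)"
  unfolding flagged_def using energy_flag by blast

end

text \<open>The point at which the complex is developed, with a flag through its support.\<close>

locale base_point = modular_semilattice_finite_rank L r for L :: "'a::order set" and r +
  fixes m :: "'a \<Rightarrow> real" and n :: nat and k :: "nat \<Rightarrow> 'a"
  assumes m_flagged: "flagged m n k" and top_supp: "k n \<in> supp m"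
begin

abbreviation c :: 'a where "c \<equiv> k n"
abbreviation J :: "'a \<Rightarrow> nat set" where "J \<equiv> jumps n k"

lemma mK: "m \<in> K" and flag_k: "flag n k"
  using m_flagged unfolding flagged_def by auto

lemma cL: "c \<in> L"
  using flag_in[OF flag_k] by simp

lemma level_m_pos: "i \<le> n \<Longrightarrow> 0 < level m i"
  using mass_pos[OF mK top_supp] flag_rk[OF flag_k, of n] by simp

text \<open>For a point \<open>z\<close> and a parameter \<open>t\<close>, an optimal pair is the best choice of a part of \<open>m\<close> and a part of
  \<open>z\<close> that fit together. Small parameters favour \<open>z\<close>, large ones favour \<open>m\<close>.\<close>

definition feasible :: "'a \<Rightarrow> 'a \<Rightarrow> bool" where
  "feasible p q \<longleftrightarrow> p \<in> L \<and> q \<in> L \<and> p \<le> c \<and> compat p q"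

definition optimal :: "('a \<Rightarrow> real) \<Rightarrow> real \<Rightarrow> 'a \<Rightarrow> 'a \<Rightarrow> bool" where
  "optimal z t p q \<longleftrightarrow> feasible p q \<and>
    (\<forall>p' q'. feasible p' q' \<longrightarrow> t * energy m p' + energy z q' \<le> t * energy m p + energy z q)"

lemma optimalD: "optimal z t p q \<Longrightarrow> feasible p' q' \<Longrightarrow> t * energy m p' + energy z q' \<le> t * energy m p + energy z q"
  unfolding optimal_def by blast

lemma energy_m: "p \<in> L \<Longrightarrow> energy m p = (\<Sum>i\<in>J p. (level m i)\<^sup>2)"
  using flagged_energy[OF m_flagged] .

lemma energy_m_strict: "p \<in> L \<Longrightarrow> q \<in> L \<Longrightarrow> p < q \<Longrightarrow> q \<le> c \<Longrightarrow> energy m p < energy m q"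
  using energy_strict_mono[OF mK _ _ _ top_supp] by blast

lemma optimal_meet_top:
  assumes "optimal z t p q" "flagged z n' k'"
  shows "optimal z t p (q \<sqinter> k' n')"
proof -
  have z: "z \<in> K" "k' n' \<in> L" using assms(2) flag_in unfolding flagged_def by auto
  have f: "feasible p q" using assms(1) unfolding optimal_def by blast
  then have "feasible p (q \<sqinter> k' n')"
    using z unfolding feasible_def by (auto intro: compat_mono)
  moreover have "energy z (q \<sqinter> k' n') = energy z q"
    using f z flagged_le[OF assms(2)] unfolding feasible_def by (intro energy_meet_top) auto
  ultimately show ?thesis using assms(1) unfolding optimal_def by auto
qed

text \<open>Compatible pairs form a lattice under the order that is reversed in the second component: this
  is where the condition on joins of three elements is used. The objective is supermodular on it, so optimal pairs can be
  combined, and they move monotonically with the parameter.\<close>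

lemma optimal_combine:
  assumes z: "flagged z n' k'" and 1: "optimal z t p q" and 2: "optimal z t' p' q'"
    and le: "0 \<le> t" "t \<le> t'" and q: "q \<le> k' n'" "q' \<le> k' n'"
  shows "optimal z t' (p \<squnion> p') (q \<sqinter> q')" "optimal z t (p \<sqinter> p') (q \<squnion> q')"
    "(t' - t) * (energy m p - energy m (p \<sqinter> p')) = 0"
    "t = t' \<or> energy z (q \<squnion> q') = energy z q"
proof -
  have zK: "z \<in> K" and c': "k' n' \<in> L" using z flag_in unfolding flagged_def by auto
  have f: "p \<in> L" "q \<in> L" "p \<le> c" "compat p q" "p' \<in> L" "q' \<in> L" "p' \<le> c" "compat p' q'"
    using 1 2 unfolding optimal_def feasible_def by auto
  have cp: "compat p p'" "compat q q'" using f q compatI[OF cL] compatI[OF c'] by auto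
  have pj: "p \<squnion> p' \<in> L" "p \<squnion> p' \<le> c" using f cp join_in join_least cL by auto
  have qj: "q \<squnion> q' \<in> L" "q \<squnion> q' \<le> k' n'" using f q cp join_in join_least c' by auto
  have pm: "p \<sqinter> p' \<in> L" "p \<sqinter> p' \<le> p" "p \<sqinter> p' \<le> p'" "p \<sqinter> p' \<le> c"
    using f meet_le1[of p p'] order_trans[OF meet_le1[of p p'] f(3)] by auto
  have qm: "q \<sqinter> q' \<in> L" "q \<sqinter> q' \<le> q" "q \<sqinter> q' \<le> q'" using f by auto
  have f1: "feasible (p \<squnion> p') (q \<sqinter> q')"
  proof -
    have "compat p (q \<sqinter> q')" "compat p' (q \<sqinter> q')" using f qm compat_mono by blast+
    then show ?thesis
      unfolding feasible_def using compat_join[OF f(1,5) qm(1) cp(1)] pj qm by blast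
  qed
  have "compat q (p \<sqinter> p')" "compat q' (p \<sqinter> p')" using f pm compat_mono compat_sym by blast+
  then have "compat (q \<squnion> q') (p \<sqinter> p')"
    using compat_join[OF f(2,6) pm(1) cp(2)] by blast
  then have f2: "feasible (p \<sqinter> p') (q \<squnion> q')"
    unfolding feasible_def using pm qj compat_sym by blast
  have o1: "t' * energy m (p \<squnion> p') + energy z (q \<sqinter> q') \<le> t' * energy m p' + energy z q'"
    using 2 f1 unfolding optimal_def by blast
  have o2: "t * energy m (p \<sqinter> p') + energy z (q \<squnion> q') \<le> t * energy m p + energy z q"
    using 1 f2 unfolding optimal_def by blast
  have s1: "energy m p + energy m p' \<le> energy m (p \<squnion> p') + energy m (p \<sqinter> p')"
    using energy_supermodular[OF mK] f cp by blast
  have s2: "energy z q + energy z q' \<le> energy z (q \<squnion> q') + energy z (q \<sqinter> q')"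
    using energy_supermodular[OF zK] f cp by blast
  define D where "D = energy m p - energy m (p \<sqinter> p')"
  have D: "0 \<le> D" unfolding D_def using energy_mono[OF mK pm(1) f(1) pm(2)] by simp
  have a: "t' * D \<le> t' * (energy m (p \<squnion> p') - energy m p')"
    using s1 le by (intro mult_left_mono) (auto simp: D_def)
  have b: "t' * (energy m (p \<squnion> p') - energy m p') \<le> energy z q' - energy z (q \<sqinter> q')"
    using o1 by (simp add: right_diff_distrib)
  have d: "energy z (q \<squnion> q') - energy z q \<le> t * D"
    using o2 by (simp add: D_def right_diff_distrib)
  have e: "t * D \<le> t' * D" using D le by (intro mult_right_mono) auto
  have eq: "t' * D = t * D" "t' * (energy m (p \<squnion> p') - energy m p') = energy z q' - energy z (q \<sqinter> q')"
      "energy z (q \<squnion> q') - energy z q = t * D"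
    using a b d e s2 by linarith+
  show "(t' - t) * (energy m p - energy m (p \<sqinter> p')) = 0"
    using eq(1) by (simp add: D_def left_diff_distrib)
  show "optimal z t' (p \<squnion> p') (q \<sqinter> q')"
  proof -
    have "t' * energy m (p \<squnion> p') + energy z (q \<sqinter> q') = t' * energy m p' + energy z q'"
      using eq(2) by (simp add: right_diff_distrib)
    then show ?thesis using 2 f1 unfolding optimal_def by presburger
  qed
  show "optimal z t (p \<sqinter> p') (q \<squnion> q')"
  proof -
    have "t * energy m (p \<sqinter> p') + energy z (q \<squnion> q') = t * energy m p + energy z q"
      using eq(3) by (simp add: right_diff_distrib D_def)
    then show ?thesis using 1 f2 unfolding optimal_def by presburger
  qed
  show "t = t' \<or> energy z (q \<squnion> q') = energy z q"
    using eq by auto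
qed

text \<open>If \<open>p\<close> did not lie below \<open>p'\<close>, combining the pairs would lose part of the energy of \<open>m\<close> at \<open>t\<close>, where
  it counts less, and gain at least as much of it at \<open>t'\<close>, where it counts more.\<close>

lemma optimal_mono:
  assumes z: "flagged z n' k'" and 1: "optimal z t p q" and 2: "optimal z t' p' q'"
    and le: "0 \<le> t" "t < t'"
  shows "p \<le> p'"
proof -
  have c': "k' n' \<in> L" using z flag_in unfolding flagged_def by auto
  have f: "p \<in> L" "q \<in> L" "p \<le> c" "p' \<in> L" "q' \<in> L"
    using 1 2 unfolding optimal_def feasible_def by auto
  have "energy m p = energy m (p \<sqinter> p')"
    using optimal_combine(3)[OF z optimal_meet_top[OF 1 z] optimal_meet_top[OF 2 z]] le f c' by auto
  then have "p \<sqinter> p' = p" using energy_m_strict[of "p \<sqinter> p'" p] f by (metis meet_in meet_le1 order_le_less less_irrefl)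
  then show ?thesis using f meet_le2[of p p'] by simp
qed

lemma optimal_antimono:
  assumes z: "flagged z n' k'" and strict: "k' n' \<in> supp z" and 1: "optimal z t p q" and 2: "optimal z t' p' q'"
    and le: "0 \<le> t" "t < t'" and q: "q \<le> k' n'" "q' \<le> k' n'"
  shows "q' \<le> q"
proof -
  have zK: "z \<in> K" and c': "k' n' \<in> L" using z flag_in unfolding flagged_def by auto
  have f: "q \<in> L" "q' \<in> L" using 1 2 unfolding optimal_def feasible_def by auto
  have cq: "compat q q'" using compatI[OF c' q] .
  have j: "q \<squnion> q' \<in> L" "q \<le> q \<squnion> q'" "q' \<le> q \<squnion> q'" "q \<squnion> q' \<le> k' n'"
    using join_in[OF f cq] join_ge1[OF f cq] join_ge2[OF f cq] join_least[OF f c' q] by auto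
  have "energy z (q \<squnion> q') = energy z q"
    using optimal_combine(4)[OF z 1 2 _ _ q] le by auto
  then have "q \<squnion> q' = q" using energy_strict_mono[OF zK f(1) j(1) _ strict j(4)] j(2) by (auto simp: order_le_less)
  then show ?thesis using j(3) by simp
qed

text \<open>Energies are sums over jump sets, which are subsets of a fixed finite set.\<close>

lemma finite_energy_values:
  assumes "flagged z n' k'"
  shows "finite {(energy m p, energy z q) | p q. P p q \<and> p \<in> L \<and> q \<in> L}"
proof (rule finite_subset)
  show "{(energy m p, energy z q) | p q. P p q \<and> p \<in> L \<and> q \<in> L} \<subseteq>
     (\<lambda>(I, Q). (\<Sum>i\<in>I. (level m i)\<^sup>2, \<Sum>j\<in>Q. (level z j)\<^sup>2)) ` (Pow {1..n} \<times> Pow {1..n'})"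
  proof clarify
    fix p q assume "p \<in> L" "q \<in> L"
    then show "(energy m p, energy z q) \<in> (\<lambda>(I, Q). (\<Sum>i\<in>I. (level m i)\<^sup>2, \<Sum>j\<in>Q. (level z j)\<^sup>2)) ` (Pow {1..n} \<times> Pow {1..n'})"
      using energy_m flagged_energy[OF assms] jumps_sub by (intro image_eqI[of _ _ "(J p, jumps n' k' q)"]) auto
  qed
qed auto

lemma feasible_bottom: "q \<in> L \<Longrightarrow> feasible bottom q"
  unfolding feasible_def using cL compatI[of q] by auto

lemma feasible_top: "feasible c bottom"
  unfolding feasible_def using cL compatI[of c] by auto

lemma ex_optimal:
  assumes z: "flagged z n' k'"
  obtains p q where "optimal z t p q"
proof -
  define V where "V = {(energy m p, energy z q) | p q. feasible p q \<and> p \<in> L \<and> q \<in> L}"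
  have "finite V" unfolding V_def by (rule finite_energy_values[OF z])
  moreover have "(energy m bottom, energy z bottom) \<in> V"
    unfolding V_def using feasible_bottom[OF bottom_in] bottom_in by blast
  ultimately have "finite ((\<lambda>v. t * fst v + snd v) ` V)" "(\<lambda>v. t * fst v + snd v) ` V \<noteq> {}" by auto
  then obtain v where "v \<in> V" "t * fst v + snd v = Max ((\<lambda>v. t * fst v + snd v) ` V)"
    using Max_in by (metis (no_types, lifting) image_iff)
  then have v: "v \<in> V" "\<And>w. w \<in> V \<Longrightarrow> t * fst w + snd w \<le> t * fst v + snd v"
    using \<open>finite ((\<lambda>v. t * fst v + snd v) ` V)\<close> by simp_all
  then obtain p q where pq: "feasible p q" "v = (energy m p, energy z q)" unfolding V_def by blast
  have "optimal z t p q"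
    unfolding optimal_def
  proof (intro conjI allI impI pq(1))
    fix p' q' assume "feasible p' q'"
    then have "(energy m p', energy z q') \<in> V" unfolding V_def feasible_def by blast
    then show "t * energy m p' + energy z q' \<le> t * energy m p + energy z q" using v(2) pq(2) by fastforce
  qed
  then show ?thesis using that by blast
qed

text \<open>At the parameter \<open>0\<close> the pairs that violate \<open>P\<close> are at least as good as the others, and for large
  parameters those that satisfy \<open>P\<close> are better. Where the two upper envelopes cross, both kinds contain
  optimal pairs.\<close>

lemma optimal_tie:
  assumes z: "flagged z n' k'"
    and a: "feasible p1 q1" "P p1 q1" "\<And>p q. feasible p q \<Longrightarrow> \<not> P p q \<Longrightarrow> energy m p < energy m p1"
    and b: "feasible p2 q2" "\<not> P p2 q2" "\<And>p q. feasible p q \<Longrightarrow> P p q \<Longrightarrow> energy z q \<le> energy z q2"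
  obtains t p q p' q' where "0 \<le> t" "optimal z t p q" "P p q" "optimal z t p' q'" "\<not> P p' q'"
proof -
  define V1 where "V1 = {(energy m p, energy z q) | p q. (feasible p q \<and> P p q) \<and> p \<in> L \<and> q \<in> L}"
  define V2 where "V2 = {(energy m p, energy z q) | p q. (feasible p q \<and> \<not> P p q) \<and> p \<in> L \<and> q \<in> L}"
  have fin: "finite V1" "finite V2" unfolding V1_def V2_def by (rule finite_energy_values[OF z])+
  have "(energy m p1, energy z q1) \<in> V1" using a unfolding V1_def feasible_def by blast
  moreover have "(energy m p2, energy z q2) \<in> V2" using b unfolding V2_def feasible_def by blast
  moreover have "fst v < fst (energy m p1, energy z q1)" if "v \<in> V2" for v using that a(3) unfolding V2_def by auto
  moreover have "snd v \<le> snd (energy m p2, energy z q2)" if "v \<in> V1" for v using that b(3) unfolding V1_def by auto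
  ultimately obtain t w1 w2 where t: "0 \<le> t" "w1 \<in> V1" "w2 \<in> V2"
    "\<And>v. v \<in> V1 \<union> V2 \<Longrightarrow> t * fst v + snd v \<le> t * fst w1 + snd w1"
    "\<And>v. v \<in> V1 \<union> V2 \<Longrightarrow> t * fst v + snd v \<le> t * fst w2 + snd w2"
    using envelopes_cross[OF fin] by metis
  obtain p q where pq: "feasible p q" "P p q" "w1 = (energy m p, energy z q)" using t(2) unfolding V1_def by blast
  obtain p' q' where pq': "feasible p' q'" "\<not> P p' q'" "w2 = (energy m p', energy z q')" using t(3) unfolding V2_def by blast
  have all: "(energy m p, energy z q) \<in> V1 \<union> V2" if "feasible p q" for p q
    using that unfolding V1_def V2_def feasible_def by blast
  have "optimal z t p q" "optimal z t p' q'"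
    unfolding optimal_def using pq pq' t(4,5)[OF all] by auto
  then show ?thesis using that t(1) pq pq' by blast
qed

text \<open>The optimal pairs at one parameter form a sublattice of bounded rank, so they include a greatest
  and a least one.\<close>

lemma ex_extreme_optimal:
  assumes z: "flagged z n' k'" and t: "0 \<le> t"
  shows "\<exists>P q. optimal z t P q \<and> q \<le> k' n' \<and> (\<forall>p' q'. optimal z t p' q' \<and> q' \<le> k' n' \<longrightarrow> p' \<le> P \<and> q \<le> q')"
    and "\<exists>p Q. optimal z t p Q \<and> Q \<le> k' n' \<and> (\<forall>p' q'. optimal z t p' q' \<and> q' \<le> k' n' \<longrightarrow> p \<le> p' \<and> q' \<le> Q)"
proof -
  have c': "k' n' \<in> L" using z flag_in unfolding flagged_def by auto
  define O' where "O' = {(p, q). optimal z t p q \<and> q \<le> k' n'}"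
  obtain p0 q0 where "optimal z t p0 q0" using ex_optimal[OF z] by blast
  moreover have "q0 \<in> L" using \<open>optimal z t p0 q0\<close> unfolding optimal_def feasible_def by blast
  ultimately have x0: "(p0, q0 \<sqinter> k' n') \<in> O'" unfolding O'_def using optimal_meet_top[OF _ z] c' by auto
  have inO: "p \<in> L" "q \<in> L" "p \<le> c" "q \<le> k' n'" "rk p \<le> rk c" "rk q \<le> rk (k' n')" if "(p, q) \<in> O'" for p q
    using that c' cL unfolding O'_def optimal_def feasible_def by (auto intro: rk_mono)
  have comb: "(p \<squnion> p', q \<sqinter> q') \<in> O'" "(p \<sqinter> p', q \<squnion> q') \<in> O'" if "(p, q) \<in> O'" "(p', q') \<in> O'" for p q p' q'
  proof -
    have o: "optimal z t p q" "optimal z t p' q'" "q \<le> k' n'" "q' \<le> k' n'" using that unfolding O'_def by auto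
    have "q \<sqinter> q' \<le> k' n'" using inO(2)[OF that(1)] inO(2)[OF that(2)] o(3) by (meson meet_le1 order_trans)
    moreover have "q \<squnion> q' \<le> k' n'" using inO(2)[OF that(1)] inO(2)[OF that(2)] o(3,4) c' by (intro join_least)
    ultimately show "(p \<squnion> p', q \<sqinter> q') \<in> O'" "(p \<sqinter> p', q \<squnion> q') \<in> O'"
      using optimal_combine(1,2)[OF z o(1,2) t _ o(3,4)] unfolding O'_def by auto
  qed
  define f where "f x = rk (fst x) + (rk (k' n') - rk (snd x))" for x
  define g where "g x = (rk c - rk (fst x)) + rk (snd x)" for x
  have "\<forall>x. x \<in> O' \<longrightarrow> f x < rk c + rk (k' n') + 1" "\<forall>x. x \<in> O' \<longrightarrow> g x < rk c + rk (k' n') + 1"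
    unfolding f_def g_def using inO by fastforce+
  then obtain x y where x: "x \<in> O'" "\<And>y. y \<in> O' \<Longrightarrow> f y \<le> f x" and y: "y \<in> O'" "\<And>x. x \<in> O' \<Longrightarrow> g x \<le> g y"
    using Lattices_Big.ex_has_greatest_nat[of "\<lambda>x. x \<in> O'" _ f] Lattices_Big.ex_has_greatest_nat[of "\<lambda>x. x \<in> O'" _ g] x0 by metis
  obtain P q where Pq: "x = (P, q)" by (cases x)
  obtain p Q where pQ: "y = (p, Q)" by (cases y)
  have A: "p' \<le> P \<and> q \<le> q'" if "(p', q') \<in> O'" for p' q'
  proof -
    note i = inO[OF x(1)[unfolded Pq]] and i' = inO[OF that] and j = comb(1)[OF x(1)[unfolded Pq] that]
    have ge: "P \<le> P \<squnion> p'" "p' \<le> P \<squnion> p'" "q \<sqinter> q' \<le> q" "q \<sqinter> q' \<le> q'"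
      using join_ge1 join_ge2 compatI[OF cL] i i' by auto
    have "rk P \<le> rk (P \<squnion> p')" "rk (q \<sqinter> q') \<le> rk q" using ge i i' inO[OF j] by (auto intro: rk_mono)
    moreover have "f (P \<squnion> p', q \<sqinter> q') \<le> f (P, q)" using x(2)[OF j] Pq by simp
    ultimately have "rk (P \<squnion> p') = rk P" "rk (q \<sqinter> q') = rk q" using i inO[OF j] by (auto simp: f_def)
    then have "P \<squnion> p' = P" "q \<sqinter> q' = q" using rk_eqD[of P "P \<squnion> p'"] rk_eqD[of "q \<sqinter> q'" q] ge i inO[OF j] by auto
    then show ?thesis using ge by auto
  qed
  have B: "p \<le> p' \<and> q' \<le> Q" if "(p', q') \<in> O'" for p' q'
  proof -
    note i = inO[OF y(1)[unfolded pQ]] and i' = inO[OF that] and j = comb(2)[OF y(1)[unfolded pQ] that]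
    have ge: "Q \<le> Q \<squnion> q'" "q' \<le> Q \<squnion> q'" "p \<sqinter> p' \<le> p" "p \<sqinter> p' \<le> p'"
      using join_ge1 join_ge2 compatI[OF c'] i i' by auto
    have "rk Q \<le> rk (Q \<squnion> q')" "rk (p \<sqinter> p') \<le> rk p" using ge i i' inO[OF j] by (auto intro: rk_mono)
    moreover have "g (p \<sqinter> p', Q \<squnion> q') \<le> g (p, Q)" using y(2)[OF j] pQ by simp
    ultimately have "rk (Q \<squnion> q') = rk Q" "rk (p \<sqinter> p') = rk p" using i inO[OF j] by (auto simp: g_def)
    then have "Q \<squnion> q' = Q" "p \<sqinter> p' = p" using rk_eqD[of Q "Q \<squnion> q'"] rk_eqD[of "p \<sqinter> p'" p] ge i inO[OF j] by auto
    then show ?thesis using ge by auto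
  qed
  show "\<exists>P q. optimal z t P q \<and> q \<le> k' n' \<and> (\<forall>p' q'. optimal z t p' q' \<and> q' \<le> k' n' \<longrightarrow> p' \<le> P \<and> q \<le> q')"
    using x(1) A unfolding Pq O'_def by blast
  show "\<exists>p Q. optimal z t p Q \<and> Q \<le> k' n' \<and> (\<forall>p' q'. optimal z t p' q' \<and> q' \<le> k' n' \<longrightarrow> p \<le> p' \<and> q' \<le> Q)"
    using y(1) B unfolding pQ O'_def by blast
qed

section \<open>The developing map\<close>

text \<open>At the parameter \<open>0\<close> the element \<open>c'\<close> may be paired with the bottom, which lacks the jump \<open>i\<close>; for large
  parameters only \<open>c\<close>, which has all jumps, can be the first component.\<close>

lemma slope_exists:
  assumes z: "flagged z n' k'" and i: "i \<in> {1..n}"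
  shows "\<exists>t\<ge>0. \<exists>p q p' q'. optimal z t p q \<and> optimal z t p' q' \<and> i \<in> J p \<and> i \<notin> J p'"
proof -
  have zK: "z \<in> K" and c': "k' n' \<in> L" using z flag_in unfolding flagged_def by auto
  have Jc: "J c = {1..n}" using jumps_flag[OF flag_k, of n] by simp
  have Jb: "J bottom = {}" using jumps_flag[OF flag_k, of 0] flag_0[OF flag_k] by simp
  obtain t p q p' q' where "0 \<le> t" "optimal z t p q" "i \<in> J p" "optimal z t p' q'" "\<not> i \<in> J p'"
  proof (rule optimal_tie[OF z, where P = "\<lambda>p q. i \<in> J p" and ?p1.0 = c and ?q1.0 = bottom and ?p2.0 = bottom and ?q2.0 = "k' n'"])
    show "energy m p < energy m c" if "feasible p q" "i \<notin> J p" for p q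
    proof -
      have "p \<noteq> c" using that(2) i Jc by metis
      then show ?thesis using that(1) cL unfolding feasible_def by (intro energy_m_strict) auto
    qed
    show "energy z q \<le> energy z (k' n')" if "feasible p q" "i \<in> J p" for p q
    proof -
      have "q \<in> L" using that unfolding feasible_def by blast
      then have "energy z q = energy z (q \<sqinter> k' n')"
        using energy_meet_top[OF zK _ c'] flagged_le[OF z] by simp
      also have "\<dots> \<le> energy z (k' n')" using \<open>q \<in> L\<close> c' by (intro energy_mono[OF zK]) auto
      finally show ?thesis .
    qed
  qed (use feasible_top feasible_bottom c' i Jc Jb in auto)
  then show ?thesis by blast
qed

text \<open>The parameter at which the coordinate \<open>i\<close> enters the jump set of the optimal first component. It is
  unique by monotonicity.\<close>

definition slope :: "('a \<Rightarrow> real) \<Rightarrow> nat \<Rightarrow> real" where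
  "slope z i = (THE t. 0 \<le> t \<and> (\<exists>p q p' q'. optimal z t p q \<and> optimal z t p' q' \<and> i \<in> J p \<and> i \<notin> J p'))"

lemma slope_eq:
  assumes z: "flagged z n' k'" and t: "0 \<le> t" and o: "optimal z t p q" "optimal z t p' q'" "i \<in> J p" "i \<notin> J p'"
  shows "slope z i = t"
  unfolding slope_def
proof (rule the_equality)
  have L: "p \<in> L" if "optimal z t p q" for t p q using that unfolding optimal_def feasible_def by blast
  fix s assume "0 \<le> s \<and> (\<exists>p q p' q'. optimal z s p q \<and> optimal z s p' q' \<and> i \<in> J p \<and> i \<notin> J p')"
  then obtain a b a' b' where s: "0 \<le> s" "optimal z s a b" "optimal z s a' b'" "i \<in> J a" "i \<notin> J a'" by blast
  have "\<not> s < t"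
    using optimal_mono[OF z s(2) o(2) s(1)] jumps_mono[OF flag_k L[OF s(2)] L[OF o(2)]] s o by blast
  moreover have "\<not> t < s"
    using optimal_mono[OF z o(1) s(3) t] jumps_mono[OF flag_k L[OF o(1)] L[OF s(3)]] s o by blast
  ultimately show "s = t" by simp
qed (use t o in blast)

end

text \<open>After the last parameter in one of the closed sets, the rest of the interval is covered by the
  others, up to its first point, which is recovered by taking closures.\<close>

lemma lipschitz_from_closed_cover:
  fixes d :: "real \<Rightarrow> real \<Rightarrow> real"
  assumes tri: "\<And>a b c. d a c \<le> d a b + d b c"
    and "finite \<S>" "\<And>S. S \<in> \<S> \<Longrightarrow> closed S" "{a..b} \<subseteq> \<Union>\<S>" "a \<le> b"
    and "\<And>S s t. S \<in> \<S> \<Longrightarrow> s \<in> S \<Longrightarrow> t \<in> S \<Longrightarrow> a \<le> s \<Longrightarrow> s \<le> t \<Longrightarrow> t \<le> b \<Longrightarrow> d s t \<le> C * (t - s)"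
  shows "d a b \<le> C * (b - a)"
  using assms(2-)
proof (induction "card \<S>" arbitrary: \<S> a)
  case 0
  then show ?case by auto
next
  case (Suc N)
  have "a \<in> \<Union>\<S>" by (rule subsetD[OF Suc.prems(3)]) (use Suc.prems(4) in simp)
  then obtain S where S: "S \<in> \<S>" "a \<in> S" by blast
  define t where "t = Sup (S \<inter> {a..b})"
  have ne: "S \<inter> {a..b} \<noteq> {}" "bdd_above (S \<inter> {a..b})" using S Suc.prems by auto
  have "closed (S \<inter> {a..b})" using Suc.prems S by auto
  then have t: "t \<in> S" "a \<le> t" "t \<le> b"
    using closed_contains_Sup[OF ne] unfolding t_def by auto
  have at: "d a t \<le> C * (t - a)" using Suc.prems(5)[OF S(1,2) t(1)] t by simp
  show ?case
  proof (cases "t = b")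
    case True
    then show ?thesis using at by simp
  next
    case False
    have "{t<..<b} \<subseteq> \<Union>(\<S> - {S})"
    proof
      fix s assume s: "s \<in> {t<..<b}"
      then have "s \<notin> S" using cSup_upper[OF _ ne(2), of s] t unfolding t_def by force
      moreover have "s \<in> \<Union>\<S>" by (rule subsetD[OF Suc.prems(3)]) (use s t in auto)
      ultimately show "s \<in> \<Union>(\<S> - {S})" by blast
    qed
    moreover have "closed (\<Union>(\<S> - {S}))" using Suc.prems by auto
    ultimately have "closure {t<..<b} \<subseteq> \<Union>(\<S> - {S})" using closure_minimal by blast
    then have "{t..b} \<subseteq> \<Union>(\<S> - {S})" using t False by (simp add: closure_greaterThanLessThan)
    moreover have "N = card (\<S> - {S})" using Suc S by simp
    moreover have "\<And>S' s u. S' \<in> \<S> - {S} \<Longrightarrow> s \<in> S' \<Longrightarrow> u \<in> S' \<Longrightarrow> t \<le> s \<Longrightarrow> s \<le> u \<Longrightarrow> u \<le> b \<Longrightarrow> d s u \<le> C * (u - s)"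
      using Suc.prems(5) t by force
    ultimately have "d t b \<le> C * (b - t)"
      using Suc.hyps(1)[of "\<S> - {S}" t] Suc.prems(1,2) t by blast
    then have "d a b \<le> C * (t - a) + C * (b - t)" using tri[of a b t] at by linarith
    then show ?thesis by (simp add: algebra_simps)
  qed
qed

lemma sqrt_sum_squares_diff:
  fixes u v :: "'i \<Rightarrow> real"
  shows "(sqrt (\<Sum>i\<in>I. (u i)\<^sup>2) - sqrt (\<Sum>i\<in>I. (v i)\<^sup>2))\<^sup>2 \<le> (\<Sum>i\<in>I. (u i - v i)\<^sup>2)"
proof -
  have "L2_set u I \<le> L2_set (\<lambda>i. u i - v i) I + L2_set v I"
    using L2_set_triangle_ineq[of "\<lambda>i. u i - v i" v I] by simp
  moreover have "L2_set v I \<le> L2_set (\<lambda>i. u i - v i) I + L2_set u I"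
    using L2_set_triangle_ineq[of "\<lambda>i. v i - u i" u I] by (simp add: L2_set_def power2_commute)
  ultimately have "\<bar>L2_set u I - L2_set v I\<bar> \<le> L2_set (\<lambda>i. u i - v i) I" by linarith
  then have "(L2_set u I - L2_set v I)\<^sup>2 \<le> (L2_set (\<lambda>i. u i - v i) I)\<^sup>2"
    by (metis abs_ge_zero power2_abs power_mono)
  then show ?thesis unfolding L2_set_def by (simp add: sum_nonneg)
qed

context base_point
begin

text \<open>The elements below \<open>c'\<close> that are compatible with \<open>c\<close> are closed under joins, by the condition on
  joins of three elements.\<close>

lemma ex_outer:
  assumes "c' \<in> L"
  obtains q where "q \<in> L" "q \<le> c'" "compat c q" "\<And>q'. q' \<in> L \<Longrightarrow> q' \<le> c' \<Longrightarrow> compat c q' \<Longrightarrow> q' \<le> q"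
proof -
  define S where "S = {q \<in> L. q \<le> c' \<and> compat c q}"
  have "bottom \<in> S" unfolding S_def using assms compatI[OF cL] cL by auto
  moreover have "\<forall>q. q \<in> S \<longrightarrow> rk q < rk c' + 1" unfolding S_def using rk_mono assms by (auto simp: less_Suc_eq_le)
  ultimately obtain q where q: "q \<in> S" "\<And>q'. q' \<in> S \<Longrightarrow> rk q' \<le> rk q"
    using Lattices_Big.ex_has_greatest_nat[of "\<lambda>q. q \<in> S" bottom rk] by blast
  have "q' \<le> q" if "q' \<in> S" for q'
  proof -
    have L: "q \<in> L" "q' \<in> L" "q \<le> c'" "q' \<le> c'" "compat c q" "compat c q'" using q that unfolding S_def by auto
    have cq: "compat q q'" using compatI[OF assms] L by blast
    have j: "q \<squnion> q' \<in> L" "q \<le> q \<squnion> q'" "q' \<le> q \<squnion> q'" "q \<squnion> q' \<le> c'"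
      using join_in[OF L(1,2) cq] join_ge1[OF L(1,2) cq] join_ge2[OF L(1,2) cq] join_least[OF L(1,2) assms L(3,4)] by auto
    have "compat c (q \<squnion> q')" using compat_join[OF L(1,2) cL cq] L compat_sym by blast
    then have "q \<squnion> q' \<in> S" using j unfolding S_def by blast
    then have "q = q \<squnion> q'" using q(2) rk_eqD[OF L(1) j(1,2)] by blast
    then show ?thesis using j(3) by simp
  qed
  then show ?thesis using that q(1) unfolding S_def by blast
qed

text \<open>A support collects the parameters \<open>t\<close> at which a block of coordinates of \<open>m\<close> is exchanged for a block
  of coordinates of \<open>z\<close>. There \<open>(p t, Q t)\<close> is the optimal pair that comes from smaller parameters and
  \<open>(P t, q t)\<close> the one that continues to larger parameters. The last two clauses say that the blocks
  exhaust the coordinates of \<open>m\<close>, and those of \<open>z\<close> outside the greatest element \<open>q0\<close> compatible with \<open>c\<close>.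
  The coordinates of \<open>m\<close> below \<open>c \<sqinter> k' n'\<close> belong to the common part of both points; they enter at the
  parameter \<open>0\<close>, where no coordinate of \<open>z\<close> is given up.\<close>

definition is_support :: "('a \<Rightarrow> real) \<Rightarrow> nat \<Rightarrow> (nat \<Rightarrow> 'a) \<Rightarrow> 'a \<Rightarrow> real set \<Rightarrow>
    (real \<Rightarrow> 'a) \<Rightarrow> (real \<Rightarrow> 'a) \<Rightarrow> (real \<Rightarrow> 'a) \<Rightarrow> (real \<Rightarrow> 'a) \<Rightarrow> bool" where
  "is_support z n' k' q0 \<Lambda> P p Q q \<longleftrightarrow> finite \<Lambda> \<and>
     (\<forall>t\<in>\<Lambda>. 0 \<le> t \<and> optimal z t (P t) (q t) \<and> optimal z t (p t) (Q t) \<and>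
        p t \<le> P t \<and> J (p t) \<noteq> J (P t) \<and> q t \<le> Q t \<and> Q t \<le> k' n' \<and>
        q0 \<le> q t \<and> (0 < t \<longrightarrow> c \<sqinter> k' n' \<le> p t) \<and> (t = 0 \<longrightarrow> q t = k' n') \<and> c \<sqinter> k' n' \<le> P t) \<and>
     (\<forall>t\<in>\<Lambda>. \<forall>t'\<in>\<Lambda>. t < t' \<longrightarrow> P t \<le> p t' \<and> Q t' \<le> q t) \<and>
     (\<forall>i\<in>{1..n}. \<exists>t\<in>\<Lambda>. i \<in> J (P t) - J (p t)) \<and>
     (\<forall>j\<in>{1..n'} - jumps n' k' q0. \<exists>t\<in>\<Lambda>. 0 < t \<and> j \<in> jumps n' k' (Q t) - jumps n' k' (q t))"

lemma supportD:
  assumes "is_support z n' k' q0 \<Lambda> P p Q q"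
  shows "finite \<Lambda>" "t \<in> \<Lambda> \<Longrightarrow> 0 \<le> t"
    "t \<in> \<Lambda> \<Longrightarrow> optimal z t (P t) (q t)" "t \<in> \<Lambda> \<Longrightarrow> optimal z t (p t) (Q t)"
    "t \<in> \<Lambda> \<Longrightarrow> p t \<le> P t" "t \<in> \<Lambda> \<Longrightarrow> J (p t) \<noteq> J (P t)" "t \<in> \<Lambda> \<Longrightarrow> q t \<le> Q t" "t \<in> \<Lambda> \<Longrightarrow> Q t \<le> k' n'"
    "t \<in> \<Lambda> \<Longrightarrow> t' \<in> \<Lambda> \<Longrightarrow> t < t' \<Longrightarrow> P t \<le> p t'" "t \<in> \<Lambda> \<Longrightarrow> t' \<in> \<Lambda> \<Longrightarrow> t < t' \<Longrightarrow> Q t' \<le> q t"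
    "i \<in> {1..n} \<Longrightarrow> \<exists>t\<in>\<Lambda>. i \<in> J (P t) - J (p t)"
    "j \<in> {1..n'} - jumps n' k' q0 \<Longrightarrow> \<exists>t\<in>\<Lambda>. 0 < t \<and> j \<in> jumps n' k' (Q t) - jumps n' k' (q t)"
    "t \<in> \<Lambda> \<Longrightarrow> q0 \<le> q t" "t \<in> \<Lambda> \<Longrightarrow> 0 < t \<Longrightarrow> c \<sqinter> k' n' \<le> p t"
    "t \<in> \<Lambda> \<Longrightarrow> t = 0 \<Longrightarrow> q t = k' n'" "t \<in> \<Lambda> \<Longrightarrow> c \<sqinter> k' n' \<le> P t"
proof -
  note A = assms[unfolded is_support_def]
  note B = conjunct2[OF A]
  note D = conjunct2[OF B]
  note E = conjunct2[OF D]
  show "finite \<Lambda>" by (rule conjunct1[OF A])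
  show "t \<in> \<Lambda> \<Longrightarrow> 0 \<le> t"
    "t \<in> \<Lambda> \<Longrightarrow> optimal z t (P t) (q t)" "t \<in> \<Lambda> \<Longrightarrow> optimal z t (p t) (Q t)"
    "t \<in> \<Lambda> \<Longrightarrow> p t \<le> P t" "t \<in> \<Lambda> \<Longrightarrow> J (p t) \<noteq> J (P t)" "t \<in> \<Lambda> \<Longrightarrow> q t \<le> Q t" "t \<in> \<Lambda> \<Longrightarrow> Q t \<le> k' n'"
    "t \<in> \<Lambda> \<Longrightarrow> q0 \<le> q t" "t \<in> \<Lambda> \<Longrightarrow> 0 < t \<Longrightarrow> c \<sqinter> k' n' \<le> p t"
    "t \<in> \<Lambda> \<Longrightarrow> t = 0 \<Longrightarrow> q t = k' n'" "t \<in> \<Lambda> \<Longrightarrow> c \<sqinter> k' n' \<le> P t"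
    using bspec[OF conjunct1[OF B], of t] by blast+
  show "t \<in> \<Lambda> \<Longrightarrow> t' \<in> \<Lambda> \<Longrightarrow> t < t' \<Longrightarrow> P t \<le> p t'" "t \<in> \<Lambda> \<Longrightarrow> t' \<in> \<Lambda> \<Longrightarrow> t < t' \<Longrightarrow> Q t' \<le> q t"
    using conjunct1[OF D] by blast+
  show "i \<in> {1..n} \<Longrightarrow> \<exists>t\<in>\<Lambda>. i \<in> J (P t) - J (p t)"
    using bspec[OF conjunct1[OF E], of i] .
  show "j \<in> {1..n'} - jumps n' k' q0 \<Longrightarrow> \<exists>t\<in>\<Lambda>. 0 < t \<and> j \<in> jumps n' k' (Q t) - jumps n' k' (q t)"
    using bspec[OF conjunct2[OF E], of j] .
qed

text \<open>The parameters are those at which the greatest and the least optimal pair have different first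
  components.\<close>

lemma support_exists:
  assumes z: "flagged z n' k'" and strict: "k' n' \<in> supp z"
    and q0: "q0 \<in> L" "q0 \<le> k' n'" "compat c q0" "\<And>q'. q' \<in> L \<Longrightarrow> q' \<le> k' n' \<Longrightarrow> compat c q' \<Longrightarrow> q' \<le> q0"
  obtains \<Lambda> P p Q q where "is_support z n' k' q0 \<Lambda> P p Q q"
proof -
  have zK: "z \<in> K" and fk': "flag n' k'" and c': "k' n' \<in> L" using z flag_in unfolding flagged_def by auto
  let ?J' = "jumps n' k'"
  obtain P q where Pq: "\<And>t. 0 \<le> t \<Longrightarrow> optimal z t (P t) (q t)" "\<And>t. 0 \<le> t \<Longrightarrow> q t \<le> k' n'"
      "\<And>t p' q'. 0 \<le> t \<Longrightarrow> optimal z t p' q' \<Longrightarrow> q' \<le> k' n' \<Longrightarrow> p' \<le> P t \<and> q t \<le> q'"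
    using ex_extreme_optimal(1)[OF z] by metis
  obtain p Q where pQ: "\<And>t. 0 \<le> t \<Longrightarrow> optimal z t (p t) (Q t)" "\<And>t. 0 \<le> t \<Longrightarrow> Q t \<le> k' n'"
      "\<And>t p' q'. 0 \<le> t \<Longrightarrow> optimal z t p' q' \<Longrightarrow> q' \<le> k' n' \<Longrightarrow> p t \<le> p' \<and> q' \<le> Q t"
    using ex_extreme_optimal(2)[OF z] by metis
  have feas: "P t \<in> L" "q t \<in> L" "p t \<in> L" "Q t \<in> L" "P t \<le> c" "p t \<le> c" "compat (P t) (q t)" "compat (p t) (Q t)"
    if "0 \<le> t" for t using Pq(1)[OF that] pQ(1)[OF that] unfolding optimal_def feasible_def by auto
  have pP: "p t \<le> P t" "q t \<le> Q t" if "0 \<le> t" for t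
    using Pq(3)[OF that pQ(1)[OF that] pQ(2)[OF that]] by auto
  have mono: "P t \<le> p t'" "Q t' \<le> q t" if "0 \<le> t" "t < t'" for t t'
  proof -
    have t': "0 \<le> t'" using that by simp
    show "P t \<le> p t'" by (rule optimal_mono[OF z Pq(1)[OF that(1)] pQ(1)[OF t'] that])
    show "Q t' \<le> q t"
      by (rule optimal_antimono[OF z strict Pq(1)[OF that(1)] pQ(1)[OF t'] that Pq(2)[OF that(1)] pQ(2)[OF t']])
  qed
  define \<Lambda> where "\<Lambda> = {t. 0 \<le> t \<and> J (p t) \<noteq> J (P t)}"
  define A where "A t = J (P t) - J (p t)" for t
  have A_ne: "A t \<noteq> {}" if "t \<in> \<Lambda>" for t
  proof -
    have t: "0 \<le> t" "J (p t) \<noteq> J (P t)" using that unfolding \<Lambda>_def by auto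
    then show ?thesis
      using jumps_mono[OF flag_k feas(3)[OF t(1)] feas(1)[OF t(1)] pP(1)[OF t(1)]] unfolding A_def by blast
  qed
  \<comment> \<open>Blocks of different parameters are disjoint, so there are at most as many as coordinates.\<close>
  have "inj_on A \<Lambda>"
  proof (rule inj_onI, rule ccontr)
    fix s t assume st: "s \<in> \<Lambda>" "t \<in> \<Lambda>" "A s = A t" "s \<noteq> t"
    have dis: "A s \<inter> A t = {}" if "0 \<le> s" "s < t" for s t
    proof -
      have "J (P s) \<subseteq> J (p t)" using mono(1)[OF that] feas that by (intro jumps_mono[OF flag_k]) auto
      then show ?thesis unfolding A_def by blast
    qed
    have "0 \<le> s" "0 \<le> t" using st unfolding \<Lambda>_def by auto
    then have "A s \<inter> A t = {}" using dis[of s t] dis[of t s] st(4) by (cases s t rule: linorder_cases) auto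
    then show False using st(3) A_ne[OF st(1)] by simp
  qed
  moreover have "A ` \<Lambda> \<subseteq> Pow {1..n}" unfolding A_def using jumps_sub by auto
  ultimately have fin: "finite \<Lambda>" using finite_imageD finite_subset by (metis finite_Pow_iff finite_atLeastAtMost)
  have cover: "\<exists>t\<in>\<Lambda>. i \<in> J (P t) - J (p t)" if i: "i \<in> {1..n}" for i
  proof -
    obtain t a b a' b' where t: "0 \<le> t" "optimal z t a b" "optimal z t a' b'" "i \<in> J a" "i \<notin> J a'"
      using slope_exists[OF z i] by blast
    have ab: "a \<in> L" "a' \<in> L" "b \<in> L" "b' \<in> L" using t(2,3) unfolding optimal_def feasible_def by auto
    have "a \<le> P t" "p t \<le> a'"
      using Pq(3)[OF t(1) optimal_meet_top[OF t(2) z]] pQ(3)[OF t(1) optimal_meet_top[OF t(3) z]] ab c' by auto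
    then have "i \<in> J (P t)" "i \<notin> J (p t)"
      using t(4,5) jumps_mono[OF flag_k ab(1) feas(1)[OF t(1)]] jumps_mono[OF flag_k feas(3)[OF t(1)] ab(2)] by auto
    then show ?thesis using t(1) unfolding \<Lambda>_def by blast
  qed
  have zero: "q 0 = k' n'"
  proof -
    have "energy z (k' n') \<le> energy z (q 0)"
      using Pq(1)[of 0] feasible_bottom[OF c'] unfolding optimal_def by auto
    then show ?thesis using energy_strict_mono[OF zK feas(2)[of 0] c' _ strict] Pq(2)[of 0]
      by (metis order_refl order_le_less not_less)
  qed
  have energy_P: "t * (energy m (P t) - energy m (p t)) = energy z (Q t) - energy z (q t)" if "0 \<le> t" for t
  proof -
    have "t * energy m (P t) + energy z (q t) = t * energy m (p t) + energy z (Q t)"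
      using Pq(1)[OF that] pQ(1)[OF that] unfolding optimal_def by (meson order_antisym)
    then show ?thesis by (simp add: algebra_simps)
  qed
  \<comment> \<open>Since \<open>q0\<close> is compatible with all of \<open>c\<close>, joining it to \<open>q t\<close> keeps the pair feasible.\<close>
  have q0q: "q0 \<le> q t" if "0 \<le> t" for t
  proof -
    have qL: "q t \<in> L" "q t \<le> k' n'" "P t \<in> L" "P t \<le> c" "compat (P t) (q t)" using feas Pq that by auto
    have cq: "compat q0 (q t)" using compatI[OF c'] q0 qL by blast
    have j: "q0 \<squnion> q t \<in> L" "q0 \<le> q0 \<squnion> q t" "q t \<le> q0 \<squnion> q t" "q0 \<squnion> q t \<le> k' n'"
      using join_in[OF q0(1) qL(1) cq] join_ge1[OF q0(1) qL(1) cq] join_ge2[OF q0(1) qL(1) cq]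
        join_least[OF q0(1) qL(1) c' q0(2) qL(2)] by auto
    have "compat (q0 \<squnion> q t) (P t)"
      using compat_join[OF q0(1) qL(1,3) cq] compat_sym[OF compat_mono[OF q0(3) qL(4) order_refl]] compat_sym[OF qL(5)] by blast
    then have "feasible (P t) (q0 \<squnion> q t)" unfolding feasible_def using j qL compat_sym by blast
    then have "energy z (q0 \<squnion> q t) \<le> energy z (q t)" using optimalD[OF Pq(1)[OF that]] by fastforce
    then have "q t = q0 \<squnion> q t" using energy_strict_mono[OF zK qL(1) j(1) _ strict j(4)] j(3)
      by (metis order_le_less not_less)
    then show ?thesis using j(2) by simp
  qed
  \<comment> \<open>A coordinate of \<open>z\<close> outside \<open>q0\<close> has to be given up for large parameters, where the first
    component is \<open>c\<close>. The energies balance at the exchange, so a coordinate of \<open>m\<close> is exchanged, too.\<close>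
  have coverj: "\<exists>t\<in>\<Lambda>. 0 < t \<and> j \<in> ?J' (Q t) - ?J' (q t)" if j: "j \<in> {1..n'} - ?J' q0" for j
  proof -
    have Jc': "?J' (k' n') = {1..n'}" using jumps_flag[OF fk', of n'] by simp
    obtain t a b a' b' where t: "0 \<le> t" "optimal z t a b" "j \<notin> ?J' b" "optimal z t a' b'" "\<not> j \<notin> ?J' b'"
    proof (rule optimal_tie[OF z, where P = "\<lambda>p q. j \<notin> ?J' q" and ?p1.0 = c and ?q1.0 = q0 and ?p2.0 = bottom and ?q2.0 = "k' n'"])
      show "feasible c q0" unfolding feasible_def using cL q0 by auto
      show "energy m a < energy m c" if "feasible a b" "\<not> j \<notin> ?J' b" for a b
      proof -
        have ab: "a \<in> L" "a \<le> c" "b \<in> L" "compat a b" using that(1) unfolding feasible_def by auto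
        have "a \<noteq> c"
        proof
          assume "a = c"
          then have "compat c (b \<sqinter> k' n')" using compat_mono[OF ab(4) order_refl meet_le1[OF ab(3) c']] by simp
          then have "b \<sqinter> k' n' \<le> q0" using q0(4) ab c' by auto
          then have "?J' (b \<sqinter> k' n') \<subseteq> ?J' q0" using ab c' q0 by (intro jumps_mono[OF fk']) auto
          then show False using that(2) j jumps_meet_top[OF fk' ab(3)] by blast
        qed
        then show ?thesis using ab cL by (intro energy_m_strict) auto
      qed
      show "energy z b \<le> energy z (k' n')" if "feasible a b" "j \<notin> ?J' b" for a b
      proof -
        have "b \<in> L" using that unfolding feasible_def by blast
        then have "energy z b = energy z (b \<sqinter> k' n')"
          using energy_meet_top[OF zK _ c'] flagged_le[OF z] by simp
        also have "\<dots> \<le> energy z (k' n')" using \<open>b \<in> L\<close> c' by (intro energy_mono[OF zK]) auto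
        finally show ?thesis .
      qed
    qed (use feasible_bottom c' j Jc' in auto)
    have ab: "a \<in> L" "a' \<in> L" "b \<in> L" "b' \<in> L" using t(2,4) unfolding optimal_def feasible_def by auto
    have "q t \<le> b \<sqinter> k' n'" "b' \<sqinter> k' n' \<le> Q t"
      using Pq(3)[OF t(1) optimal_meet_top[OF t(2) z]] pQ(3)[OF t(1) optimal_meet_top[OF t(4) z]] ab c' by auto
    then have "?J' (q t) \<subseteq> ?J' b" "?J' b' \<subseteq> ?J' (Q t)"
      using jumps_mono[OF fk', of "q t" "b \<sqinter> k' n'"] jumps_mono[OF fk', of "b' \<sqinter> k' n'" "Q t"]
        jumps_meet_top[OF fk'] ab feas[OF t(1)] c' by auto
    then have jQ: "j \<in> ?J' (Q t) - ?J' (q t)" using t by blast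
    have "t \<noteq> 0" using jQ zero j Jc' by auto
    then have "0 < t" using t(1) by simp
    have "Q t \<noteq> q t" using jQ by auto
    then have "energy z (q t) < energy z (Q t)"
      using energy_strict_mono[OF zK feas(2)[OF t(1)] feas(4)[OF t(1)] _ strict pQ(2)[OF t(1)]] pP(2)[OF t(1)]
      by (auto simp: order_le_less)
    then have "energy m (P t) \<noteq> energy m (p t)" using energy_P[OF t(1)] by auto
    then have "J (p t) \<noteq> J (P t)" using energy_m[OF feas(1)[OF t(1)]] energy_m[OF feas(3)[OF t(1)]] by metis
    then have "t \<in> \<Lambda>" using t(1) unfolding \<Lambda>_def by blast
    then show ?thesis using jQ \<open>0 < t\<close> by blast
  qed
  \<comment> \<open>The common part of both tops is compatible with everything below either of them, so it may be
    joined to the first component.\<close>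
  have below: "c \<sqinter> k' n' \<le> p t" if "0 < t" for t
  proof -
    have t0: "0 \<le> t" using that by simp
    define e where "e = c \<sqinter> k' n'"
    have e: "e \<in> L" "e \<le> c" "e \<le> k' n'" unfolding e_def using cL c' by auto
    have L: "p t \<in> L" "Q t \<in> L" "p t \<le> c" "Q t \<le> k' n'" "compat (p t) (Q t)" using feas[OF t0] pQ(2)[OF t0] by auto
    have ce: "compat (p t) e" "compat e (Q t)" using compatI[OF cL] compatI[OF c'] e L by auto
    have j: "p t \<squnion> e \<in> L" "p t \<le> p t \<squnion> e" "e \<le> p t \<squnion> e" "p t \<squnion> e \<le> c"
      using join_in[OF L(1) e(1) ce(1)] join_ge1[OF L(1) e(1) ce(1)] join_ge2[OF L(1) e(1) ce(1)] join_least[OF L(1) e(1) cL L(3) e(2)] by auto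
    have "feasible (p t \<squnion> e) (Q t)" unfolding feasible_def using j L compat_join[OF L(1) e(1) L(2) ce(1) L(5) ce(2)] by blast
    then have "t * energy m (p t \<squnion> e) \<le> t * energy m (p t)" using optimalD[OF pQ(1)[OF t0]] by fastforce
    then have "energy m (p t \<squnion> e) \<le> energy m (p t)" using that by simp
    then have "p t = p t \<squnion> e" using energy_m_strict[OF L(1) j(1) _ j(4)] j(2) by (metis order_le_less not_less)
    then show ?thesis using j(3) unfolding e_def by simp
  qed
  have below_P: "c \<sqinter> k' n' \<le> P t" if t0: "0 \<le> t" for t
  proof -
    define e where "e = c \<sqinter> k' n'"
    have e: "e \<in> L" "e \<le> c" "e \<le> k' n'" unfolding e_def using cL c' by auto
    have L: "P t \<in> L" "q t \<in> L" "P t \<le> c" "q t \<le> k' n'" "compat (P t) (q t)" using feas[OF t0] Pq(2)[OF t0] by auto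
    have ce: "compat (P t) e" "compat e (q t)" using compatI[OF cL] compatI[OF c'] e L by auto
    have j: "P t \<squnion> e \<in> L" "P t \<le> P t \<squnion> e" "e \<le> P t \<squnion> e" "P t \<squnion> e \<le> c"
      using join_in[OF L(1) e(1) ce(1)] join_ge1[OF L(1) e(1) ce(1)] join_ge2[OF L(1) e(1) ce(1)] join_least[OF L(1) e(1) cL L(3) e(2)] by auto
    have f: "feasible (P t \<squnion> e) (q t)" unfolding feasible_def using j L compat_join[OF L(1) e(1) L(2) ce(1) L(5) ce(2)] by blast
    have "t * energy m (P t) \<le> t * energy m (P t \<squnion> e)"
      using energy_mono[OF mK L(1) j(1,2)] t0 by (rule mult_left_mono)
    then have "optimal z t (P t \<squnion> e) (q t)"
      using optimalD[OF Pq(1)[OF t0]] f unfolding optimal_def by (smt (verit))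
    then have "P t \<squnion> e \<le> P t" using Pq(3)[OF t0 _ L(4)] by blast
    then show ?thesis using j(3) unfolding e_def by order
  qed
  have "is_support z n' k' q0 \<Lambda> P p Q q"
    unfolding is_support_def
  proof (intro conjI ballI)
    show "finite \<Lambda>" by (rule fin)
  next
    fix t assume t: "t \<in> \<Lambda>"
    show t0: "0 \<le> t" using t unfolding \<Lambda>_def by simp
    show "optimal z t (P t) (q t)" "optimal z t (p t) (Q t)" using Pq(1)[OF t0] pQ(1)[OF t0] .
    show "p t \<le> P t" "q t \<le> Q t" "Q t \<le> k' n'" using pP[OF t0] pQ(2)[OF t0] .
    show "J (p t) \<noteq> J (P t)" using t unfolding \<Lambda>_def by simp
    show "q0 \<le> q t" by (rule q0q[OF t0])
    show "0 < t \<longrightarrow> c \<sqinter> k' n' \<le> p t" using below by blast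
    show "t = 0 \<longrightarrow> q t = k' n'" using zero by simp
    show "c \<sqinter> k' n' \<le> P t" by (rule below_P[OF t0])
  next
    fix t t' assume "t \<in> \<Lambda>" "t' \<in> \<Lambda>"
    then show "t < t' \<longrightarrow> P t \<le> p t' \<and> Q t' \<le> q t" using mono unfolding \<Lambda>_def by simp
  next
    fix i assume "i \<in> {1..n}"
    then show "\<exists>t\<in>\<Lambda>. i \<in> J (P t) - J (p t)" by (rule cover)
  next
    fix j assume "j \<in> {1..n'} - ?J' q0"
    then show "\<exists>t\<in>\<Lambda>. 0 < t \<and> j \<in> ?J' (Q t) - ?J' (q t)" by (rule coverj)
  qed
  then show ?thesis by (rule that)
qed

text \<open>The squared norm of the part of \<open>z\<close> that is compatible with \<open>c\<close> but not below \<open>c\<close>. The greatest energy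
  of a compatible element is described without a flag through the support of \<open>z\<close>.\<close>

definition outer :: "('a \<Rightarrow> real) \<Rightarrow> real" where
  "outer z = (THE v. \<exists>q\<in>L. compat c q \<and> v = energy z q \<and> (\<forall>q'\<in>L. compat c q' \<longrightarrow> energy z q' \<le> v)) - energy z c"

lemma outer_eq:
  assumes z: "flagged z n' k'"
    and q0: "q0 \<in> L" "q0 \<le> k' n'" "compat c q0" "\<And>q'. q' \<in> L \<Longrightarrow> q' \<le> k' n' \<Longrightarrow> compat c q' \<Longrightarrow> q' \<le> q0"
  shows "outer z = energy z q0 - energy z c"
proof -
  have zK: "z \<in> K" and c': "k' n' \<in> L" using z flag_in unfolding flagged_def by auto
  have "energy z q' \<le> energy z q0" if "q' \<in> L" "compat c q'" for q'
  proof -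
    have "compat c (q' \<sqinter> k' n')" using compat_mono[OF that(2) order_refl meet_le1[OF that(1) c']] .
    then have "q' \<sqinter> k' n' \<le> q0" using q0(4) that c' by auto
    then have "energy z (q' \<sqinter> k' n') \<le> energy z q0" using that c' q0 by (intro energy_mono[OF zK]) auto
    then show ?thesis using energy_meet_top[OF zK that(1) c'] flagged_le[OF z] by simp
  qed
  then have "(THE v. \<exists>q\<in>L. compat c q \<and> v = energy z q \<and> (\<forall>q'\<in>L. compat c q' \<longrightarrow> energy z q' \<le> v)) = energy z q0"
    using q0 by (intro the_equality) (auto intro: order_antisym)
  then show ?thesis unfolding outer_def by simp
qed

text \<open>On a block of coordinates exchanged at the parameter \<open>t\<close>, the second summand is the vector opposite to
  the block of \<open>m\<close> whose norm is that of the corresponding block of \<open>z\<close>. The first summand is the part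
  of \<open>z\<close> below \<open>c\<close>; on each block at least one of the summands vanishes.\<close>

definition dev :: "('a \<Rightarrow> real) \<Rightarrow> nat \<Rightarrow> real" where
  "dev z i = (if i = 0 then sqrt (outer z) else mass z (\<lambda>p. i \<in> J p) - sqrt (slope z i) * level m i)"

end

section \<open>The developing map does not increase distances\<close>

definition seg :: "('a \<Rightarrow> real) \<Rightarrow> ('a \<Rightarrow> real) \<Rightarrow> real \<Rightarrow> 'a \<Rightarrow> real" where
  "seg x y s = (\<lambda>p. (1 - s) * x p + s * y p)"

lemma seg_0 [simp]: "seg x y 0 = x" and seg_1 [simp]: "seg x y 1 = y"
  unfolding seg_def by auto

context modular_semilattice_finite_rank
begin

lemma supp_seg_subset: "supp (seg x y s) \<subseteq> supp x \<union> supp y"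
  unfolding supp_def seg_def by auto

text \<open>Coefficients are nonnegative, so nothing cancels in the interior of a segment.\<close>

lemma supp_seg:
  assumes "x \<in> K" "y \<in> K" "0 < s" "s < 1"
  shows "supp (seg x y s) = supp x \<union> supp y"
proof -
  have "p \<in> supp (seg x y s)" if "p \<in> supp x \<union> supp y" for p
  proof -
    have "0 \<le> x p" "0 \<le> y p" "0 < x p \<or> 0 < y p"
      using that K_pos[OF assms(1)] K_pos[OF assms(2)] K_supp(5)[OF assms(1)] K_supp(5)[OF assms(2)] by auto
    then have "0 < (1 - s) * x p + s * y p"
      using assms(3,4) by (auto intro: add_pos_nonneg add_nonneg_pos)
    then show ?thesis unfolding supp_def seg_def by simp
  qed
  then show ?thesis using supp_seg_subset[of x y s] by blast
qed

lemma mass_seg: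
  assumes "x \<in> K" "y \<in> K"
  shows "mass (seg x y s) P = (1 - s) * mass x P + s * mass y P"
proof -
  have S: "finite (supp x \<union> supp y)" "supp x \<subseteq> supp x \<union> supp y" "supp y \<subseteq> supp x \<union> supp y"
    using K_supp assms by auto
  show ?thesis
    unfolding mass_eq_sum[OF S(1,2)] mass_eq_sum[OF S(1,3)] mass_eq_sum[OF S(1) supp_seg_subset]
    by (simp add: seg_def distrib_right sum.distrib sum_distrib_left mult.assoc)
qed

lemma seg_K:
  assumes "adjacent x y" "0 \<le> s" "s \<le> 1"
  shows "seg x y s \<in> K"
proof -
  have xy: "x \<in> K" "y \<in> K" "Complete_Partial_Order.chain (\<le>) (supp x \<union> supp y)"
    using assms unfolding adjacent_def by auto
  have S: "finite (supp x \<union> supp y)" "supp x \<union> supp y \<subseteq> L" using K_supp xy by auto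
  have "(\<Sum>p\<in>supp (seg x y s). seg x y s p) = 1"
    using mass_seg[OF xy(1,2), of s "\<lambda>_. True"] mass_True xy unfolding mass_def by simp
  moreover from this have "supp (seg x y s) \<noteq> {}" by auto
  moreover have "0 \<le> seg x y s p" for p
    unfolding seg_def using K_supp(5)[OF xy(1)] K_supp(5)[OF xy(2)] assms by simp
  moreover have "finite (supp (seg x y s))" "supp (seg x y s) \<subseteq> L"
    using finite_subset[OF supp_seg_subset S(1)] supp_seg_subset[of x y s] S(2) by blast+
  ultimately show ?thesis
    unfolding K_iff using chain_subset[OF xy(3) supp_seg_subset] by blast
qed

lemma adjacent_seg:
  assumes "adjacent x y" "0 \<le> s" "s \<le> 1" "0 \<le> t" "t \<le> 1"
  shows "adjacent (seg x y s) (seg x y t)"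
proof -
  have "supp (seg x y s) \<union> supp (seg x y t) \<subseteq> supp x \<union> supp y"
    using supp_seg_subset[of x y s] supp_seg_subset[of x y t] by blast
  then have "Complete_Partial_Order.chain (\<le>) (supp (seg x y s) \<union> supp (seg x y t))"
    using assms(1) chain_subset unfolding adjacent_def by blast
  then show ?thesis using seg_K[OF assms(1)] assms(2-) unfolding adjacent_def by blast
qed

lemma sdist_seg:
  assumes a: "adjacent x y" "0 \<le> s" "s \<le> 1" "0 \<le> t" "t \<le> 1"
  shows "sdist (seg x y s) (seg x y t) = \<bar>s - t\<bar> * sdist x y"
proof -
  have xy: "x \<in> K" "y \<in> K" using a unfolding adjacent_def by auto
  obtain N where N: "\<And>p. p \<in> supp x \<union> supp y \<Longrightarrow> rk p \<le> N" using adjacent_rank_bound[OF a(1)] by blast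
  have N': "rk p \<le> N" if "p \<in> supp (seg x y s) \<union> supp (seg x y t)" for p
    using that supp_seg_subset[of x y s] supp_seg_subset[of x y t] N by blast
  have "level (seg x y s) j - level (seg x y t) j = (t - s) * (level x j - level y j)" for j
    unfolding mass_seg[OF xy] by (simp add: algebra_simps)
  then have "(sdist (seg x y s) (seg x y t))\<^sup>2 = (\<Sum>j\<in>{1..N}. ((s - t) * (level x j - level y j))\<^sup>2)"
    using sdist_levels[OF adjacent_seg[OF a] N'] by (simp add: power_mult_distrib power2_commute)
  also have "\<dots> = (\<bar>s - t\<bar> * sdist x y)\<^sup>2"
    using sdist_levels[OF a(1) N] by (simp add: power_mult_distrib sum_distrib_left)
  finally show ?thesis by (simp add: power2_eq_iff_nonneg sdist_nonneg)
qed

lemma flagged_seg: "adjacent x y \<Longrightarrow> flagged x n k \<Longrightarrow> flagged y n k \<Longrightarrow> 0 \<le> s \<Longrightarrow> s \<le> 1 \<Longrightarrow> flagged (seg x y s) n k"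
  unfolding flagged_def using seg_K[of x y s] supp_seg_subset[of x y s] by blast

lemma flagged_adjacent:
  assumes "flagged x n k" "flagged y n k"
  shows "adjacent x y"
proof -
  have "p \<le> q \<or> q \<le> p" if pq: "p \<in> k ` {..n}" "q \<in> k ` {..n}" for p q
  proof -
    obtain i j where "p = k i" "i \<le> n" "q = k j" "j \<le> n" using pq by blast
    then show ?thesis using flag_mono[of n k] assms(1) unfolding flagged_def by (metis nat_le_linear)
  qed
  then have "Complete_Partial_Order.chain (\<le>) (k ` {..n})" unfolding Complete_Partial_Order.chain_def by blast
  then show ?thesis using assms chain_subset unfolding flagged_def adjacent_def by (metis Un_least)
qed

lemma sdist_flagged:
  assumes "flagged x n k" "flagged y n k"
  shows "(sdist x y)\<^sup>2 = (\<Sum>j\<in>{1..n}. (level x j - level y j)\<^sup>2)"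
proof (rule sdist_levels[OF flagged_adjacent[OF assms]])
  fix p assume "p \<in> supp x \<union> supp y"
  then obtain i where "i \<le> n" "p = k i" using assms unfolding flagged_def by blast
  then show "rk p \<le> n" using assms(1) flag_rk[of n k i] unfolding flagged_def by simp
qed

end

context base_point
begin

text \<open>Pairs enter the optimisation problem only through their jump sets along the flags of \<open>m\<close> and of
  \<open>z\<close>. In these terms the problem has finitely many candidates, and its objective depends continuously
  on the levels \<open>l\<close> of \<open>z\<close>.\<close>

definition pair_types :: "nat \<Rightarrow> (nat \<Rightarrow> 'a) \<Rightarrow> (nat set \<times> nat set) set" where
  "pair_types n' k' = {(J p, jumps n' k' q) | p q. feasible p q}"

definition type_value :: "real \<Rightarrow> (nat \<Rightarrow> real) \<Rightarrow> nat set \<times> nat set \<Rightarrow> real" where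
  "type_value t l v = t * (\<Sum>i\<in>fst v. (level m i)\<^sup>2) + (\<Sum>j\<in>snd v. (l j)\<^sup>2)"

definition block_ratio :: "(nat \<Rightarrow> real) \<Rightarrow> nat set \<times> nat set \<Rightarrow> nat set \<times> nat set \<Rightarrow> real" where
  "block_ratio l v w = (\<Sum>j\<in>snd v - snd w. (l j)\<^sup>2) / (\<Sum>i\<in>fst w - fst v. (level m i)\<^sup>2)"

text \<open>A block system records the exchanges of a support without their parameters: an element \<open>(v, w)\<close>
  leads from the optimal pair \<open>v\<close> to the optimal pair \<open>w\<close>. The parameter is recovered as the ratio of the
  squared norms of the two blocks. Validity says that both pairs are optimal at this parameter; as a
  conjunction of finitely many weak inequalities, it is a closed condition on \<open>l\<close>.\<close>

definition block_system :: "nat \<Rightarrow> (nat \<Rightarrow> 'a) \<Rightarrow> 'a \<Rightarrow> ((nat set \<times> nat set) \<times> (nat set \<times> nat set)) set \<Rightarrow> bool" where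
  "block_system n' k' q0 X \<longleftrightarrow> X \<subseteq> pair_types n' k' \<times> pair_types n' k' \<and>
     (\<forall>(v, w)\<in>X. fst v \<subset> fst w) \<and>
     (\<forall>(v, w)\<in>X. \<forall>(v', w')\<in>X. (v, w) \<noteq> (v', w') \<longrightarrow>
        (fst w - fst v) \<inter> (fst w' - fst v') = {} \<and> (snd v - snd w) \<inter> (snd v' - snd w') = {}) \<and>
     {1..n} = (\<Union>(v, w)\<in>X. fst w - fst v) \<and>
     (\<forall>(v, w)\<in>X. (snd v - snd w) \<inter> jumps n' k' q0 = {}) \<and>
     (\<forall>(v, w)\<in>X. (fst w - fst v) \<inter> J (k' n') \<noteq> {} \<longrightarrow> snd v - snd w = {})"

definition valid_system :: "nat \<Rightarrow> (nat \<Rightarrow> 'a) \<Rightarrow> (nat \<Rightarrow> real) \<Rightarrow> ((nat set \<times> nat set) \<times> (nat set \<times> nat set)) set \<Rightarrow> bool" where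
  "valid_system n' k' l X \<longleftrightarrow> (\<forall>(v, w)\<in>X. \<forall>u\<in>pair_types n' k'.
     type_value (block_ratio l v w) l u \<le> type_value (block_ratio l v w) l v \<and>
     type_value (block_ratio l v w) l u \<le> type_value (block_ratio l v w) l w)"

lemma block_systemD:
  assumes "block_system n' k' q0 X"
  shows "X \<subseteq> pair_types n' k' \<times> pair_types n' k'"
    "(v, w) \<in> X \<Longrightarrow> fst v \<subset> fst w"
    "(v, w) \<in> X \<Longrightarrow> (v', w') \<in> X \<Longrightarrow> (v, w) \<noteq> (v', w') \<Longrightarrow> (fst w - fst v) \<inter> (fst w' - fst v') = {}"
    "(v, w) \<in> X \<Longrightarrow> (v', w') \<in> X \<Longrightarrow> (v, w) \<noteq> (v', w') \<Longrightarrow> (snd v - snd w) \<inter> (snd v' - snd w') = {}"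
    "{1..n} = (\<Union>(v, w)\<in>X. fst w - fst v)"
    "(v, w) \<in> X \<Longrightarrow> (snd v - snd w) \<inter> jumps n' k' q0 = {}"
    "(v, w) \<in> X \<Longrightarrow> (fst w - fst v) \<inter> J (k' n') \<noteq> {} \<Longrightarrow> snd v - snd w = {}"
proof -
  note A = assms[unfolded block_system_def]
  note B = conjunct2[OF A]
  note D = conjunct2[OF B]
  note E = conjunct2[OF D]
  note F = conjunct2[OF E]
  show "X \<subseteq> pair_types n' k' \<times> pair_types n' k'" by (rule conjunct1[OF A])
  show "(v, w) \<in> X \<Longrightarrow> fst v \<subset> fst w" using conjunct1[OF B] by blast
  show "(v, w) \<in> X \<Longrightarrow> (v', w') \<in> X \<Longrightarrow> (v, w) \<noteq> (v', w') \<Longrightarrow> (fst w - fst v) \<inter> (fst w' - fst v') = {}"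
    "(v, w) \<in> X \<Longrightarrow> (v', w') \<in> X \<Longrightarrow> (v, w) \<noteq> (v', w') \<Longrightarrow> (snd v - snd w) \<inter> (snd v' - snd w') = {}"
    using bspec[OF conjunct1[OF D], of "(v, w)"] by auto
  show "{1..n} = (\<Union>(v, w)\<in>X. fst w - fst v)" by (rule conjunct1[OF E])
  show "(v, w) \<in> X \<Longrightarrow> (snd v - snd w) \<inter> jumps n' k' q0 = {}" using bspec[OF conjunct1[OF F], of "(v, w)"] by simp
  show "(v, w) \<in> X \<Longrightarrow> (fst w - fst v) \<inter> J (k' n') \<noteq> {} \<Longrightarrow> snd v - snd w = {}"
    using bspec[OF conjunct2[OF F], of "(v, w)"] by simp
qed

lemma pair_types_sub: "pair_types n' k' \<subseteq> Pow {1..n} \<times> Pow {1..n'}"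
  unfolding pair_types_def using jumps_sub by auto

lemma finite_pair_types: "finite (pair_types n' k')"
  by (rule finite_subset[OF pair_types_sub]) auto

lemma type_value_eq:
  assumes "flagged z n' k'" "p \<in> L" "q \<in> L"
  shows "type_value t (level z) (J p, jumps n' k' q) = t * energy m p + energy z q"
  unfolding type_value_def using energy_m flagged_energy[OF assms(1)] assms by simp

lemma block_ratio_nonneg: "0 \<le> block_ratio l v w"
  unfolding block_ratio_def by (intro divide_nonneg_nonneg sum_nonneg) auto

lemma slope_valid:
  assumes z: "flagged z n' k'" and X: "block_system n' k' q0 X" "valid_system n' k' (level z) X"
    and vw: "(v, w) \<in> X" "i \<in> fst w - fst v"
  shows "slope z i = block_ratio (level z) v w"
proof -
  define t where "t = block_ratio (level z) v w"
  have T: "v \<in> pair_types n' k'" "w \<in> pair_types n' k'" using block_systemD(1)[OF X(1)] vw by auto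
  then obtain p q p' q' where pq: "v = (J p, jumps n' k' q)" "feasible p q" "w = (J p', jumps n' k' q')" "feasible p' q'"
    unfolding pair_types_def by blast
  have L: "p \<in> L" "q \<in> L" "p' \<in> L" "q' \<in> L" using pq unfolding feasible_def by auto
  have val: "type_value t (level z) u \<le> type_value t (level z) v \<and> type_value t (level z) u \<le> type_value t (level z) w"
    if "u \<in> pair_types n' k'" for u
    using X(2) vw that unfolding valid_system_def t_def by fast
  have le: "t * energy m a + energy z b \<le> t * energy m p + energy z q \<and> t * energy m a + energy z b \<le> t * energy m p' + energy z q'"
    if ab: "feasible a b" for a b
  proof -
    have "a \<in> L" "b \<in> L" "(J a, jumps n' k' b) \<in> pair_types n' k'"
      using ab unfolding pair_types_def feasible_def by auto
    then show ?thesis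
      using val[of "(J a, jumps n' k' b)"] type_value_eq[OF z] L unfolding pq by auto
  qed
  have "optimal z t p q" "optimal z t p' q'"
    unfolding optimal_def using pq le by auto
  moreover have "i \<in> J p'" "i \<notin> J p" using vw(2) pq by auto
  moreover have "0 \<le> t" unfolding t_def by (rule block_ratio_nonneg)
  ultimately show ?thesis unfolding t_def[symmetric] using slope_eq[OF z] by blast
qed

lemma block_system_exists:
  assumes z: "flagged z n' k'" and strict: "k' n' \<in> supp z"
    and q0: "q0 \<in> L" "q0 \<le> k' n'" "compat c q0" "\<And>q'. q' \<in> L \<Longrightarrow> q' \<le> k' n' \<Longrightarrow> compat c q' \<Longrightarrow> q' \<le> q0"
  shows "\<exists>X. block_system n' k' q0 X \<and> valid_system n' k' (level z) X"
proof -
  have zK: "z \<in> K" and fk': "flag n' k'" and c': "k' n' \<in> L" using z flag_in unfolding flagged_def by auto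
  let ?J' = "jumps n' k'"
  obtain \<Lambda> P p Q q where "is_support z n' k' q0 \<Lambda> P p Q q"
    using support_exists[OF z strict q0] by blast
  note S = supportD[OF this]
  have feas: "P t \<in> L" "q t \<in> L" "p t \<in> L" "Q t \<in> L" "feasible (P t) (q t)" "feasible (p t) (Q t)"
    if "t \<in> \<Lambda>" for t using S(3,4)[OF that] unfolding optimal_def feasible_def by auto
  define X where "X = (\<lambda>t. ((J (p t), ?J' (Q t)), (J (P t), ?J' (q t)))) ` \<Lambda>"
  have JP: "J (p t) \<subset> J (P t)" if "t \<in> \<Lambda>" for t
    using jumps_mono[OF flag_k feas(3,1)[OF that] S(5)[OF that]] S(6)[OF that] by blast
  have Jq: "?J' (q t) \<subseteq> ?J' (Q t)" if "t \<in> \<Lambda>" for t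
    using jumps_mono[OF fk' feas(2,4)[OF that] S(7)[OF that]] .
  have dis: "J (P t) \<subseteq> J (p t')" "?J' (Q t') \<subseteq> ?J' (q t)" if "t \<in> \<Lambda>" "t' \<in> \<Lambda>" "t < t'" for t t'
    using jumps_mono[OF flag_k feas(1)[OF that(1)] feas(3)[OF that(2)] S(9)[OF that]]
      jumps_mono[OF fk' feas(4)[OF that(2)] feas(2)[OF that(1)] S(10)[OF that]] by auto
  have "block_system n' k' q0 X"
    unfolding block_system_def
  proof (intro conjI)
    show "X \<subseteq> pair_types n' k' \<times> pair_types n' k'"
      unfolding X_def pair_types_def using feas by blast
    show "\<forall>(v, w)\<in>X. fst v \<subset> fst w" unfolding X_def using JP by auto
    have "(J (P t) - J (p t)) \<inter> (J (P t') - J (p t')) = {} \<and> (?J' (Q t) - ?J' (q t)) \<inter> (?J' (Q t') - ?J' (q t')) = {}"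
      if "t \<in> \<Lambda>" "t' \<in> \<Lambda>" "t \<noteq> t'" for t t'
      using dis[OF that(1,2)] dis[OF that(2,1)] that(3) by (cases t t' rule: linorder_cases) blast+
    then show "\<forall>(v, w)\<in>X. \<forall>(v', w')\<in>X. (v, w) \<noteq> (v', w') \<longrightarrow>
        (fst w - fst v) \<inter> (fst w' - fst v') = {} \<and> (snd v - snd w) \<inter> (snd v' - snd w') = {}"
      unfolding X_def by fastforce
    show "{1..n} = (\<Union>(v, w)\<in>X. fst w - fst v)"
      unfolding X_def using S(11) jumps_sub[of n k] by auto
    have "?J' q0 \<subseteq> ?J' (q t)" if "t \<in> \<Lambda>" for t
      using jumps_mono[OF fk' q0(1) feas(2)[OF that] S(13)[OF that]] .
    then show "\<forall>(v, w)\<in>X. (snd v - snd w) \<inter> ?J' q0 = {}" unfolding X_def by auto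
    have "?J' (Q t) - ?J' (q t) = {}" if t: "t \<in> \<Lambda>" and ne: "(J (P t) - J (p t)) \<inter> J (k' n') \<noteq> {}" for t
    proof (cases "t = 0")
      case True
      then have "Q t = q t" using S(15)[OF t] S(7,8)[OF t] by simp
      then show ?thesis by simp
    next
      case False
      then have "c \<sqinter> k' n' \<le> p t" using S(2,14)[OF t] by simp
      then have "J (c \<sqinter> k' n') \<subseteq> J (p t)" using feas(3)[OF t] cL c' by (intro jumps_mono[OF flag_k]) auto
      moreover have "J (c \<sqinter> k' n') = J (k' n')" using jumps_meet_top[OF flag_k c'] by (simp add: meet_commute)
      ultimately show ?thesis using ne by blast
    qed
    then show "\<forall>(v, w)\<in>X. (fst w - fst v) \<inter> J (k' n') \<noteq> {} \<longrightarrow> snd v - snd w = {}" unfolding X_def by auto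
  qed
  moreover have "valid_system n' k' (level z) X"
  proof -
    have "type_value s (level z) u \<le> type_value s (level z) (J (p t), ?J' (Q t)) \<and>
          type_value s (level z) u \<le> type_value s (level z) (J (P t), ?J' (q t))"
      if t: "t \<in> \<Lambda>" and u: "u \<in> pair_types n' k'" and s: "s = block_ratio (level z) (J (p t), ?J' (Q t)) (J (P t), ?J' (q t))" for t u s
    proof -
      have eq: "t * (energy m (P t) - energy m (p t)) = energy z (Q t) - energy z (q t)"
        using optimalD[OF S(3)[OF t] feas(6)[OF t]] optimalD[OF S(4)[OF t] feas(5)[OF t]] by (simp add: algebra_simps)
      have "(\<Sum>j\<in>?J' (Q t) - ?J' (q t). (level z j)\<^sup>2) = energy z (Q t) - energy z (q t)"
        using Jq[OF t] flagged_energy[OF z] feas[OF t] by (simp add: sum_diff)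
      moreover have "(\<Sum>i\<in>J (P t) - J (p t). (level m i)\<^sup>2) = energy m (P t) - energy m (p t)"
        using JP[OF t] energy_m feas[OF t] by (subst sum_diff) auto
      moreover have "energy m (p t) < energy m (P t)"
      proof (rule energy_m_strict)
        show "p t < P t" using S(5,6)[OF t] by (auto simp: order_le_less)
      qed (use feas[OF t] in \<open>auto simp: feasible_def\<close>)
      ultimately have st: "s = t" unfolding s block_ratio_def using eq[symmetric] by simp
      obtain a b where ab: "u = (J a, ?J' b)" "feasible a b" using u unfolding pair_types_def by blast
      then have "a \<in> L" "b \<in> L" unfolding feasible_def by auto
      then show ?thesis
        unfolding st ab(1) using type_value_eq[OF z] feas[OF t] optimalD[OF S(3)[OF t] ab(2)] optimalD[OF S(4)[OF t] ab(2)] by simp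
    qed
    then show ?thesis unfolding valid_system_def X_def by auto
  qed
  ultimately show ?thesis by blast
qed

text \<open>If the block \<open>B\<close> of \<open>z\<close> is nonempty, then the block \<open>A\<close> of the developing map is a multiple of a unit
  vector by the norm of \<open>B\<close>, and the reverse triangle inequality applies.\<close>

lemma block_bound:
  assumes m: "finite A" "finite B" "0 < (\<Sum>i\<in>A. (level m i)\<^sup>2)"
    and z: "B \<noteq> {} \<Longrightarrow> \<forall>i\<in>A. \<rho> i = 0 \<and> \<rho>' i = 0"
  shows "(\<Sum>i\<in>A. ((\<rho> i - sqrt ((\<Sum>j\<in>B. (l j)\<^sup>2) / (\<Sum>i\<in>A. (level m i)\<^sup>2)) * level m i)
                - (\<rho>' i - sqrt ((\<Sum>j\<in>B. (l' j)\<^sup>2) / (\<Sum>i\<in>A. (level m i)\<^sup>2)) * level m i))\<^sup>2)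
       \<le> (\<Sum>i\<in>A. (\<rho> i - \<rho>' i)\<^sup>2) + (\<Sum>j\<in>B. (l j - l' j)\<^sup>2)"
proof (cases "B = {}")
  case False
  define M where "M = (\<Sum>i\<in>A. (level m i)\<^sup>2)"
  define a where "a = sqrt (\<Sum>j\<in>B. (l j)\<^sup>2)"
  define b where "b = sqrt (\<Sum>j\<in>B. (l' j)\<^sup>2)"
  have M: "0 < M" using m unfolding M_def by simp
  have "(\<Sum>i\<in>A. ((\<rho> i - sqrt ((\<Sum>j\<in>B. (l j)\<^sup>2) / M) * level m i) - (\<rho>' i - sqrt ((\<Sum>j\<in>B. (l' j)\<^sup>2) / M) * level m i))\<^sup>2)
      = (\<Sum>i\<in>A. ((a - b)\<^sup>2 / M) * (level m i)\<^sup>2)"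
  proof (intro sum.cong refl)
    fix i assume "i \<in> A"
    then have "\<rho> i = 0" "\<rho>' i = 0" using z[OF False] by auto
    then have "((\<rho> i - sqrt ((\<Sum>j\<in>B. (l j)\<^sup>2) / M) * level m i) - (\<rho>' i - sqrt ((\<Sum>j\<in>B. (l' j)\<^sup>2) / M) * level m i))\<^sup>2
        = ((b - a) / sqrt M * level m i)\<^sup>2"
      by (simp add: real_sqrt_divide a_def b_def diff_divide_distrib left_diff_distrib)
    also have "\<dots> = ((a - b)\<^sup>2 / M) * (level m i)\<^sup>2"
      using M by (simp add: power_mult_distrib power_divide power2_commute)
    finally show "((\<rho> i - sqrt ((\<Sum>j\<in>B. (l j)\<^sup>2) / M) * level m i) - (\<rho>' i - sqrt ((\<Sum>j\<in>B. (l' j)\<^sup>2) / M) * level m i))\<^sup>2 = ((a - b)\<^sup>2 / M) * (level m i)\<^sup>2" .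
  qed
  also have "\<dots> = (a - b)\<^sup>2 / M * M" unfolding M_def by (rule sum_distrib_left[symmetric])
  also have "\<dots> = (a - b)\<^sup>2" using M by simp
  also have "\<dots> \<le> (\<Sum>j\<in>B. (l j - l' j)\<^sup>2)" unfolding a_def b_def by (rule sqrt_sum_squares_diff)
  also have "\<dots> \<le> (\<Sum>i\<in>A. (\<rho> i - \<rho>' i)\<^sup>2) + (\<Sum>j\<in>B. (l j - l' j)\<^sup>2)" by (simp add: sum_nonneg)
  finally show ?thesis unfolding M_def .
qed simp

text \<open>The coordinates of the developing map fall into the coordinate \<open>0\<close>, the part below \<open>c\<close>, and the blocks.
  Each is controlled by a set of coordinates of \<open>z\<close>: the coordinates of \<open>q0\<close> outside \<open>c\<close>, those of \<open>c\<close>, and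
  the blocks of \<open>z\<close>. These sets are disjoint, so the squares add up.\<close>

lemma dev_same_type:
  assumes z: "flagged z n' k'" "flagged z' n' k'"
    and q0: "q0 \<in> L" "q0 \<le> k' n'" "compat c q0" "\<And>q'. q' \<in> L \<Longrightarrow> q' \<le> k' n' \<Longrightarrow> compat c q' \<Longrightarrow> q' \<le> q0"
    and X: "block_system n' k' q0 X" "valid_system n' k' (level z) X" "valid_system n' k' (level z') X"
  shows "(\<Sum>i\<in>{0..n}. (dev z i - dev z' i)\<^sup>2) \<le> (sdist z z')\<^sup>2"
proof -
  have zK: "z \<in> K" "z' \<in> K" and fk': "flag n' k'" and c': "k' n' \<in> L" using z flag_in unfolding flagged_def by auto
  let ?J' = "jumps n' k'"
  define \<rho> where "\<rho> z i = mass z (\<lambda>p. i \<in> J p)" for z i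
  define A where "A b = fst (snd b) - fst (fst b)" for b :: "(nat set \<times> nat set) \<times> (nat set \<times> nat set)"
  define B where "B b = snd (fst b) - snd (snd b)" for b :: "(nat set \<times> nat set) \<times> (nat set \<times> nat set)"
  have XT: "X \<subseteq> pair_types n' k' \<times> pair_types n' k'" using block_systemD(1)[OF X(1)] .
  have finX: "finite X" using finite_subset[OF XT] finite_pair_types by blast
  have AB: "finite (A b)" "finite (B b)" "A b \<subseteq> {1..n}" "B b \<subseteq> {1..n'}" "A b \<noteq> {}"
      "B b \<inter> ?J' q0 = {}" "A b \<inter> J (k' n') \<noteq> {} \<Longrightarrow> B b = {}" if "b \<in> X" for b
  proof -
    obtain v w where vw: "b = (v, w)" by (cases b)
    then have T: "v \<in> Pow {1..n} \<times> Pow {1..n'}" "w \<in> Pow {1..n} \<times> Pow {1..n'}" using XT that pair_types_sub by blast+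
    then show "A b \<subseteq> {1..n}" "B b \<subseteq> {1..n'}" unfolding A_def B_def vw by auto
    then show "finite (A b)" "finite (B b)" using finite_subset by blast+
    have "(v, w) \<in> X" using that vw by simp
    note D = block_systemD(2,6,7)[OF X(1) this]
    show "A b \<noteq> {}" using D(1) unfolding A_def vw by auto
    show "B b \<inter> ?J' q0 = {}" using D(2) unfolding B_def vw by simp
    show "A b \<inter> J (k' n') \<noteq> {} \<Longrightarrow> B b = {}" using D(3) unfolding A_def B_def vw by simp
  qed
  have dis: "A b \<inter> A b' = {}" "B b \<inter> B b' = {}" if "b \<in> X" "b' \<in> X" "b \<noteq> b'" for b b'
    using block_systemD(3,4)[OF X(1), of "fst b" "snd b" "fst b'" "snd b'"] that
    unfolding A_def B_def by auto
  have UA: "{1..n} = \<Union>(A ` X)"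
    unfolding A_def block_systemD(5)[OF X(1)] by (simp add: case_prod_beta)
  have \<rho>0: "\<rho> x i = 0" if x: "flagged x n' k'" and i: "i \<notin> J (k' n')" for x i
  proof -
    have "mass x (\<lambda>p. i \<in> J p) = mass x (\<lambda>p. False)"
    proof (rule mass_cong)
      fix p assume "p \<in> supp x"
      then have "p \<le> k' n'" "p \<in> L" using flagged_le[OF x] K_supp(1) x unfolding flagged_def by auto
      then show "(i \<in> J p) = False" using jumps_mono[OF flag_k _ c'] i by blast
    qed
    then show ?thesis unfolding \<rho>_def by simp
  qed
  have dev_b: "dev x i = \<rho> x i - sqrt ((\<Sum>j\<in>B b. (level x j)\<^sup>2) / (\<Sum>i\<in>A b. (level m i)\<^sup>2)) * level m i"
    if x: "flagged x n' k'" "valid_system n' k' (level x) X" and b: "b \<in> X" "i \<in> A b" for x b i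
  proof -
    obtain v w where vw: "b = (v, w)" by (cases b)
    have "slope x i = block_ratio (level x) v w" using slope_valid[OF x(1) X(1) x(2)] b unfolding vw A_def by simp
    moreover have "i \<noteq> 0" using AB(3)[OF b(1)] b(2) by force
    ultimately show ?thesis unfolding dev_def \<rho>_def block_ratio_def A_def B_def vw by simp
  qed
  have blk: "(\<Sum>i\<in>A b. (dev z i - dev z' i)\<^sup>2) \<le> (\<Sum>i\<in>A b. (\<rho> z i - \<rho> z' i)\<^sup>2) + (\<Sum>j\<in>B b. (level z j - level z' j)\<^sup>2)"
    if b: "b \<in> X" for b
  proof -
    have pos: "0 < (\<Sum>i\<in>A b. (level m i)\<^sup>2)"
    proof (rule sum_pos)
      fix i assume "i \<in> A b"
      then have "i \<le> n" using AB(3)[OF b] by force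
      then show "0 < (level m i)\<^sup>2" using level_m_pos[of i] by simp
    qed (use AB[OF b] in auto)
    have "(\<Sum>i\<in>A b. (dev z i - dev z' i)\<^sup>2) =
       (\<Sum>i\<in>A b. ((\<rho> z i - sqrt ((\<Sum>j\<in>B b. (level z j)\<^sup>2) / (\<Sum>i\<in>A b. (level m i)\<^sup>2)) * level m i)
                - (\<rho> z' i - sqrt ((\<Sum>j\<in>B b. (level z' j)\<^sup>2) / (\<Sum>i\<in>A b. (level m i)\<^sup>2)) * level m i))\<^sup>2)"
      by (intro sum.cong refl) (simp only: dev_b[OF z(1) X(2) b] dev_b[OF z(2) X(3) b])
    also have "\<dots> \<le> (\<Sum>i\<in>A b. (\<rho> z i - \<rho> z' i)\<^sup>2) + (\<Sum>j\<in>B b. (level z j - level z' j)\<^sup>2)"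
    proof (rule block_bound[OF AB(1,2)[OF b] pos])
      assume "B b \<noteq> {}"
      then have "A b \<inter> J (k' n') = {}" using AB(7)[OF b] by blast
      then show "\<forall>i\<in>A b. \<rho> z i = 0 \<and> \<rho> z' i = 0" using \<rho>0[OF z(1)] \<rho>0[OF z(2)] by blast
    qed
    finally show ?thesis .
  qed
  have a: "adjacent z z'" using flagged_adjacent[OF z] .
  have SL: "p \<in> L" "p \<le> k' n'" if "p \<in> supp z \<union> supp z'" for p
    using that K_supp(1) zK flagged_le z by blast+
  \<comment> \<open>The part below \<open>c\<close> has the same inner products along both flags, as the jumps of \<open>p\<close> in the flag of
    \<open>m\<close> and the jumps of \<open>c\<close> up to \<open>p\<close> in the flag of \<open>z\<close> both count the rank of \<open>p \<sqinter> c\<close>.\<close>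
  have rho: "(\<Sum>i\<in>{1..n}. (\<rho> z i - \<rho> z' i)\<^sup>2) = (\<Sum>j\<in>?J' c. (level z j - level z' j)\<^sup>2)"
  proof -
    have flg: "\<exists>i\<le>n'. p = k' i" if "p \<in> supp z \<union> supp z'" for p using that z unfolding flagged_def by blast
    have 1: "(\<Sum>i\<in>{1..n}. (\<rho> z i - \<rho> z' i)\<^sup>2) =
      (\<Sum>p\<in>supp z \<union> supp z'. \<Sum>q\<in>supp z \<union> supp z'. (z p - z' p) * (z q - z' q) * real (min (card (J p)) (card (J q))))"
      unfolding \<rho>_def
      using SL jumps_sub jumps_mono[OF flag_k] by (intro mass_labels_gram[OF a]) auto
    have 2: "(\<Sum>j\<in>?J' c. (mass z (\<lambda>p. j \<in> ?J' c \<inter> {1..rk p}) - mass z' (\<lambda>p. j \<in> ?J' c \<inter> {1..rk p}))\<^sup>2) =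
      (\<Sum>p\<in>supp z \<union> supp z'. \<Sum>q\<in>supp z \<union> supp z'. (z p - z' p) * (z q - z' q) *
          real (min (card (?J' c \<inter> {1..rk p})) (card (?J' c \<inter> {1..rk q}))))"
    proof (rule mass_labels_gram[OF a])
      fix p q assume "p \<in> supp z \<union> supp z'" "q \<in> supp z \<union> supp z'" "p \<le> q"
      then have "rk p \<le> rk q" using SL rk_mono by blast
      then show "?J' c \<inter> {1..rk p} \<subseteq> ?J' c \<inter> {1..rk q}" by auto
    qed auto
    have "card (J p) = card (?J' c \<inter> {1..rk p})" if p: "p \<in> supp z \<union> supp z'" for p
    proof -
      obtain i where i: "i \<le> n'" "p = k' i" using flg[OF p] by blast
      have "card (?J' c \<inter> {1..rk p}) = rk (c \<sqinter> p)" using card_jumps_Int[OF fk' cL i(1)] flag_rk[OF fk'] i by simp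
      also have "\<dots> = card (J p)" using card_jumps[OF flag_k SL(1)[OF p]] by (simp add: meet_commute)
      finally show ?thesis by simp
    qed
    then have "(\<Sum>i\<in>{1..n}. (\<rho> z i - \<rho> z' i)\<^sup>2) =
        (\<Sum>j\<in>?J' c. (mass z (\<lambda>p. j \<in> ?J' c \<inter> {1..rk p}) - mass z' (\<lambda>p. j \<in> ?J' c \<inter> {1..rk p}))\<^sup>2)"
      unfolding 1 2 by (intro sum.cong refl) simp
    also have "\<dots> = (\<Sum>j\<in>?J' c. (level z j - level z' j)\<^sup>2)"
    proof (intro sum.cong refl)
      fix j assume j: "j \<in> ?J' c"
      then have "1 \<le> j" using jumps_sub[of n' k' c] by auto
      then have "mass x (\<lambda>p. j \<in> ?J' c \<inter> {1..rk p}) = level x j" for x using j by (intro mass_cong) auto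
      then show "(mass z (\<lambda>p. j \<in> ?J' c \<inter> {1..rk p}) - mass z' (\<lambda>p. j \<in> ?J' c \<inter> {1..rk p}))\<^sup>2 = (level z j - level z' j)\<^sup>2" by simp
    qed
    finally show ?thesis .
  qed
  have Jcq0: "?J' c \<subseteq> ?J' q0"
  proof -
    have "compat c (c \<sqinter> k' n')" using compatI[OF cL order_refl] cL c' by simp
    then have "c \<sqinter> k' n' \<le> q0" using q0(4) cL c' by auto
    then have "?J' (c \<sqinter> k' n') \<subseteq> ?J' q0" using cL c' q0 by (intro jumps_mono[OF fk']) auto
    then show ?thesis using jumps_meet_top[OF fk' cL] by simp
  qed
  have out: "outer x = (\<Sum>j\<in>?J' q0 - ?J' c. (level x j)\<^sup>2)" if x: "flagged x n' k'" for x
    using outer_eq[OF x q0] flagged_energy[OF x] q0 cL Jcq0 by (simp add: sum_diff)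
  have "(\<Sum>i\<in>{0..n}. (dev z i - dev z' i)\<^sup>2) = (dev z 0 - dev z' 0)\<^sup>2 + (\<Sum>i\<in>{1..n}. (dev z i - dev z' i)\<^sup>2)"
    by (simp add: sum.atLeast_Suc_atMost)
  also have "(\<Sum>i\<in>{1..n}. (dev z i - dev z' i)\<^sup>2) = (\<Sum>b\<in>X. \<Sum>i\<in>A b. (dev z i - dev z' i)\<^sup>2)"
    unfolding UA using finX AB dis by (intro sum.UNION_disjoint) auto
  also have "\<dots> \<le> (\<Sum>b\<in>X. (\<Sum>i\<in>A b. (\<rho> z i - \<rho> z' i)\<^sup>2) + (\<Sum>j\<in>B b. (level z j - level z' j)\<^sup>2))"
    by (intro sum_mono blk)
  also have "\<dots> = (\<Sum>i\<in>{1..n}. (\<rho> z i - \<rho> z' i)\<^sup>2) + (\<Sum>j\<in>\<Union>(B ` X). (level z j - level z' j)\<^sup>2)"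
  proof -
    have "(\<Sum>i\<in>{1..n}. (\<rho> z i - \<rho> z' i)\<^sup>2) = (\<Sum>b\<in>X. \<Sum>i\<in>A b. (\<rho> z i - \<rho> z' i)\<^sup>2)"
      unfolding UA using finX AB dis by (intro sum.UNION_disjoint) auto
    moreover have "(\<Sum>j\<in>\<Union>(B ` X). (level z j - level z' j)\<^sup>2) = (\<Sum>b\<in>X. \<Sum>j\<in>B b. (level z j - level z' j)\<^sup>2)"
      using finX AB dis by (intro sum.UNION_disjoint) auto
    ultimately show ?thesis by (simp add: sum.distrib)
  qed
  also have "(dev z 0 - dev z' 0)\<^sup>2 \<le> (\<Sum>j\<in>?J' q0 - ?J' c. (level z j - level z' j)\<^sup>2)"
    unfolding dev_def out[OF z(1)] out[OF z(2)] by (simp add: sqrt_sum_squares_diff)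
  finally have "(\<Sum>i\<in>{0..n}. (dev z i - dev z' i)\<^sup>2) \<le> (\<Sum>j\<in>?J' q0 - ?J' c. (level z j - level z' j)\<^sup>2) +
      ((\<Sum>j\<in>?J' c. (level z j - level z' j)\<^sup>2) + (\<Sum>j\<in>\<Union>(B ` X). (level z j - level z' j)\<^sup>2))"
    unfolding rho by linarith
  also have "\<dots> = (\<Sum>j\<in>?J' q0 \<union> \<Union>(B ` X). (level z j - level z' j)\<^sup>2)"
  proof -
    have "(\<Sum>j\<in>?J' q0. (level z j - level z' j)\<^sup>2) = (\<Sum>j\<in>?J' q0 - ?J' c. (level z j - level z' j)\<^sup>2) + (\<Sum>j\<in>?J' c. (level z j - level z' j)\<^sup>2)"
      using Jcq0 by (intro sum.subset_diff) auto
    moreover have "(\<Sum>j\<in>?J' q0 \<union> \<Union>(B ` X). (level z j - level z' j)\<^sup>2) =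
       (\<Sum>j\<in>?J' q0. (level z j - level z' j)\<^sup>2) + (\<Sum>j\<in>\<Union>(B ` X). (level z j - level z' j)\<^sup>2)"
    proof (rule sum.union_disjoint)
      show "finite (\<Union>(B ` X))" using finX AB(2) by blast
      show "?J' q0 \<inter> \<Union>(B ` X) = {}" using AB(6) by blast
    qed simp
    ultimately show ?thesis by simp
  qed
  also have "\<dots> \<le> (\<Sum>j\<in>{1..n'}. (level z j - level z' j)\<^sup>2)"
  proof (rule sum_mono2)
    show "?J' q0 \<union> \<Union>(B ` X) \<subseteq> {1..n'}" using AB(4) jumps_sub[of n' k' q0] by blast
  qed auto
  also have "\<dots> = (sdist z z')\<^sup>2" using sdist_flagged[OF z] by simp
  finally show ?thesis .
qed

text \<open>Along a segment only finitely many block systems occur, and each of them is valid on a closed set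
  of parameters. They cover the interior of the segment, hence also its ends.\<close>

lemma dev_lipschitz:
  assumes a: "adjacent x y"
  shows "L2_set (\<lambda>i. dev x i - dev y i) {0..n} \<le> sdist x y"
proof -
  have xy: "x \<in> K" "y \<in> K" using a unfolding adjacent_def by auto
  obtain n' k' where fl: "flagged x n' k'" "flagged y n' k'" "k' n' \<in> supp x \<union> supp y"
    using ex_flagged[OF a] by blast
  have c': "k' n' \<in> L" using fl flag_in unfolding flagged_def by auto
  obtain q0 where q0: "q0 \<in> L" "q0 \<le> k' n'" "compat c q0" "\<And>q'. q' \<in> L \<Longrightarrow> q' \<le> k' n' \<Longrightarrow> compat c q' \<Longrightarrow> q' \<le> q0"
    using ex_outer[OF c'] by blast
  define l where "l s j = (1 - s) * level x j + s * level y j" for s j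
  have lev: "level (seg x y s) = l s" for s unfolding l_def using mass_seg[OF xy] by auto
  define \<X> where "\<X> = {X. block_system n' k' q0 X}"
  have fin\<X>: "finite \<X>"
    by (rule finite_subset[of _ "Pow (pair_types n' k' \<times> pair_types n' k')"])
      (auto simp: \<X>_def block_system_def finite_pair_types)
  define W where "W X = {s. valid_system n' k' (l s) X}" for X
  have Wcl: "closed (W X)" if "X \<in> \<X>" for X
  proof -
    have pos: "(\<Sum>i\<in>fst w - fst v. (level m i)\<^sup>2) \<noteq> 0" if "(v, w) \<in> X" for v w
    proof -
      have vw: "fst v \<subset> fst w" "fst w \<subseteq> {1..n}"
      proof -
        have X: "block_system n' k' q0 X" using \<open>X \<in> \<X>\<close> unfolding \<X>_def by simp
        show "fst v \<subset> fst w" by (rule block_systemD(2)[OF X that])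
        have "w \<in> Pow {1..n} \<times> Pow {1..n'}" using block_systemD(1)[OF X] that pair_types_sub by blast
        then show "fst w \<subseteq> {1..n}" by auto
      qed
      then have "finite (fst w)" using finite_subset by blast
      then have "0 < (\<Sum>i\<in>fst w - fst v. (level m i)\<^sup>2)"
      proof (intro sum_pos)
        fix i assume "i \<in> fst w - fst v"
        then have "i \<le> n" using vw(2) by force
        then show "0 < (level m i)\<^sup>2" using level_m_pos[of i] by simp
      qed (use vw in auto)
      then show ?thesis by simp
    qed
    have cont_l: "continuous_on UNIV (\<lambda>s. l s j)" for j unfolding l_def by (intro continuous_intros)
    have cont_r: "continuous_on UNIV (\<lambda>s. block_ratio (l s) v w)" if "(v, w) \<in> X" for v w
      unfolding block_ratio_def using pos[OF that] by (intro continuous_intros cont_l) auto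
    have cont_t: "continuous_on UNIV (\<lambda>s. type_value (block_ratio (l s) v w) (l s) u)" if "(v, w) \<in> X" for v w u
      unfolding type_value_def by (intro continuous_intros cont_l cont_r[OF that])
    have "W X = (\<Inter>(v, w)\<in>X. \<Inter>u\<in>pair_types n' k'.
       {s. type_value (block_ratio (l s) v w) (l s) u \<le> type_value (block_ratio (l s) v w) (l s) v} \<inter>
       {s. type_value (block_ratio (l s) v w) (l s) u \<le> type_value (block_ratio (l s) v w) (l s) w})"
      unfolding W_def valid_system_def by auto
    moreover have "closed \<dots>"
      by (intro closed_INT ballI) (auto intro!: closed_INT closed_Int closed_Collect_le cont_t)
    ultimately show ?thesis by simp
  qed
  have inner: "{0<..<1} \<subseteq> \<Union>(W ` \<X>)"
  proof
    fix s :: real assume s: "s \<in> {0<..<1}"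
    have 1: "flagged (seg x y s) n' k'" using flagged_seg[OF a fl(1,2)] s by simp
    have 2: "k' n' \<in> supp (seg x y s)" using supp_seg[OF xy, of s] s fl(3) by simp
    obtain X where "block_system n' k' q0 X" "valid_system n' k' (level (seg x y s)) X"
      using block_system_exists[OF 1 2 q0] by blast
    then show "s \<in> \<Union>(W ` \<X>)" unfolding W_def \<X>_def lev by auto
  qed
  have "closed (\<Union>(W ` \<X>))" using fin\<X> Wcl by auto
  then have cover: "{0..1} \<subseteq> \<Union>(W ` \<X>)"
    using closure_minimal[OF inner] by (simp add: closure_greaterThanLessThan)
  define d where "d s t = L2_set (\<lambda>i. dev (seg x y s) i - dev (seg x y t) i) {0..n}" for s t
  have "d 0 1 \<le> sdist x y * (1 - 0)"
  proof (rule lipschitz_from_closed_cover[where \<S> = "W ` \<X>"])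
    show "d a c \<le> d a b + d b c" for a b c
      using L2_set_triangle_ineq[of "\<lambda>i. dev (seg x y a) i - dev (seg x y b) i" "\<lambda>i. dev (seg x y b) i - dev (seg x y c) i" "{0..n}"]
      unfolding d_def by simp
    fix S s t assume S: "S \<in> W ` \<X>" "s \<in> S" "t \<in> S" and st: "0 \<le> s" "s \<le> t" "t \<le> (1::real)"
    then obtain X where X: "X \<in> \<X>" "s \<in> W X" "t \<in> W X" by auto
    have "(\<Sum>i\<in>{0..n}. (dev (seg x y s) i - dev (seg x y t) i)\<^sup>2) \<le> (sdist (seg x y s) (seg x y t))\<^sup>2"
    proof -
      have 1: "flagged (seg x y s) n' k'" "flagged (seg x y t) n' k'" using flagged_seg[OF a fl(1,2)] st by auto
      have 2: "block_system n' k' q0 X" using X unfolding \<X>_def by simp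
      have 3: "valid_system n' k' (level (seg x y s)) X" "valid_system n' k' (level (seg x y t)) X"
        using X unfolding W_def lev by auto
      show ?thesis by (rule dev_same_type[OF 1 q0 2 3])
    qed
    then have "d s t \<le> sdist (seg x y s) (seg x y t)"
      unfolding d_def L2_set_def by (intro real_le_lsqrt) (auto simp: sdist_nonneg sum_nonneg)
    then show "d s t \<le> sdist x y * (t - s)" using sdist_seg[OF a] st by (simp add: mult.commute)
  qed (use fin\<X> Wcl cover in auto)
  then show ?thesis unfolding d_def by simp
qed

end

section \<open>Points with prescribed levels\<close>

text \<open>A decreasing step function from \<open>{0<..1}\<close> to the poset describes the point whose coefficient
  at \<open>p\<close> is the length of the interval on which the value \<open>p\<close> is taken.\<close>

definition step_point :: "(real \<Rightarrow> 'a) \<Rightarrow> 'a \<Rightarrow> real" where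
  "step_point f = (\<lambda>p. measure lborel {\<theta> \<in> {0<..1}. f \<theta> = p})"

lemma step_fiber:
  fixes f :: "real \<Rightarrow> 'a::order"
  assumes "\<And>\<theta> \<theta>'. 0 < \<theta> \<Longrightarrow> \<theta> \<le> \<theta>' \<Longrightarrow> \<theta>' \<le> 1 \<Longrightarrow> f \<theta>' \<le> f \<theta>"
  shows "{\<theta> \<in> {0<..1}. f \<theta> = p} \<in> fmeasurable lborel"
proof -
  have "is_interval {\<theta> \<in> {0<..1}. f \<theta> = p}"
    unfolding is_interval_1
  proof clarify
    fix a b x :: real assume *: "a \<in> {0<..1}" "b \<in> {0<..1}" "a \<le> x" "x \<le> b" "f b = f a" "p = f a"
    then have "f x \<le> f a" "f b \<le> f x" using assms[of a x] assms[of x b] by auto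
    then show "x \<in> {0<..1} \<and> f x = f a" using * by auto
  qed
  then have "{\<theta> \<in> {0<..1}. f \<theta> = p} \<in> sets lborel" using real_interval_borel_measurable by simp
  moreover have "{0<..1::real} \<in> fmeasurable lborel" by (auto simp: fmeasurable_def)
  ultimately show ?thesis by (rule fmeasurableI2[rotated 2]) auto
qed

lemma sum_step_point:
  fixes f :: "real \<Rightarrow> 'a::order"
  assumes mono: "\<And>\<theta> \<theta>'. 0 < \<theta> \<Longrightarrow> \<theta> \<le> \<theta>' \<Longrightarrow> \<theta>' \<le> 1 \<Longrightarrow> f \<theta>' \<le> f \<theta>"
    and fin: "finite (f ` {0<..1})"
  shows "(\<Sum>p\<in>f ` {0<..1}. step_point f p * of_bool (P p)) = measure lborel {\<theta> \<in> {0<..1}. P (f \<theta>)}"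
proof -
  have "(\<Sum>p\<in>f ` {0<..1}. step_point f p * of_bool (P p)) = (\<Sum>p\<in>{p\<in>f ` {0<..1}. P p}. measure lborel {\<theta> \<in> {0<..1}. f \<theta> = p})"
    unfolding step_point_def using fin by (intro sum.mono_neutral_cong_right) auto
  also have "\<dots> = measure lborel (\<Union>p\<in>{p\<in>f ` {0<..1}. P p}. {\<theta> \<in> {0<..1}. f \<theta> = p})"
    using fin step_fiber[of f, OF mono]
    by (intro measure_UNION'[symmetric]) (auto simp: pairwise_def disjnt_def)
  also have "(\<Union>p\<in>{p\<in>f ` {0<..1}. P p}. {\<theta> \<in> {0<..1}. f \<theta> = p}) = {\<theta> \<in> {0<..1}. P (f \<theta>)}" by auto
  finally show ?thesis .
qed

context modular_semilattice_finite_rank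
begin

lemma step_point_props:
  assumes mono: "\<And>\<theta> \<theta>'. 0 < \<theta> \<Longrightarrow> \<theta> \<le> \<theta>' \<Longrightarrow> \<theta>' \<le> 1 \<Longrightarrow> f \<theta>' \<le> f \<theta>"
    and fin: "finite (f ` {0<..1})" and L: "f ` {0<..1} \<subseteq> L"
  shows "step_point f \<in> K" "supp (step_point f) \<subseteq> f ` {0<..1}"
    "mass (step_point f) P = measure lborel {\<theta> \<in> {0<..1}. P (f \<theta>)}"
proof -
  show sub: "supp (step_point f) \<subseteq> f ` {0<..1}"
  proof
    fix p assume "p \<in> supp (step_point f)"
    then have "measure lborel {\<theta> \<in> {0<..1}. f \<theta> = p} \<noteq> 0" unfolding supp_def step_point_def by simp
    then have "{\<theta> \<in> {0<..1}. f \<theta> = p} \<noteq> {}" by (metis measure_empty)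
    then show "p \<in> f ` {0<..1}" by blast
  qed
  show mass: "mass (step_point f) P = measure lborel {\<theta> \<in> {0<..1}. P (f \<theta>)}" for P
    unfolding mass_eq_sum[OF fin sub] by (rule sum_step_point[OF mono fin])
  have 1: "(\<Sum>p\<in>supp (step_point f). step_point f p) = 1"
  proof -
    have "{\<theta> \<in> {0<..1::real}. True} = {0<..1}" by auto
    then show ?thesis using mass[of "\<lambda>_. True"] unfolding mass_def by simp
  qed
  moreover from 1 have "supp (step_point f) \<noteq> {}" by auto
  moreover have "Complete_Partial_Order.chain (\<le>) (f ` {0<..1})"
    unfolding Complete_Partial_Order.chain_def
  proof clarify
    fix a b :: real assume "a \<in> {0<..1}" "b \<in> {0<..1}" "\<not> f b \<le> f a"
    then show "f a \<le> f b" using mono[of a b] mono[of b a] by (cases "a \<le> b") auto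
  qed
  moreover have "0 \<le> step_point f p" for p unfolding step_point_def by simp
  ultimately show "step_point f \<in> K"
    unfolding K_iff using sub L fin chain_subset finite_subset by (metis subset_trans)
qed

text \<open>The part below both flags would be counted twice by the jumps along both, so the second flag only
  contributes the jumps that do not belong to \<open>k n\<close>.\<close>

definition label :: "nat \<Rightarrow> (nat \<Rightarrow> 'a) \<Rightarrow> nat \<Rightarrow> (nat \<Rightarrow> 'a) \<Rightarrow> 'a \<Rightarrow> (nat + nat) set" where
  "label n k n' k' p = Inl ` jumps n k p \<union> Inr ` (jumps n' k' p - jumps n' k' (k n))"

lemma finite_label: "finite (label n k n' k' p)"
  unfolding label_def by simp

lemma label_mono:
  assumes "flag n k" "flag n' k'" "p \<in> L" "q \<in> L" "p \<le> q"
  shows "label n k n' k' p \<subseteq> label n k n' k' q"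
  using jumps_mono[OF assms(1,3-)] jumps_mono[OF assms(2,3-)] unfolding label_def by blast

lemma card_Inl_Inr: "finite A \<Longrightarrow> finite B \<Longrightarrow> card (Inl ` A \<union> Inr ` B) = card A + card B"
  by (subst card_Un_disjoint) (auto simp: card_image)

text \<open>The label counts the rank of the join of the two parts of \<open>p\<close> below the flags, which may be
  smaller than \<open>p\<close>.\<close>

lemma card_label_le:
  assumes k: "flag n k" and k': "flag n' k'" and p: "p \<in> L"
  shows "card (label n k n' k' p) \<le> rk p"
proof -
  define c where "c = k n"
  define c' where "c' = k' n'"
  have L: "c \<in> L" "c' \<in> L" using flag_in[OF k, of n] flag_in[OF k', of n'] unfolding c_def c'_def by auto
  have J': "card (jumps n' k' p \<inter> jumps n' k' c) \<ge> rk ((p \<sqinter> c) \<sqinter> c')"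
  proof -
    have "jumps n' k' (p \<sqinter> c) \<subseteq> jumps n' k' p \<inter> jumps n' k' c" by (rule jumps_meet_sub[OF k' p L(1)])
    then have "card (jumps n' k' (p \<sqinter> c)) \<le> card (jumps n' k' p \<inter> jumps n' k' c)" by (intro card_mono) auto
    then show ?thesis using card_jumps[OF k', of "p \<sqinter> c"] p L unfolding c'_def by simp
  qed
  have "card (jumps n' k' p - jumps n' k' c) = card (jumps n' k' p) - card (jumps n' k' p \<inter> jumps n' k' c)"
    by (rule card_Diff_subset_Int) simp
  moreover have "card (jumps n' k' p \<inter> jumps n' k' c) \<le> card (jumps n' k' p)" by (intro card_mono) auto
  moreover have "card (jumps n' k' p) = rk (p \<sqinter> c')" "card (jumps n k p) = rk (p \<sqinter> c)"
    using card_jumps[OF k' p] card_jumps[OF k p] unfolding c_def c'_def by auto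
  moreover have "card (label n k n' k' p) = card (jumps n k p) + card (jumps n' k' p - jumps n' k' c)"
    unfolding label_def c_def by (rule card_Inl_Inr) auto
  ultimately have 1: "card (label n k n' k' p) + rk (p \<sqinter> c \<sqinter> c') \<le> rk (p \<sqinter> c) + rk (p \<sqinter> c')"
    using J' by linarith
  have M: "p \<sqinter> c \<in> L" "p \<sqinter> c' \<in> L" "p \<sqinter> c \<le> p" "p \<sqinter> c' \<le> p" using p L by auto
  have comp: "compat (p \<sqinter> c) (p \<sqinter> c')" using compatI[OF p M(3,4)] .
  have "(p \<sqinter> c) \<sqinter> (p \<sqinter> c') \<le> p \<sqinter> c \<sqinter> c'"
    using M p L order_trans[OF meet_le2[OF M(1,2)] meet_le2[OF p L(2)]] meet_le1[OF M(1,2)]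
    by (intro meet_greatest[of "p \<sqinter> c" c']) auto
  then have "rk ((p \<sqinter> c) \<sqinter> (p \<sqinter> c')) \<le> rk (p \<sqinter> c \<sqinter> c')" using M p L by (intro rk_mono) auto
  moreover have "rk ((p \<sqinter> c) \<squnion> (p \<sqinter> c')) \<le> rk p"
    using join_least[OF M(1,2) p M(3,4)] join_in[OF M(1,2) comp] p by (intro rk_mono)
  ultimately show ?thesis using 1 rk_join_meet[OF M(1,2) comp] by linarith
qed

text \<open>Let \<open>d\<close>, \<open>a\<close> and \<open>b\<close> be the joins of the three families. The ranks of each are counted by jumps, as
  each is generated by two chains. Modularity bounds the rank of the total join by those of \<open>d \<squnion> a\<close> and
  \<open>d \<squnion> b\<close>, whose meet contains \<open>d\<close>. It remains to see that \<open>d \<sqinter> a\<close> and \<open>d \<sqinter> b\<close> are large enough: for the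
  greatest index \<open>i\<close> in \<open>Ga\<close>, both \<open>d\<close> and \<open>a\<close> lie above \<open>e \<sqinter> k i\<close>, which accounts for all jumps that \<open>a\<close>
  has in common with \<open>e\<close>.\<close>

lemma rk_lub_three_le:
  assumes k: "flag n k" and k': "flag n' k'"
    and Gd: "finite Gd" "Gd \<subseteq> {..n} \<times> k' ` {..n'}"
    and Ga: "finite Ga" "Ga \<subseteq> {..n} \<times> DP" "DP \<subseteq> L" "Complete_Partial_Order.chain (\<le>) DP" "\<And>P. P \<in> DP \<Longrightarrow> k n \<sqinter> k' n' \<le> P"
    and Gb: "finite Gb" "Gb \<subseteq> {..n'} \<times> DQ" "DQ \<subseteq> L" "Complete_Partial_Order.chain (\<le>) DQ" "\<And>Q. Q \<in> DQ \<Longrightarrow> k n \<sqinter> k' n' \<le> Q"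
    and da: "\<And>i P. (i, P) \<in> Ga \<Longrightarrow> (i, k' n') \<in> Gd"
    and db: "\<And>j Q. (j, Q) \<in> Gb \<Longrightarrow> (n, k' j) \<in> Gd"
    and S: "S = (\<lambda>(i, q). k i \<sqinter> q) ` Gd \<union> (\<lambda>(i, P). k i \<sqinter> P) ` Ga \<union> (\<lambda>(j, Q). k' j \<sqinter> Q) ` Gb"
    and u: "u \<in> L" "\<And>x. x \<in> S \<Longrightarrow> x \<le> u"
  shows "S \<subseteq> L" "finite S" "rk (lub S) \<le> card (Inl ` ((\<Union>(i, q)\<in>Gd. {1..i} \<inter> jumps n k q) \<union> (\<Union>(i, P)\<in>Ga. {1..i} \<inter> jumps n k P)) \<union>
      Inr ` ((\<Union>(j, Q)\<in>Gb. {1..j} \<inter> jumps n' k' Q) - jumps n' k' (k n)) :: (nat + nat) set)"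
proof -
  define e where "e = k n \<sqinter> k' n'"
  have top: "k n \<in> L" "k' n' \<in> L" using flag_in[OF k, of n] flag_in[OF k', of n'] by auto
  then have eL: "e \<in> L" "e \<le> k n" "e \<le> k' n'" unfolding e_def by auto
  define Sd where "Sd = (\<lambda>(i, q). k i \<sqinter> q) ` Gd"
  define Sa where "Sa = (\<lambda>(i, P). k i \<sqinter> P) ` Ga"
  define Sb where "Sb = (\<lambda>(j, Q). k' j \<sqinter> Q) ` Gb"
  have kL: "k i \<in> L" if "i \<le> n" for i using flag_in[OF k that] .
  have kL': "k' j \<in> L" if "j \<le> n'" for j using flag_in[OF k' that] .
  have DL: "k' ` {..n'} \<subseteq> L" using kL' by auto
  have Dch: "Complete_Partial_Order.chain (\<le>) (k' ` {..n'})"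
    unfolding Complete_Partial_Order.chain_def
  proof (intro ballI)
    fix p q assume "p \<in> k' ` {..n'}" "q \<in> k' ` {..n'}"
    then obtain i j where "p = k' i" "i \<le> n'" "q = k' j" "j \<le> n'" by blast
    then show "p \<le> q \<or> q \<le> p" using flag_mono[OF k', of i j] flag_mono[OF k', of j i] by (cases "i \<le> j") auto
  qed
  have Sin: "Sd \<subseteq> L" "Sa \<subseteq> L" "Sb \<subseteq> L"
    using Gd(2) Ga(2,3) Gb(2,3) kL kL' unfolding Sd_def Sa_def Sb_def by (auto dest!: subsetD)
  have fin: "finite Sd" "finite Sa" "finite Sb" using Gd Ga Gb unfolding Sd_def Sa_def Sb_def by auto
  have SS: "S = Sd \<union> Sa \<union> Sb" unfolding S Sd_def Sa_def Sb_def ..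
  show "S \<subseteq> L" "finite S" using Sin fin unfolding SS by auto
  define d where "d = lub Sd"
  define a where "a = lub Sa"
  define b where "b = lub Sb"
  have up: "x \<in> Sd \<Longrightarrow> x \<le> u" "x \<in> Sa \<Longrightarrow> x \<le> u" "x \<in> Sb \<Longrightarrow> x \<le> u" for x using u(2) unfolding SS by auto
  have d: "d \<in> L" "d \<le> u" "\<And>x. x \<in> Sd \<Longrightarrow> x \<le> d"
    using lub_in[OF fin(1) Sin(1) u(1) up(1)] lub_least[OF fin(1) Sin(1) u(1) up(1)] lub_upper[OF fin(1) Sin(1) u(1) up(1)] unfolding d_def by auto
  have a: "a \<in> L" "a \<le> u" "\<And>x. x \<in> Sa \<Longrightarrow> x \<le> a"
    using lub_in[OF fin(2) Sin(2) u(1) up(2)] lub_least[OF fin(2) Sin(2) u(1) up(2)] lub_upper[OF fin(2) Sin(2) u(1) up(2)] unfolding a_def by auto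
  have b: "b \<in> L" "b \<le> u" "\<And>x. x \<in> Sb \<Longrightarrow> x \<le> b"
    using lub_in[OF fin(3) Sin(3) u(1) up(3)] lub_least[OF fin(3) Sin(3) u(1) up(3)] lub_upper[OF fin(3) Sin(3) u(1) up(3)] unfolding b_def by auto
  have dtop: "d \<le> k n"
    unfolding d_def
  proof (rule lub_least[OF fin(1) Sin(1) top(1)])
    fix x assume "x \<in> Sd"
    then obtain i q where iq: "(i, q) \<in> Gd" "x = k i \<sqinter> q" unfolding Sd_def by auto
    then have "(i, q) \<in> {..n} \<times> L" using Gd(2) DL by blast
    then have "i \<le> n" "q \<in> L" "x = k i \<sqinter> q" using iq(2) by auto
    then show "x \<le> k n" using order_trans[OF meet_le1 flag_mono[OF k, of i n]] kL by simp
  qed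
  have atop: "a \<le> k n"
    unfolding a_def
  proof (rule lub_least[OF fin(2) Sin(2) top(1)])
    fix x assume "x \<in> Sa"
    then obtain i q where iq: "(i, q) \<in> Ga" "x = k i \<sqinter> q" unfolding Sa_def by auto
    then have "(i, q) \<in> {..n} \<times> L" using Ga(2,3) by blast
    then have "i \<le> n" "q \<in> L" "x = k i \<sqinter> q" using iq(2) by auto
    then show "x \<le> k n" using order_trans[OF meet_le1 flag_mono[OF k, of i n]] kL by simp
  qed
  have btop: "b \<le> k' n'"
    unfolding b_def
  proof (rule lub_least[OF fin(3) Sin(3) top(2)])
    fix x assume "x \<in> Sb"
    then obtain i q where iq: "(i, q) \<in> Gb" "x = k' i \<sqinter> q" unfolding Sb_def by auto
    then have "(i, q) \<in> {..n'} \<times> L" using Gb(2,3) by blast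
    then have "i \<le> n'" "q \<in> L" "x = k' i \<sqinter> q" using iq(2) by auto
    then show "x \<le> k' n'" using order_trans[OF meet_le1 flag_mono[OF k', of i n']] kL' by simp
  qed
  define Dd where "Dd = (\<Union>(i, q)\<in>Gd. {1..i} \<inter> jumps n k q)"
  define Da where "Da = (\<Union>(i, P)\<in>Ga. {1..i} \<inter> jumps n k P)"
  define Db where "Db = (\<Union>(j, Q)\<in>Gb. {1..j} \<inter> jumps n' k' Q)"
  have J: "jumps n k d = Dd" "jumps n k a = Da" "jumps n' k' b = Db"
    unfolding d_def a_def b_def Sd_def Sa_def Sb_def Dd_def Da_def Db_def
    using jumps_lub_two_chains[OF k Gd DL Dch] jumps_lub_two_chains[OF k Ga(1-4)] jumps_lub_two_chains[OF k' Gb(1-4)] by auto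
  have rk: "rk d = card Dd" "rk a = card Da" "rk b = card Db"
    using card_jumps_below[OF k d(1) dtop] card_jumps_below[OF k a(1) atop] card_jumps_below[OF k' b(1) btop] J by auto
  have finD: "finite Dd" "finite Da" "finite Db" using J by (metis finite_jumps)+
  have Je: "jumps n k e = jumps n k (k' n')" "jumps n' k' e = jumps n' k' (k n)"
    unfolding e_def using jumps_meet_top[OF k top(2)] jumps_meet_top[OF k' top(1)] by (simp_all add: meet_commute)
  have sub: "Dd \<subseteq> jumps n k e"
  proof -
    have "jumps n k q \<subseteq> jumps n k e" if "q \<in> k' ` {..n'}" for q
      unfolding Je using that DL top flag_mono[OF k'] by (intro jumps_mono[OF k]) auto
    then show ?thesis unfolding Dd_def using Gd(2) by blast
  qed
  have da': "card (Da \<inter> jumps n k e) \<le> rk (d \<sqinter> a)"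
  proof (cases "Ga = {}")
    case False
    define i where "i = Max (fst ` Ga)"
    have "i \<in> fst ` Ga" unfolding i_def using False Ga(1) by (intro Max_in) auto
    then obtain P where iP: "(i, P) \<in> Ga" by auto
    have i: "i \<le> n" "P \<in> L" "e \<le> P" using iP Ga(2,3,5) unfolding e_def by auto
    have "Da \<inter> jumps n k e \<subseteq> {1..i} \<inter> jumps n k e"
    proof -
      have "i' \<le> i" if "(i', P') \<in> Ga" for i' P' unfolding i_def using that Ga(1) by (intro Max_ge) force+
      then show ?thesis unfolding Da_def by force
    qed
    also have "\<dots> = jumps n k (e \<sqinter> k i)" using jumps_meet_flag[OF k eL(1) i(1)] by blast
    finally have "card (Da \<inter> jumps n k e) \<le> card (jumps n k (e \<sqinter> k i))" by (intro card_mono) auto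
    also have "\<dots> = rk (e \<sqinter> k i)"
      using eL kL[OF i(1)] order_trans[OF meet_le1[OF eL(1) kL[OF i(1)]] eL(2)] by (intro card_jumps_below[OF k]) auto
    also have "\<dots> \<le> rk (d \<sqinter> a)"
    proof (intro rk_mono meet_greatest)
      have "k i \<sqinter> k' n' \<in> Sd" unfolding Sd_def using da[OF iP] by force
      moreover have "e \<sqinter> k i \<le> k i \<sqinter> k' n'"
        using eL kL[OF i(1)] top order_trans[OF meet_le1[OF eL(1) kL[OF i(1)]] eL(3)] by (intro meet_greatest) auto
      ultimately show "e \<sqinter> k i \<le> d" using d(3) by (meson order_trans)
      have "k i \<sqinter> P \<in> Sa" unfolding Sa_def using iP by force
      moreover have "e \<sqinter> k i \<le> k i \<sqinter> P"
        using eL kL[OF i(1)] i order_trans[OF meet_le1[OF eL(1) kL[OF i(1)]] i(3)] by (intro meet_greatest) auto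
      ultimately show "e \<sqinter> k i \<le> a" using a(3) by (meson order_trans)
    qed (use eL kL i d a in auto)
    finally show ?thesis .
  qed (simp add: Da_def)
  have db': "card (Db \<inter> jumps n' k' e) \<le> rk (d \<sqinter> b)"
  proof (cases "Gb = {}")
    case False
    define j where "j = Max (fst ` Gb)"
    have "j \<in> fst ` Gb" unfolding j_def using False Gb(1) by (intro Max_in) auto
    then obtain Q where jQ: "(j, Q) \<in> Gb" by auto
    have j: "j \<le> n'" "Q \<in> L" "e \<le> Q" using jQ Gb(2,3,5) unfolding e_def by auto
    have "Db \<inter> jumps n' k' e \<subseteq> {1..j} \<inter> jumps n' k' e"
    proof -
      have "j' \<le> j" if "(j', Q') \<in> Gb" for j' Q' unfolding j_def using that Gb(1) by (intro Max_ge) force+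
      then show ?thesis unfolding Db_def by force
    qed
    also have "\<dots> = jumps n' k' (e \<sqinter> k' j)" using jumps_meet_flag[OF k' eL(1) j(1)] by blast
    finally have "card (Db \<inter> jumps n' k' e) \<le> card (jumps n' k' (e \<sqinter> k' j))" by (intro card_mono) auto
    also have "\<dots> = rk (e \<sqinter> k' j)"
      using eL kL'[OF j(1)] order_trans[OF meet_le1[OF eL(1) kL'[OF j(1)]] eL(3)] by (intro card_jumps_below[OF k']) auto
    also have "\<dots> \<le> rk (d \<sqinter> b)"
    proof (intro rk_mono meet_greatest)
      have "k n \<sqinter> k' j \<in> Sd" unfolding Sd_def using db[OF jQ] by force
      moreover have "e \<sqinter> k' j \<le> k n \<sqinter> k' j"
        using eL kL'[OF j(1)] top order_trans[OF meet_le1[OF eL(1) kL'[OF j(1)]] eL(2)] by (intro meet_greatest) auto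
      ultimately show "e \<sqinter> k' j \<le> d" using d(3) by (meson order_trans)
      have "k' j \<sqinter> Q \<in> Sb" unfolding Sb_def using jQ by force
      moreover have "e \<sqinter> k' j \<le> k' j \<sqinter> Q"
        using eL kL'[OF j(1)] j order_trans[OF meet_le1[OF eL(1) kL'[OF j(1)]] j(3)] by (intro meet_greatest) auto
      ultimately show "e \<sqinter> k' j \<le> b" using b(3) by (meson order_trans)
    qed (use eL kL' j d b in auto)
    finally show ?thesis .
  qed (simp add: Db_def)
  have cda: "compat d a" and cdb: "compat d b" using compatI[OF u(1)] d a b by auto
  define x where "x = d \<squnion> a"
  define y where "y = d \<squnion> b"
  have x: "x \<in> L" "d \<le> x" "a \<le> x" "x \<le> u" unfolding x_def using join_in join_ge1 join_ge2 join_least d a cda u by auto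
  have y: "y \<in> L" "d \<le> y" "b \<le> y" "y \<le> u" unfolding y_def using join_in join_ge1 join_ge2 join_least d b cdb u by auto
  have cxy: "compat x y" using compatI[OF u(1) x(4) y(4)] .
  have "lub S \<le> x \<squnion> y"
  proof (rule lub_least[OF \<open>finite S\<close> \<open>S \<subseteq> L\<close> join_in[OF x(1) y(1) cxy]])
    fix s assume "s \<in> S"
    then have "s \<le> x \<or> s \<le> y" using d(3) a(3) b(3) x y unfolding SS by (meson UnE order_trans)
    then show "s \<le> x \<squnion> y" using join_ge1[OF x(1) y(1) cxy] join_ge2[OF x(1) y(1) cxy] by (meson order_trans)
  qed
  then have "rk (lub S) \<le> rk (x \<squnion> y)"
    using lub_in[OF \<open>finite S\<close> \<open>S \<subseteq> L\<close> u] join_in[OF x(1) y(1) cxy] by (intro rk_mono)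
  moreover have "rk d \<le> rk (x \<sqinter> y)" using x y d by (intro rk_mono meet_greatest) auto
  moreover have "rk x + rk (d \<sqinter> a) = rk d + rk a" unfolding x_def using rk_join_meet[OF d(1) a(1) cda] by simp
  moreover have "rk y + rk (d \<sqinter> b) = rk d + rk b" unfolding y_def using rk_join_meet[OF d(1) b(1) cdb] by simp
  moreover have "card Da = card (Da \<inter> jumps n k e) + card (Da - jumps n k e)"
    "card Db = card (Db \<inter> jumps n' k' e) + card (Db - jumps n' k' e)"
    using card_Int_Diff[OF finD(2)] card_Int_Diff[OF finD(3)] by auto
  ultimately have "rk (lub S) \<le> card Dd + card (Da - jumps n k e) + card (Db - jumps n' k' e)"
    using rk_join_meet[OF x(1) y(1) cxy] da' db' rk by linarith
  also have "card Dd + card (Da - jumps n k e) = card (Dd \<union> (Da - jumps n k e))"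
    using finD sub by (intro card_Un_disjoint[symmetric]) auto
  also have "\<dots> \<le> card (Dd \<union> Da)" using finD by (intro card_mono) auto
  finally have "rk (lub S) \<le> card (Dd \<union> Da) + card (Db - jumps n' k' e)" by simp
  also have "\<dots> = card (Inl ` (Dd \<union> Da) \<union> Inr ` (Db - jumps n' k' e) :: (nat + nat) set)"
    using finD by (intro card_Inl_Inr[symmetric]) auto
  finally show "rk (lub S) \<le> card (Inl ` ((\<Union>(i, q)\<in>Gd. {1..i} \<inter> jumps n k q) \<union> (\<Union>(i, P)\<in>Ga. {1..i} \<inter> jumps n k P)) \<union>
      Inr ` ((\<Union>(j, Q)\<in>Gb. {1..j} \<inter> jumps n' k' Q) - jumps n' k' (k n)) :: (nat + nat) set)"
    unfolding Dd_def Da_def Db_def Je .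
qed

end

section \<open>Geodesics from the base point\<close>

context modular_semilattice_finite_rank
begin

inductive polygonal :: "('a \<Rightarrow> real) \<Rightarrow> ('a \<Rightarrow> real) \<Rightarrow> real \<Rightarrow> bool" where
  stay: "x \<in> K \<Longrightarrow> polygonal x x 0"
| extend: "polygonal x y l \<Longrightarrow> adjacent y z \<Longrightarrow> polygonal x z (l + sdist y z)"

lemma polygonal_trans: "polygonal y z l' \<Longrightarrow> polygonal x y l \<Longrightarrow> polygonal x z (l + l')"
proof (induction rule: polygonal.induct)
  case (extend y w l' z)
  then show ?case using polygonal.extend[of x w "l + l'" z] by (simp add: add.assoc)
qed simp

lemma polygonal_adjacent: "adjacent x y \<Longrightarrow> polygonal x y (sdist x y)"
  using polygonal.extend[OF polygonal.stay] unfolding adjacent_def by force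

lemma level_antimono: "x \<in> K \<Longrightarrow> i \<le> j \<Longrightarrow> level x j \<le> level x i"
  by (rule mass_mono) auto

lemma level_le_1: "x \<in> K \<Longrightarrow> level x i \<le> 1"
  using level_antimono[of x 0 i] mass_True[of x] by simp

lemma mass_jumps_flagged:
  assumes x: "flagged x n k" and i: "i \<in> {1..n}"
  shows "mass x (\<lambda>p. i \<in> jumps n k p) = level x i"
proof (rule mass_cong)
  fix p assume "p \<in> supp x"
  then obtain a where a: "a \<le> n" "p = k a" using x unfolding flagged_def by blast
  then have "jumps n k p = {1..a}" "rk p = a" using x jumps_flag flag_rk unfolding flagged_def by blast+
  then show "(i \<in> jumps n k p) = (i \<le> rk p)" using i by simp
qed

end

context base_point
begin

text \<open>For a point \<open>x\<close> below \<open>c\<close> nothing has to be exchanged: its part below \<open>c\<close> is all of \<open>x\<close>, and \<open>c\<close> and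
  bottom are both optimal at the parameter \<open>0\<close>.\<close>

lemma dev_on_flag:
  assumes x: "flagged x n k"
  shows "dev x 0 = 0" "i \<in> {1..n} \<Longrightarrow> dev x i = level x i"
proof -
  have xK: "x \<in> K" using x unfolding flagged_def by simp
  have "compat c c" using compatI[OF cL] by simp
  then have "outer x = 0" using outer_eq[OF x cL] by simp
  then show "dev x 0 = 0" unfolding dev_def by simp
  assume i: "i \<in> {1..n}"
  have le: "energy x b \<le> energy x c" if "b \<in> L" for b
    using energy_mono[OF xK _ cL, of "b \<sqinter> c"] energy_meet_top[OF xK that cL] flagged_le[OF x] that cL by simp
  have "optimal x 0 c c" "optimal x 0 bottom c"
    unfolding optimal_def feasible_def using \<open>compat c c\<close> le cL compat_mono[of c c bottom c] by auto
  moreover have "i \<in> J c" "i \<notin> J bottom"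
    using i jumps_flag[OF flag_k, of n] jumps_flag[OF flag_k, of 0] flag_0[OF flag_k] by auto
  ultimately have "slope x i = 0" using slope_eq[OF x] by blast
  then show "dev x i = level x i" unfolding dev_def using i mass_jumps_flagged[OF x i] by simp
qed

end

text \<open>The base point and a second point \<open>z\<close> with a support, which determine the geodesic from \<open>m\<close> to \<open>z\<close>.\<close>

locale support_path = base_point L r m n k for L :: "'a::order set" and r m n k +
  fixes z :: "'a \<Rightarrow> real" and n' :: nat and k' :: "nat \<Rightarrow> 'a" and q0 :: 'a and \<Lambda> :: "real set"
    and P p Q q :: "real \<Rightarrow> 'a"
  assumes z_flagged: "flagged z n' k'"
    and q0: "q0 \<in> L" "q0 \<le> k' n'" "compat (k n) q0"
    and q0_greatest: "\<And>q'. q' \<in> L \<Longrightarrow> q' \<le> k' n' \<Longrightarrow> compat (k n) q' \<Longrightarrow> q' \<le> q0"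
    and support: "is_support z n' k' q0 \<Lambda> P p Q q"
begin

abbreviation c' :: 'a where "c' \<equiv> k' n'"
abbreviation J' :: "'a \<Rightarrow> nat set" where "J' \<equiv> jumps n' k'"
abbreviation e :: 'a where "e \<equiv> c \<sqinter> c'"

lemmas S = supportD[OF support]

lemma zK: "z \<in> K" and flag_k': "flag n' k'" and c'L: "c' \<in> L"
  using z_flagged flag_in unfolding flagged_def by auto

lemma eL: "e \<in> L" "e \<le> c" "e \<le> c'"
  using cL c'L by auto

lemma J_e: "J e = J c'" and J'_e: "J' e = J' c"
  using jumps_meet_top[OF flag_k c'L] jumps_meet_top[OF flag_k' cL] by (simp_all add: meet_commute)

lemma support_in:
  assumes "t \<in> \<Lambda>"
  shows "P t \<in> L" "q t \<in> L" "p t \<in> L" "Q t \<in> L" "P t \<le> c" "p t \<le> c" "compat (P t) (q t)" "compat (p t) (Q t)"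
  using S(3,4)[OF assms] unfolding optimal_def feasible_def by auto

lemma e_le_q0: "e \<le> q0"
  using q0_greatest[OF eL(1,3)] compatI[OF cL order_refl eL(2)] .

text \<open>The optimal elements, each with a slope. The block of \<open>m\<close> that enters with \<open>P t\<close> is scaled by
  \<open>(1 - s) - s * sqrt t\<close> at the time \<open>s\<close>, the block of \<open>z\<close> in \<open>Q t\<close> but not in \<open>q t\<close> by \<open>s - (1 - s) / sqrt t\<close>. Both
  factors vanish at the breaking time \<open>1 / (1 + sqrt t)\<close>. The element \<open>q0\<close> has slope \<open>0\<close>, as the part of
  \<open>z\<close> that is compatible with \<open>c\<close> grows from the start.\<close>

definition left_chain :: "('a \<times> real) set" where
  "left_chain = (\<lambda>t. (P t, sqrt t)) ` \<Lambda>"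

definition right_chain :: "('a \<times> real) set" where
  "right_chain = insert (q0, 0) ((\<lambda>t. (Q t, 1 / sqrt t)) ` {t \<in> \<Lambda>. 0 < t})"

lemma finite_chains: "finite left_chain" "finite right_chain"
  unfolding left_chain_def right_chain_def using S(1) by auto

lemma left_chain:
  assumes "(A, \<tau>) \<in> left_chain"
  shows "A \<in> L" "A \<le> c" "e \<le> A" "0 \<le> \<tau>"
  using assms support_in S(2) S(16) unfolding left_chain_def by auto

lemma right_chain:
  assumes "(B, \<eta>) \<in> right_chain"
  shows "B \<in> L" "B \<le> c'" "e \<le> B" "0 \<le> \<eta>"
proof -
  have "e \<le> Q t" if "t \<in> \<Lambda>" for t
    using e_le_q0 S(13)[OF that] S(7)[OF that] by order
  then show "B \<in> L" "B \<le> c'" "e \<le> B" "0 \<le> \<eta>"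
    using assms support_in S(2) S(8) q0 e_le_q0 unfolding right_chain_def by auto
qed

lemma left_chain_mono:
  assumes "(A, \<tau>) \<in> left_chain" "(A', \<tau>') \<in> left_chain" "\<tau> \<le> \<tau>'"
  shows "A \<le> A'"
proof -
  obtain t t' where t: "t \<in> \<Lambda>" "A = P t" "\<tau> = sqrt t" "t' \<in> \<Lambda>" "A' = P t'" "\<tau>' = sqrt t'"
    using assms(1,2) unfolding left_chain_def by auto
  then have "t \<le> t'" using assms(3) by simp
  then show ?thesis using S(9)[OF t(1,4)] S(5)[OF t(4)] t by (cases "t = t'") auto
qed

lemma right_chain_mono:
  assumes "(B, \<eta>) \<in> right_chain" "(B', \<eta>') \<in> right_chain" "\<eta> \<le> \<eta>'"
  shows "B \<le> B'"
proof -
  have q0Q: "q0 \<le> Q t" if "t \<in> \<Lambda>" for t using S(13)[OF that] S(7)[OF that] by order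
  consider "B = q0" "\<eta> = 0" | t where "t \<in> \<Lambda>" "0 < t" "B = Q t" "\<eta> = 1 / sqrt t"
    using assms(1) unfolding right_chain_def by auto
  then show ?thesis
  proof cases
    case 1
    then show ?thesis using assms(2) q0Q unfolding right_chain_def by auto
  next
    case (2 t)
    then have "0 < \<eta>'" using assms(3) by (smt (verit) divide_pos_pos real_sqrt_gt_zero)
    then obtain t' where t': "t' \<in> \<Lambda>" "0 < t'" "B' = Q t'" "\<eta>' = 1 / sqrt t'"
      using assms(2) unfolding right_chain_def by auto
    have "t' \<le> t" using assms(3) 2 t' by (simp add: frac_le field_simps)
    then show ?thesis using S(10)[OF t'(1) 2(1)] S(7)[OF t'(1)] 2 t' by (cases "t = t'") auto
  qed
qed

text \<open>An element of the left chain still present at some time and one of the right chain already present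
  at that time have slopes with product less than \<open>1\<close>. Their parameters then satisfy \<open>t < t'\<close>, so that
  \<open>P t\<close> lies below \<open>p t'\<close>, the partner of \<open>Q t'\<close>.\<close>

lemma chains_compat:
  assumes "(A, \<tau>) \<in> left_chain" "(B, \<eta>) \<in> right_chain" "\<tau> * \<eta> < 1"
  shows "compat A B"
proof -
  obtain t where t: "t \<in> \<Lambda>" "A = P t" "\<tau> = sqrt t" using assms(1) unfolding left_chain_def by auto
  consider "B = q0" "\<eta> = 0" | t' where "t' \<in> \<Lambda>" "0 < t'" "B = Q t'" "\<eta> = 1 / sqrt t'"
    using assms(2) unfolding right_chain_def by auto
  then show ?thesis
  proof cases
    case 1
    then show ?thesis using q0(3) support_in(5)[OF t(1)] t by (auto intro: compat_mono)
  next
    case (2 t')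
    then have "t < t'" using assms(3) t by (simp add: divide_less_eq)
    then show ?thesis using S(9)[OF t(1) 2(1)] support_in(8)[OF 2(1)] t 2 by (auto intro: compat_mono)
  qed
qed

text \<open>A generator is an element with its coefficients at the times \<open>0\<close> and \<open>1\<close>, between which the
  coefficient is affine. The middle generators interpolate between the levels of the two points; the left
  ones can be positive only before their breaking times, the right ones only after them. The point of the
  geodesic at the time \<open>s\<close> is the step function that assigns to \<open>\<theta>\<close> the join of the generators whose
  coefficients are at least \<open>\<theta>\<close>.\<close>

definition gen_mid :: "('a \<times> real \<times> real) set" where
  "gen_mid = (\<lambda>(i, j). (k i \<sqinter> k' j, level m i, level z j)) ` ({..n} \<times> {..n'})"

definition gen_left :: "('a \<times> real \<times> real) set" where
  "gen_left = (\<lambda>(i, x). (k i \<sqinter> fst x, level m i, - snd x * level m i)) ` ({..n} \<times> left_chain)"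

definition gen_right :: "('a \<times> real \<times> real) set" where
  "gen_right = (\<lambda>(j, x). (k' j \<sqinter> fst x, - snd x * level z j, level z j)) ` ({..n'} \<times> right_chain)"

definition gen :: "('a \<times> real \<times> real) set" where
  "gen = gen_mid \<union> gen_left \<union> gen_right"

definition coeff :: "real \<Rightarrow> 'a \<times> real \<times> real \<Rightarrow> real" where
  "coeff s x = (1 - s) * fst (snd x) + s * snd (snd x)"

definition upper :: "real \<Rightarrow> real \<Rightarrow> ('a \<times> real \<times> real) set" where
  "upper s \<theta> = {x \<in> gen. \<theta> \<le> coeff s x}"

definition elt :: "real \<Rightarrow> real \<Rightarrow> 'a" where
  "elt s \<theta> = lub (fst ` upper s \<theta>)"

abbreviation lab :: "'a \<Rightarrow> (nat + nat) set" where
  "lab \<equiv> label n k n' k'"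

lemma finite_gen: "finite gen"
  unfolding gen_def gen_mid_def gen_left_def gen_right_def using finite_chains by auto

lemma gen_in: "x \<in> gen \<Longrightarrow> fst x \<in> L"
  unfolding gen_def gen_mid_def gen_left_def gen_right_def
  using left_chain right_chain flag_in[OF flag_k] flag_in[OF flag_k'] by auto

lemma level_m_nonneg: "0 \<le> level m i" and level_z_nonneg: "0 \<le> level z i"
  using mass_nonneg mK zK by auto

text \<open>The left generators with positive coefficients have slopes less than \<open>(1 - s) / s\<close>, the right ones
  have slopes less than \<open>s / (1 - s)\<close>. If both kinds occur, their greatest elements are compatible, and the
  join of these is the bound.\<close>

lemma upper_bounded:
  assumes s: "0 \<le> s" "s \<le> 1" and \<theta>: "0 < \<theta>"
  obtains u where "u \<in> L" "\<And>x. x \<in> upper s \<theta> \<Longrightarrow> fst x \<le> u"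
proof -
  define UA where "UA = {(A, \<tau>) \<in> left_chain. s * \<tau> < 1 - s}"
  define UB where "UB = {(B, \<eta>) \<in> right_chain. (1 - s) * \<eta> < s}"
  have kL: "i \<le> n \<Longrightarrow> k i \<in> L" "j \<le> n' \<Longrightarrow> k' j \<in> L" for i j
    using flag_in[OF flag_k] flag_in[OF flag_k'] by auto
  have mid: "fst x \<le> e" if x: "x \<in> upper s \<theta>" "x \<in> gen_mid" for x
  proof -
    obtain i j where "i \<le> n" "j \<le> n'" "fst x = k i \<sqinter> k' j" using x(2) unfolding gen_mid_def by auto
    then show ?thesis using kL cL c'L flag_mono[OF flag_k, of i n] flag_mono[OF flag_k', of j n'] by (auto intro: meet_mono)
  qed
  have left: "\<exists>A \<tau>. (A, \<tau>) \<in> UA \<and> fst x \<le> A" if x: "x \<in> upper s \<theta>" "x \<in> gen_left" for x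
  proof -
    obtain i A \<tau> where i: "i \<le> n" "(A, \<tau>) \<in> left_chain" "x = (k i \<sqinter> A, level m i, - \<tau> * level m i)"
      using x(2) unfolding gen_left_def by auto
    have "0 < ((1 - s) - s * \<tau>) * level m i"
      using x(1) \<theta> i unfolding upper_def coeff_def by (simp add: algebra_simps)
    then have "s * \<tau> < 1 - s" using level_m_nonneg[of i] by (simp add: zero_less_mult_iff)
    then have "(A, \<tau>) \<in> UA" using i(2) unfolding UA_def by simp
    moreover have "fst x \<le> A" using i kL(1)[OF i(1)] left_chain(1)[OF i(2)] by simp
    ultimately show ?thesis by blast
  qed
  have right: "\<exists>B \<eta>. (B, \<eta>) \<in> UB \<and> fst x \<le> B" if x: "x \<in> upper s \<theta>" "x \<in> gen_right" for x
  proof -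
    obtain i B \<eta> where i: "i \<le> n'" "(B, \<eta>) \<in> right_chain" "x = (k' i \<sqinter> B, - \<eta> * level z i, level z i)"
      using x(2) unfolding gen_right_def by auto
    have "0 < (s - (1 - s) * \<eta>) * level z i"
      using x(1) \<theta> i unfolding upper_def coeff_def by (simp add: algebra_simps)
    then have "(1 - s) * \<eta> < s" using level_z_nonneg[of i] by (simp add: zero_less_mult_iff)
    then have "(B, \<eta>) \<in> UB" using i(2) unfolding UB_def by simp
    moreover have "fst x \<le> B" using i kL(2)[OF i(1)] right_chain(1)[OF i(2)] by simp
    ultimately show ?thesis by blast
  qed
  have cases: "x \<in> gen_mid \<or> x \<in> gen_left \<or> x \<in> gen_right" if "x \<in> upper s \<theta>" for x
    using that unfolding upper_def gen_def by blast
  have UA_c: "A \<le> c" if "(A, \<tau>) \<in> UA" for A \<tau> using that left_chain(2) unfolding UA_def by blast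
  have UB_c: "B \<le> c'" if "(B, \<eta>) \<in> UB" for B \<eta> using that right_chain(2) unfolding UB_def by blast
  show ?thesis
  proof (cases "UA = {} \<or> UB = {}")
    case True
    then show ?thesis
    proof
      assume empty: "UA = {}"
      show ?thesis
      proof (rule that[OF c'L])
        fix x assume x: "x \<in> upper s \<theta>"
        show "fst x \<le> c'"
        proof (cases "x \<in> gen_mid")
          case True then show ?thesis using mid[OF x True] eL(3) by order
        next
          case False
          then have "x \<in> gen_right" using cases[OF x] left[OF x] empty by blast
          then obtain B \<eta> where "(B, \<eta>) \<in> UB" "fst x \<le> B" using right[OF x] by blast
          then show ?thesis using UB_c by (meson order_trans)
        qed
      qed
    next
      assume empty: "UB = {}"
      show ?thesis
      proof (rule that[OF cL])
        fix x assume x: "x \<in> upper s \<theta>"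
        show "fst x \<le> c"
        proof (cases "x \<in> gen_mid")
          case True then show ?thesis using mid[OF x True] eL(2) by order
        next
          case False
          then have "x \<in> gen_left" using cases[OF x] right[OF x] empty by blast
          then obtain A \<tau> where "(A, \<tau>) \<in> UA" "fst x \<le> A" using left[OF x] by blast
          then show ?thesis using UA_c by (meson order_trans)
        qed
      qed
    qed
  next
    case False
    have "finite UA" "finite UB" using finite_chains finite_subset[of UA left_chain] finite_subset[of UB right_chain] unfolding UA_def UB_def by auto
    then have "Max (snd ` UA) \<in> snd ` UA" "Max (snd ` UB) \<in> snd ` UB" using False by auto
    then obtain A \<tau> B \<eta> where A: "(A, \<tau>) \<in> UA" "\<tau> = Max (snd ` UA)" and B: "(B, \<eta>) \<in> UB" "\<eta> = Max (snd ` UB)" by auto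
    have mA: "A' \<le> A" if "(A', \<tau>') \<in> UA" for A' \<tau>'
    proof -
      have "\<tau>' \<le> \<tau>" using that \<open>finite UA\<close> unfolding A(2) by (intro Max_ge) force+
      then show ?thesis using left_chain_mono A(1) that unfolding UA_def by blast
    qed
    have mB: "B' \<le> B" if "(B', \<eta>') \<in> UB" for B' \<eta>'
    proof -
      have "\<eta>' \<le> \<eta>" using that \<open>finite UB\<close> unfolding B(2) by (intro Max_ge) force+
      then show ?thesis using right_chain_mono B(1) that unfolding UB_def by blast
    qed
    have AL: "A \<in> L" "B \<in> L" "0 \<le> \<tau>" "0 \<le> \<eta>" "e \<le> A" using A(1) B(1) left_chain right_chain unfolding UA_def UB_def by auto
    have lt: "s * \<tau> < 1 - s" "(1 - s) * \<eta> < s" using A(1) B(1) unfolding UA_def UB_def by auto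
    have "0 \<le> s * \<tau>" "0 \<le> (1 - s) * \<eta>" using s AL by auto
    then have pos: "0 < 1 - s" "0 < s" using lt by linarith+
    have "(s * \<tau>) * ((1 - s) * \<eta>) < (1 - s) * s"
      using lt s AL by (intro mult_strict_mono') auto
    then have "(s * (1 - s)) * (\<tau> * \<eta>) < (s * (1 - s)) * 1" by (simp add: mult_ac)
    then have "\<tau> * \<eta> < 1" using pos by (subst (asm) mult_less_cancel_left_pos) auto
    then have comp: "compat A B" using chains_compat A(1) B(1) unfolding UA_def UB_def by blast
    have j: "A \<squnion> B \<in> L" "A \<le> A \<squnion> B" "B \<le> A \<squnion> B" using join_in[OF AL(1,2) comp] join_ge1[OF AL(1,2) comp] join_ge2[OF AL(1,2) comp] by auto
    show ?thesis
    proof (rule that[OF j(1)])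
      fix x assume x: "x \<in> upper s \<theta>"
      have "fst x \<le> A \<or> fst x \<le> B"
        using cases[OF x] mid[OF x] left[OF x] right[OF x] mA mB AL(5) by (meson order_trans)
      then show "fst x \<le> A \<squnion> B" using j by (meson order_trans)
    qed
  qed
qed

lemma upper_sub: "upper s \<theta> \<subseteq> gen"
  unfolding upper_def by auto

lemma finite_upper: "finite (fst ` upper s \<theta>)" and upper_in: "fst ` upper s \<theta> \<subseteq> L"
  using finite_subset[OF upper_sub[of s \<theta>] finite_gen] gen_in upper_sub[of s \<theta>] by blast+

lemma elt_lub:
  assumes "0 \<le> s" "s \<le> 1" "0 < \<theta>"
  shows "elt s \<theta> \<in> L" "\<And>x. x \<in> upper s \<theta> \<Longrightarrow> fst x \<le> elt s \<theta>"
    "\<And>w. w \<in> L \<Longrightarrow> (\<And>x. x \<in> upper s \<theta> \<Longrightarrow> fst x \<le> w) \<Longrightarrow> elt s \<theta> \<le> w"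
proof -
  obtain u where u: "u \<in> L" "\<And>x. x \<in> upper s \<theta> \<Longrightarrow> fst x \<le> u" using upper_bounded[OF assms] by blast
  have L: "isLub L (fst ` upper s \<theta>) (elt s \<theta>)"
    unfolding elt_def by (rule isLub_lub[OF finite_upper upper_in u(1)]) (use u(2) in blast)
  then show "elt s \<theta> \<in> L" "\<And>x. x \<in> upper s \<theta> \<Longrightarrow> fst x \<le> elt s \<theta>"
    "\<And>w. w \<in> L \<Longrightarrow> (\<And>x. x \<in> upper s \<theta> \<Longrightarrow> fst x \<le> w) \<Longrightarrow> elt s \<theta> \<le> w"
    unfolding isLub_alt by auto
qed

text \<open>The three sets of jumps which the generators with coefficients at least \<open>\<theta>\<close> contribute to a label.\<close>

definition mid_set :: "real \<Rightarrow> real \<Rightarrow> nat set" where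
  "mid_set s \<theta> = {i. \<exists>a\<le>n. \<exists>b\<le>n'. \<theta> \<le> (1 - s) * level m a + s * level z b \<and> 1 \<le> i \<and> i \<le> a \<and> i \<in> J (k' b)}"

definition left_set :: "real \<Rightarrow> real \<Rightarrow> nat set" where
  "left_set s \<theta> = {i. \<exists>a\<le>n. \<exists>(A, \<tau>)\<in>left_chain. \<theta> \<le> ((1 - s) - s * \<tau>) * level m a \<and> 1 \<le> i \<and> i \<le> a \<and> i \<in> J A}"

definition right_set :: "real \<Rightarrow> real \<Rightarrow> nat set" where
  "right_set s \<theta> = {j. \<exists>b\<le>n'. \<exists>(B, \<eta>)\<in>right_chain. \<theta> \<le> (s - (1 - s) * \<eta>) * level z b \<and> 1 \<le> j \<and> j \<le> b \<and> j \<in> J' B}"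

text \<open>The label of the join contains all labels that come from the generators. Their number bounds its
  rank by \<open>rk_lub_three_le\<close>, and the rank bounds the size of the label by \<open>card_label_le\<close>, so all
  three agree.\<close>

lemma label_elt:
  assumes s: "0 \<le> s" "s \<le> 1" and \<theta>: "0 < \<theta>"
  shows "lab (elt s \<theta>) = Inl ` (mid_set s \<theta> \<union> left_set s \<theta>) \<union> Inr ` (right_set s \<theta> - J' c)"
    "card (lab (elt s \<theta>)) = rk (elt s \<theta>)"
proof -
  define Gd where "Gd = (\<lambda>(i, j). (i, k' j)) ` {(i, j) \<in> {..n} \<times> {..n'}. \<theta> \<le> (1 - s) * level m i + s * level z j}"
  define Ga where "Ga = (\<lambda>(i, x). (i, fst x)) ` {(i, x) \<in> {..n} \<times> left_chain. \<theta> \<le> ((1 - s) - s * snd x) * level m i}"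
  define Gb where "Gb = (\<lambda>(j, x). (j, fst x)) ` {(j, x) \<in> {..n'} \<times> right_chain. \<theta> \<le> (s - (1 - s) * snd x) * level z j}"
  have up: "fst ` upper s \<theta> = (\<lambda>(i, q). k i \<sqinter> q) ` Gd \<union> (\<lambda>(i, P). k i \<sqinter> P) ` Ga \<union> (\<lambda>(j, Q). k' j \<sqinter> Q) ` Gb"
  proof -
    have "fst ` {x \<in> gen_mid. \<theta> \<le> coeff s x} = (\<lambda>(i, q). k i \<sqinter> q) ` Gd"
      unfolding gen_mid_def Gd_def coeff_def by force
    moreover have "fst ` {x \<in> gen_left. \<theta> \<le> coeff s x} = (\<lambda>(i, P). k i \<sqinter> P) ` Ga"
    proof -
      have "(1 - s) * level m i + s * (- snd x * level m i) = ((1 - s) - s * snd x) * level m i" for i and x :: "'a \<times> real"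
        by (simp add: algebra_simps)
      note eq = this
      have "fst ` {x \<in> gen_left. \<theta> \<le> coeff s x} =
          (\<lambda>(i, x). k i \<sqinter> fst x) ` {(i, x) \<in> {..n} \<times> left_chain. \<theta> \<le> (1 - s) * level m i + s * (- snd x * level m i)}"
        unfolding gen_left_def coeff_def by force
      then show ?thesis unfolding eq Ga_def by (simp add: image_image case_prod_beta)
    qed
    moreover have "fst ` {x \<in> gen_right. \<theta> \<le> coeff s x} = (\<lambda>(j, Q). k' j \<sqinter> Q) ` Gb"
    proof -
      have "(1 - s) * (- snd x * level z j) + s * level z j = (s - (1 - s) * snd x) * level z j" for j and x :: "'a \<times> real"
        by (simp add: algebra_simps)
      note eq = this
      have "fst ` {x \<in> gen_right. \<theta> \<le> coeff s x} =
          (\<lambda>(j, x). k' j \<sqinter> fst x) ` {(j, x) \<in> {..n'} \<times> right_chain. \<theta> \<le> (1 - s) * (- snd x * level z j) + s * level z j}"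
        unfolding gen_right_def coeff_def by force
      then show ?thesis unfolding eq Gb_def by (simp add: image_image case_prod_beta)
    qed
    moreover have "upper s \<theta> = {x \<in> gen_mid. \<theta> \<le> coeff s x} \<union> {x \<in> gen_left. \<theta> \<le> coeff s x} \<union> {x \<in> gen_right. \<theta> \<le> coeff s x}"
      unfolding upper_def gen_def by blast
    ultimately show ?thesis by (simp add: image_Un)
  qed
  have sets: "(\<Union>(i, q)\<in>Gd. {1..i} \<inter> J q) = mid_set s \<theta>" "(\<Union>(i, P)\<in>Ga. {1..i} \<inter> J P) = left_set s \<theta>"
    "(\<Union>(j, Q)\<in>Gb. {1..j} \<inter> J' Q) = right_set s \<theta>"
  proof -
    show "(\<Union>(i, q)\<in>Gd. {1..i} \<inter> J q) = mid_set s \<theta>"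
    proof (intro set_eqI iffI)
      fix x assume "x \<in> (\<Union>(i, q)\<in>Gd. {1..i} \<inter> J q)"
      then obtain i j where "i \<le> n" "j \<le> n'" "\<theta> \<le> (1 - s) * level m i + s * level z j" "x \<in> {1..i}" "x \<in> J (k' j)"
        unfolding Gd_def by auto
      then show "x \<in> mid_set s \<theta>" unfolding mid_set_def by auto
    next
      fix x assume "x \<in> mid_set s \<theta>"
      then obtain a b where ab: "a \<le> n" "b \<le> n'" "\<theta> \<le> (1 - s) * level m a + s * level z b" "1 \<le> x" "x \<le> a" "x \<in> J (k' b)"
        unfolding mid_set_def by blast
      then have "(a, k' b) \<in> Gd" unfolding Gd_def by force
      then show "x \<in> (\<Union>(i, q)\<in>Gd. {1..i} \<inter> J q)" using ab by force
    qed
    show "(\<Union>(i, P)\<in>Ga. {1..i} \<inter> J P) = left_set s \<theta>"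
    proof (intro set_eqI iffI)
      fix x assume "x \<in> (\<Union>(i, P)\<in>Ga. {1..i} \<inter> J P)"
      then obtain i A \<tau> where "i \<le> n" "(A, \<tau>) \<in> left_chain" "\<theta> \<le> ((1 - s) - s * \<tau>) * level m i" "x \<in> {1..i}" "x \<in> J A"
        unfolding Ga_def by auto
      then show "x \<in> left_set s \<theta>" unfolding left_set_def by auto
    next
      fix x assume "x \<in> left_set s \<theta>"
      then obtain a A \<tau> where ab: "a \<le> n" "(A, \<tau>) \<in> left_chain" "\<theta> \<le> ((1 - s) - s * \<tau>) * level m a" "1 \<le> x" "x \<le> a" "x \<in> J A"
        unfolding left_set_def by blast
      then have "(a, A) \<in> Ga" unfolding Ga_def by force
      then show "x \<in> (\<Union>(i, P)\<in>Ga. {1..i} \<inter> J P)" using ab by force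
    qed
    show "(\<Union>(j, Q)\<in>Gb. {1..j} \<inter> J' Q) = right_set s \<theta>"
    proof (intro set_eqI iffI)
      fix x assume "x \<in> (\<Union>(j, Q)\<in>Gb. {1..j} \<inter> J' Q)"
      then obtain i A \<tau> where "i \<le> n'" "(A, \<tau>) \<in> right_chain" "\<theta> \<le> (s - (1 - s) * \<tau>) * level z i" "x \<in> {1..i}" "x \<in> J' A"
        unfolding Gb_def by auto
      then show "x \<in> right_set s \<theta>" unfolding right_set_def by auto
    next
      fix x assume "x \<in> right_set s \<theta>"
      then obtain a A \<tau> where ab: "a \<le> n'" "(A, \<tau>) \<in> right_chain" "\<theta> \<le> (s - (1 - s) * \<tau>) * level z a" "1 \<le> x" "x \<le> a" "x \<in> J' A"
        unfolding right_set_def by blast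
      then have "(a, A) \<in> Gb" unfolding Gb_def by force
      then show "x \<in> (\<Union>(j, Q)\<in>Gb. {1..j} \<inter> J' Q)" using ab by force
    qed
  qed
  obtain u where u: "u \<in> L" "\<And>x. x \<in> upper s \<theta> \<Longrightarrow> fst x \<le> u" using upper_bounded[OF assms] by blast
  have finG: "finite Gd" "finite Ga" "finite Gb"
  proof -
    have fin: "finite ({..n} \<times> {..n'})" "finite ({..n} \<times> left_chain)" "finite ({..n'} \<times> right_chain)" using finite_chains by auto
    show "finite Gd" unfolding Gd_def by (rule finite_imageI, rule finite_subset[OF _ fin(1)]) auto
    show "finite Ga" unfolding Ga_def by (rule finite_imageI, rule finite_subset[OF _ fin(2)]) auto
    show "finite Gb" unfolding Gb_def by (rule finite_imageI, rule finite_subset[OF _ fin(3)]) auto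
  qed
  have subG: "Gd \<subseteq> {..n} \<times> k' ` {..n'}" "Ga \<subseteq> {..n} \<times> fst ` left_chain" "Gb \<subseteq> {..n'} \<times> fst ` right_chain"
    unfolding Gd_def Ga_def Gb_def by force+
  have DL: "fst ` left_chain \<subseteq> L" "fst ` right_chain \<subseteq> L" using left_chain(1) right_chain(1) by auto
  have Dch: "Complete_Partial_Order.chain (\<le>) (fst ` left_chain)" "Complete_Partial_Order.chain (\<le>) (fst ` right_chain)"
    unfolding Complete_Partial_Order.chain_def using left_chain_mono right_chain_mono
    by (auto) (metis linear)+
  have De: "A \<in> fst ` left_chain \<Longrightarrow> e \<le> A" "B \<in> fst ` right_chain \<Longrightarrow> e \<le> B" for A B
    using left_chain(3) right_chain(3) by auto
  have da: "(i, c') \<in> Gd" if iA: "(i, A) \<in> Ga" for i A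
  proof -
    obtain \<tau> where "i \<le> n" "(A, \<tau>) \<in> left_chain" "\<theta> \<le> ((1 - s) - s * \<tau>) * level m i" using iA unfolding Ga_def by auto
    moreover have "((1 - s) - s * \<tau>) * level m i \<le> (1 - s) * level m i"
      using left_chain(4)[OF calculation(2)] s level_m_nonneg[of i] by (intro mult_right_mono) auto
    moreover have "0 \<le> s * level z n'" using s level_z_nonneg by simp
    ultimately show ?thesis unfolding Gd_def by force
  qed
  have db: "(n, k' j) \<in> Gd" if jB: "(j, B) \<in> Gb" for j B
  proof -
    obtain \<eta> where "j \<le> n'" "(B, \<eta>) \<in> right_chain" "\<theta> \<le> (s - (1 - s) * \<eta>) * level z j" using jB unfolding Gb_def by auto
    moreover have "(s - (1 - s) * \<eta>) * level z j \<le> s * level z j"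
      using right_chain(4)[OF calculation(2)] s level_z_nonneg[of j] by (intro mult_right_mono) auto
    moreover have "0 \<le> (1 - s) * level m n" using s level_m_nonneg by simp
    ultimately show ?thesis unfolding Gd_def by force
  qed
  define X where "X = Inl ` (mid_set s \<theta> \<union> left_set s \<theta>) \<union> Inr ` (right_set s \<theta> - J' c)"
  have le: "rk (elt s \<theta>) \<le> card X"
    unfolding elt_def X_def sets[symmetric]
    by (rule rk_lub_three_le(3)[OF flag_k flag_k' finG(1) subG(1) finG(2) subG(2) DL(1) Dch(1) De(1) finG(3) subG(3) DL(2) Dch(2) De(2) da db up u(1)])
      (use u(2) in auto)
  have sub: "X \<subseteq> lab (elt s \<theta>)"
  proof -
    have E: "elt s \<theta> \<in> L" using elt_lub(1)[OF assms] .
    have up': "x \<le> elt s \<theta>" if "x \<in> fst ` upper s \<theta>" for x using elt_lub(2)[OF assms] that by auto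
    have kL: "i \<le> n \<Longrightarrow> k i \<in> L" "j \<le> n' \<Longrightarrow> k' j \<in> L" for i j
      using flag_in[OF flag_k] flag_in[OF flag_k'] by auto
    have 1: "{1..i} \<inter> J q \<subseteq> J (elt s \<theta>)" if "(i, q) \<in> Gd \<union> Ga" for i q
    proof -
      have iq: "i \<le> n" "q \<in> L" using that subG DL kL by auto
      have "k i \<sqinter> q \<le> elt s \<theta>" using that by (intro up') (unfold up, force)
      then have "J (q \<sqinter> k i) \<subseteq> J (elt s \<theta>)" using iq kL E by (intro jumps_mono[OF flag_k]) (auto simp: meet_commute)
      then show ?thesis using jumps_meet_flag[OF flag_k iq(2,1)] by blast
    qed
    have 2: "{1..j} \<inter> J' q \<subseteq> J' (elt s \<theta>)" if "(j, q) \<in> Gb" for j q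
    proof -
      have iq: "j \<le> n'" "q \<in> L" using that subG DL by auto
      have "k' j \<sqinter> q \<le> elt s \<theta>" using that by (intro up') (unfold up, force)
      then have "J' (q \<sqinter> k' j) \<subseteq> J' (elt s \<theta>)" using iq kL E by (intro jumps_mono[OF flag_k']) (auto simp: meet_commute)
      then show ?thesis using jumps_meet_flag[OF flag_k' iq(2,1)] by blast
    qed
    show ?thesis unfolding X_def label_def sets[symmetric] using 1 2 by blast
  qed
  have "card (lab (elt s \<theta>)) \<le> rk (elt s \<theta>)" by (rule card_label_le[OF flag_k flag_k' elt_lub(1)[OF assms]])
  moreover have "card X \<le> card (lab (elt s \<theta>))" by (rule card_mono[OF finite_label sub])
  ultimately have "card X = card (lab (elt s \<theta>))" "card (lab (elt s \<theta>)) = rk (elt s \<theta>)" using le by auto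
  then show "lab (elt s \<theta>) = X" "card (lab (elt s \<theta>)) = rk (elt s \<theta>)"
    using card_subset_eq[OF finite_label sub] by auto
qed

subsection \<open>Coordinates along the geodesic\<close>

abbreviation \<rho> :: "nat \<Rightarrow> real" where "\<rho> i \<equiv> mass z (\<lambda>p. i \<in> J p)"

text \<open>The coordinates of the geodesic. A coordinate of \<open>m\<close> in the common part interpolates between the two
  points; the others shrink at the slope of their block. For a coordinate of \<open>z\<close> outside \<open>q0\<close> the
  parameter of its block is chosen from the support.\<close>

definition left_slope :: "nat \<Rightarrow> real" where
  "left_slope i = sqrt (slope z i)"

definition right_param :: "nat \<Rightarrow> real" where
  "right_param j = (SOME t. t \<in> \<Lambda> \<and> 0 < t \<and> j \<in> J' (Q t) - J' (q t))"

definition right_slope :: "nat \<Rightarrow> real" where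
  "right_slope j = (if j \<in> J' q0 then 0 else 1 / sqrt (right_param j))"

definition left_coord :: "real \<Rightarrow> nat \<Rightarrow> real" where
  "left_coord s i = (if i \<in> J e then (1 - s) * level m i + s * \<rho> i else ((1 - s) - s * left_slope i) * level m i)"

definition right_coord :: "real \<Rightarrow> nat \<Rightarrow> real" where
  "right_coord s j = (s - (1 - s) * right_slope j) * level z j"

lemma slope_block:
  assumes "t \<in> \<Lambda>" "i \<in> J (P t) - J (p t)"
  shows "slope z i = t"
  using slope_eq[OF z_flagged S(2)[OF assms(1)] S(3)[OF assms(1)] S(4)[OF assms(1)]] assms(2) by blast

lemma slope_in:
  assumes "i \<in> {1..n}"
  shows "slope z i \<in> \<Lambda>" "i \<in> J (P (slope z i)) - J (p (slope z i))"
  using S(11)[OF assms] slope_block by auto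

lemma right_param:
  assumes "j \<in> {1..n'} - J' q0"
  shows "right_param j \<in> \<Lambda>" "0 < right_param j" "j \<in> J' (Q (right_param j)) - J' (q (right_param j))"
proof -
  have "right_param j \<in> \<Lambda> \<and> 0 < right_param j \<and> j \<in> J' (Q (right_param j)) - J' (q (right_param j))"
    unfolding right_param_def by (rule someI_ex) (use S(12)[OF assms] in blast)
  then show "right_param j \<in> \<Lambda>" "0 < right_param j" "j \<in> J' (Q (right_param j)) - J' (q (right_param j))" by auto
qed

lemma right_param_eq:
  assumes "t \<in> \<Lambda>" "j \<in> {1..n'} - J' q0" "j \<in> J' (Q t) - J' (q t)"
  shows "right_param j = t"
proof -
  have *: False if "t \<in> \<Lambda>" "t' \<in> \<Lambda>" "t < t'" "j \<notin> J' (q t)" "j \<in> J' (Q t')" for t t'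
    using jumps_mono[OF flag_k' support_in(4)[OF that(2)] support_in(2)[OF that(1)] S(10)[OF that(1,2,3)]] that by blast
  show ?thesis
    using *[of t "right_param j"] *[of "right_param j" t] right_param[OF assms(2)] assms
    by (cases t "right_param j" rule: linorder_cases) auto
qed

lemma left_slope_nonneg: "i \<in> {1..n} \<Longrightarrow> 0 \<le> left_slope i"
  unfolding left_slope_def using slope_in(1) S(2) by simp

lemma right_slope_nonneg: "j \<in> {1..n'} \<Longrightarrow> 0 \<le> right_slope j"
  unfolding right_slope_def using right_param(2)[of j] by auto

text \<open>Among the elements of the left chain with the jump \<open>i\<close>, the one that exchanges \<open>i\<close> has the least slope,
  hence the greatest coefficients. The same holds for the right chain.\<close>

lemma left_chain_slope:
  assumes i: "i \<in> {1..n}"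
  shows "\<exists>A. (A, left_slope i) \<in> left_chain \<and> i \<in> J A"
    and "(A, \<tau>) \<in> left_chain \<Longrightarrow> i \<in> J A \<Longrightarrow> left_slope i \<le> \<tau>"
proof -
  show "\<exists>A. (A, left_slope i) \<in> left_chain \<and> i \<in> J A"
    unfolding left_chain_def left_slope_def using slope_in[OF i] by blast
  assume A: "(A, \<tau>) \<in> left_chain" "i \<in> J A"
  then obtain t where t: "t \<in> \<Lambda>" "A = P t" "\<tau> = sqrt t" unfolding left_chain_def by auto
  have "\<not> t < slope z i"
    using jumps_mono[OF flag_k support_in(1)[OF t(1)] support_in(3)[OF slope_in(1)[OF i]] S(9)[OF t(1) slope_in(1)[OF i]]]
      slope_in(2)[OF i] A(2) t(2) by blast
  then show "left_slope i \<le> \<tau>" unfolding left_slope_def t by simp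
qed

lemma right_chain_slope:
  assumes j: "j \<in> {1..n'}"
  shows "\<exists>B. (B, right_slope j) \<in> right_chain \<and> j \<in> J' B"
    and "(B, \<eta>) \<in> right_chain \<Longrightarrow> j \<in> J' B \<Longrightarrow> right_slope j \<le> \<eta>"
proof -
  show "\<exists>B. (B, right_slope j) \<in> right_chain \<and> j \<in> J' B"
    unfolding right_chain_def right_slope_def using right_param[of j] j by auto
  assume B: "(B, \<eta>) \<in> right_chain" "j \<in> J' B"
  show "right_slope j \<le> \<eta>"
  proof (cases "j \<in> J' q0")
    case True
    then show ?thesis using right_chain(4)[OF B(1)] unfolding right_slope_def by simp
  next
    case False
    then obtain t where t: "t \<in> \<Lambda>" "0 < t" "B = Q t" "\<eta> = 1 / sqrt t" using B unfolding right_chain_def by auto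
    have j': "j \<in> {1..n'} - J' q0" using j False by blast
    note r = right_param[OF j']
    have "\<not> right_param j < t"
      using jumps_mono[OF flag_k' support_in(4)[OF t(1)] support_in(2)[OF r(1)] S(10)[OF r(1) t(1)]] r(3) B(2) t(3) by blast
    then show ?thesis unfolding right_slope_def t using False t(2) r(2) by (simp add: frac_le)
  qed
qed

lemma J_flag': "b \<le> n' \<Longrightarrow> J (k' b) \<subseteq> J e"
  unfolding J_e using flag_in[OF flag_k'] c'L flag_mono[OF flag_k', of b n'] by (intro jumps_mono[OF flag_k]) auto

lemma rho_0:
  assumes "i \<notin> J e"
  shows "\<rho> i = 0"
proof -
  have "\<rho> i = mass z (\<lambda>p. False)"
  proof (rule mass_cong)
    fix p assume "p \<in> supp z"
    then obtain b where "b \<le> n'" "p = k' b" using z_flagged unfolding flagged_def by blast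
    then show "(i \<in> J p) = False" using J_flag' assms by blast
  qed
  then show ?thesis by simp
qed

text \<open>The generators that witness a common coordinate \<open>i\<close> come from the first element of the flag of \<open>z\<close> that
  has the jump \<open>i\<close>.\<close>

lemma rho_level:
  assumes i: "i \<in> J e"
  shows "\<exists>b\<le>n'. i \<in> J (k' b) \<and> \<rho> i = level z b" and "b \<le> n' \<Longrightarrow> i \<in> J (k' b) \<Longrightarrow> level z b \<le> \<rho> i"
proof -
  have fl: "\<exists>l\<le>n'. p = k' l \<and> rk p = l" if "p \<in> supp z" for p
    using that z_flagged flag_rk unfolding flagged_def by blast
  have mono: "i \<in> J (k' l)" if "i \<in> J (k' b)" "b \<le> l" "l \<le> n'" for b l
    using jumps_mono[OF flag_k, of "k' b" "k' l"] flag_in[OF flag_k'] flag_mono[OF flag_k' that(2,3)] that by auto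
  show "level z b \<le> \<rho> i" if "b \<le> n'" "i \<in> J (k' b)" for b
    using fl mono that by (intro mass_mono[OF zK]) fastforce
  define b where "b = (LEAST b. i \<in> J (k' b))"
  have ib: "i \<in> J (k' b)" unfolding b_def using i unfolding J_e by (rule LeastI)
  have le: "b \<le> l" if "i \<in> J (k' l)" for l unfolding b_def using that by (rule Least_le)
  have bn: "b \<le> n'" using le i unfolding J_e by blast
  have "\<rho> i = level z b"
  proof (rule mass_cong)
    fix p assume "p \<in> supp z"
    then obtain l where "l \<le> n'" "p = k' l" "rk p = l" using fl by blast
    then show "(i \<in> J p) = (b \<le> rk p)" using le[of l] mono[OF ib, of l] by auto
  qed
  then show "\<exists>b\<le>n'. i \<in> J (k' b) \<and> \<rho> i = level z b" using ib bn by blast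
qed

text \<open>The generator of the greatest coefficient among those with a given jump determines the thresholds at
  which the jump is present. This coefficient is the coordinate, as long as it is positive.\<close>

lemma label_iff:
  assumes s: "0 \<le> s" "s \<le> 1" and \<theta>: "0 < \<theta>"
  shows "i \<in> {1..n} \<Longrightarrow> Inl i \<in> lab (elt s \<theta>) \<longleftrightarrow> \<theta> \<le> left_coord s i"
    and "j \<in> {1..n'} - J' c \<Longrightarrow> Inr j \<in> lab (elt s \<theta>) \<longleftrightarrow> \<theta> \<le> right_coord s j"
proof -
  assume i: "i \<in> {1..n}"
  have "Inl i \<in> lab (elt s \<theta>) \<longleftrightarrow> i \<in> mid_set s \<theta> \<union> left_set s \<theta>"
    unfolding label_elt(1)[OF assms] by auto
  also have "\<dots> \<longleftrightarrow> \<theta> \<le> left_coord s i"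
  proof (cases "i \<in> J e")
    case True
    have mid: "i \<in> mid_set s \<theta> \<longleftrightarrow> \<theta> \<le> left_coord s i"
    proof
      assume "i \<in> mid_set s \<theta>"
      then obtain a b where ab: "a \<le> n" "b \<le> n'" "\<theta> \<le> (1 - s) * level m a + s * level z b" "i \<le> a" "i \<in> J (k' b)"
        unfolding mid_set_def by blast
      have "(1 - s) * level m a \<le> (1 - s) * level m i" "s * level z b \<le> s * \<rho> i"
        using level_antimono[OF mK ab(4)] rho_level(2)[OF True ab(2,5)] s by (auto intro: mult_left_mono)
      then show "\<theta> \<le> left_coord s i" using ab(3) True unfolding left_coord_def by simp
    next
      assume le: "\<theta> \<le> left_coord s i"
      obtain b where "b \<le> n'" "i \<in> J (k' b)" "\<rho> i = level z b" using rho_level(1)[OF True] by blast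
      then show "i \<in> mid_set s \<theta>" using le True i unfolding mid_set_def left_coord_def by auto
    qed
    have "\<theta> \<le> left_coord s i" if left: "i \<in> left_set s \<theta>"
    proof -
      obtain a A \<tau> where a: "a \<le> n" "(A, \<tau>) \<in> left_chain" "\<theta> \<le> ((1 - s) - s * \<tau>) * level m a" "i \<le> a"
        using left unfolding left_set_def by blast
      have "((1 - s) - s * \<tau>) * level m a \<le> (1 - s) * level m a"
        using left_chain(4)[OF a(2)] s level_m_nonneg[of a] by (intro mult_right_mono) auto
      also have "\<dots> \<le> (1 - s) * level m i" using level_antimono[OF mK a(4)] s by (intro mult_left_mono) auto
      also have "\<dots> \<le> left_coord s i" using True s mass_nonneg[OF zK] unfolding left_coord_def by simp
      finally show ?thesis using a(3) by simp
    qed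
    then show ?thesis using mid by blast
  next
    case False
    have "i \<notin> mid_set s \<theta>" using J_flag' False unfolding mid_set_def by blast
    moreover have "i \<in> left_set s \<theta> \<longleftrightarrow> \<theta> \<le> left_coord s i"
    proof
      assume "i \<in> left_set s \<theta>"
      then obtain a A \<tau> where a: "a \<le> n" "(A, \<tau>) \<in> left_chain" "\<theta> \<le> ((1 - s) - s * \<tau>) * level m a" "i \<le> a" "i \<in> J A"
        unfolding left_set_def by blast
      have pos: "0 < ((1 - s) - s * \<tau>) * level m a" using a(3) \<theta> by simp
      have "left_slope i \<le> \<tau>" using left_chain_slope(2)[OF i a(2,5)] .
      then have "((1 - s) - s * \<tau>) * level m a \<le> ((1 - s) - s * left_slope i) * level m a"
        using s level_m_nonneg[of a] by (intro mult_right_mono) (auto intro: mult_left_mono)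
      also have "\<dots> \<le> ((1 - s) - s * left_slope i) * level m i"
      proof (intro mult_left_mono level_antimono[OF mK a(4)])
        have "0 < ((1 - s) - s * left_slope i) * level m a" using pos calculation by simp
        then show "0 \<le> (1 - s) - s * left_slope i" using level_m_nonneg[of a] by (simp add: zero_less_mult_iff)
      qed
      finally show "\<theta> \<le> left_coord s i" using a(3) False unfolding left_coord_def by simp
    next
      assume le: "\<theta> \<le> left_coord s i"
      obtain A where A: "(A, left_slope i) \<in> left_chain" "i \<in> J A" using left_chain_slope(1)[OF i] by blast
      have "\<theta> \<le> ((1 - s) - s * left_slope i) * level m i" using le False unfolding left_coord_def by simp
      then show "i \<in> left_set s \<theta>" using A i unfolding left_set_def by auto
    qed
    ultimately show ?thesis by blast
  qed
  finally show "Inl i \<in> lab (elt s \<theta>) \<longleftrightarrow> \<theta> \<le> left_coord s i" .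
next
  assume "j \<in> {1..n'} - J' c"
  then have j: "j \<in> {1..n'}" "j \<notin> J' c" by auto
  have "Inr j \<in> lab (elt s \<theta>) \<longleftrightarrow> j \<in> right_set s \<theta>"
    unfolding label_elt(1)[OF assms] using j by auto
  also have "\<dots> \<longleftrightarrow> \<theta> \<le> right_coord s j"
  proof
    assume "j \<in> right_set s \<theta>"
    then obtain a B \<eta> where a: "a \<le> n'" "(B, \<eta>) \<in> right_chain" "\<theta> \<le> (s - (1 - s) * \<eta>) * level z a" "j \<le> a" "j \<in> J' B"
      unfolding right_set_def by blast
    have pos: "0 < (s - (1 - s) * \<eta>) * level z a" using a(3) \<theta> by simp
    have "right_slope j \<le> \<eta>" using right_chain_slope(2)[OF j(1) a(2,5)] .
    then have "(s - (1 - s) * \<eta>) * level z a \<le> (s - (1 - s) * right_slope j) * level z a"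
      using s level_z_nonneg[of a] by (intro mult_right_mono) (auto intro: mult_left_mono)
    also have "\<dots> \<le> (s - (1 - s) * right_slope j) * level z j"
    proof (intro mult_left_mono level_antimono[OF zK a(4)])
      have "0 < (s - (1 - s) * right_slope j) * level z a" using pos calculation by simp
      then show "0 \<le> s - (1 - s) * right_slope j" using level_z_nonneg[of a] by (simp add: zero_less_mult_iff)
    qed
    finally show "\<theta> \<le> right_coord s j" using a(3) unfolding right_coord_def by simp
  next
    assume le: "\<theta> \<le> right_coord s j"
    obtain B where B: "(B, right_slope j) \<in> right_chain" "j \<in> J' B" using right_chain_slope(1)[OF j(1)] by blast
    have "\<theta> \<le> (s - (1 - s) * right_slope j) * level z j" using le unfolding right_coord_def by simp
    then show "j \<in> right_set s \<theta>" using B j unfolding right_set_def by auto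
  qed
  finally show "Inr j \<in> lab (elt s \<theta>) \<longleftrightarrow> \<theta> \<le> right_coord s j" .
qed

definition path :: "real \<Rightarrow> 'a \<Rightarrow> real" where
  "path s = step_point (elt s)"

lemma elt_antimono:
  assumes "0 \<le> s" "s \<le> 1" "0 < \<theta>" "\<theta> \<le> \<theta>'"
  shows "elt s \<theta>' \<le> elt s \<theta>"
proof (rule elt_lub(3))
  show "elt s \<theta> \<in> L" using elt_lub(1) assms by blast
  fix x assume "x \<in> upper s \<theta>'"
  then have "x \<in> upper s \<theta>" using assms unfolding upper_def by auto
  then show "fst x \<le> elt s \<theta>" using elt_lub(2) assms by blast
qed (use assms in auto)

lemma path_props:
  assumes s: "0 \<le> s" "s \<le> 1"
  shows "path s \<in> K" "supp (path s) \<subseteq> elt s ` {0<..1}"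
    "mass (path s) R = measure lborel {\<theta> \<in> {0<..1}. R (elt s \<theta>)}"
proof -
  have mono: "\<And>\<theta> \<theta>'. 0 < \<theta> \<Longrightarrow> \<theta> \<le> \<theta>' \<Longrightarrow> \<theta>' \<le> 1 \<Longrightarrow> elt s \<theta>' \<le> elt s \<theta>" using elt_antimono[OF s] by blast
  have "elt s ` {0<..1} \<subseteq> lub ` Pow (fst ` gen)" unfolding elt_def using upper_sub by blast
  moreover have "finite (lub ` Pow (fst ` gen))" using finite_gen by simp
  ultimately have fin: "finite (elt s ` {0<..1})" by (rule finite_subset)
  have "elt s ` {0<..1} \<subseteq> L" using elt_lub(1)[OF s] by auto
  note p = step_point_props[OF mono fin this]
  show "path s \<in> K" "supp (path s) \<subseteq> elt s ` {0<..1}" "mass (path s) R = measure lborel {\<theta> \<in> {0<..1}. R (elt s \<theta>)}"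
    unfolding path_def using p by auto
qed

lemma measure_threshold: "v \<le> 1 \<Longrightarrow> measure lborel {\<theta> \<in> {0<..1}. \<theta> \<le> v} = max 0 (v::real)"
proof -
  assume "v \<le> 1"
  then have "{\<theta> \<in> {0<..1}. \<theta> \<le> v} = {0<..v}" by auto
  moreover have "measure lborel {0<..v} = max 0 v" by (cases "0 \<le> v") auto
  ultimately show ?thesis by metis
qed

lemma coord_le_1:
  assumes "0 \<le> s" "s \<le> 1"
  shows "i \<in> {1..n} \<Longrightarrow> left_coord s i \<le> 1" "j \<in> {1..n'} \<Longrightarrow> right_coord s j \<le> 1"
proof -
  assume i: "i \<in> {1..n}"
  have "\<rho> i \<le> mass z (\<lambda>p. True)" by (rule mass_mono[OF zK]) simp
  then have r: "\<rho> i \<le> 1" using mass_True[OF zK] by simp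
  have "(1 - s) * level m i + s * \<rho> i \<le> (1 - s) * 1 + s * 1"
    using assms level_le_1[OF mK, of i] r by (intro add_mono mult_left_mono) auto
  moreover have "((1 - s) - s * left_slope i) * level m i \<le> 1 * 1"
  proof (rule mult_mono)
    have "0 \<le> s * left_slope i" using assms left_slope_nonneg[OF i] by simp
    then show "(1 - s) - s * left_slope i \<le> 1" using assms by simp
  qed (use level_le_1[OF mK, of i] level_m_nonneg[of i] in auto)
  ultimately show "left_coord s i \<le> 1" unfolding left_coord_def by auto
next
  assume j: "j \<in> {1..n'}"
  have "0 \<le> (1 - s) * right_slope j" using assms right_slope_nonneg[OF j] by simp
  then have "(s - (1 - s) * right_slope j) * level z j \<le> 1 * 1"
    using assms level_le_1[OF zK, of j] level_z_nonneg[of j] by (intro mult_mono) auto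
  then show "right_coord s j \<le> 1" unfolding right_coord_def by simp
qed

text \<open>A coordinate contributes the length of the interval of thresholds below it.\<close>

lemma path_coords:
  assumes s: "0 \<le> s" "s \<le> 1"
  shows "i \<in> {1..n} \<Longrightarrow> mass (path s) (\<lambda>p. Inl i \<in> lab p) = max 0 (left_coord s i)"
    "j \<in> {1..n'} - J' c \<Longrightarrow> mass (path s) (\<lambda>p. Inr j \<in> lab p) = max 0 (right_coord s j)"
proof -
  assume i: "i \<in> {1..n}"
  have "{\<theta> \<in> {0<..1}. Inl i \<in> lab (elt s \<theta>)} = {\<theta> \<in> {0<..1}. \<theta> \<le> left_coord s i}"
    using label_iff(1)[OF s _ i] by auto
  then show "mass (path s) (\<lambda>p. Inl i \<in> lab p) = max 0 (left_coord s i)"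
    unfolding path_props(3)[OF s] using measure_threshold[OF coord_le_1(1)[OF s i]] by simp
next
  assume j: "j \<in> {1..n'} - J' c"
  have "{\<theta> \<in> {0<..1}. Inr j \<in> lab (elt s \<theta>)} = {\<theta> \<in> {0<..1}. \<theta> \<le> right_coord s j}"
    using label_iff(2)[OF s _ j] by auto
  then show "mass (path s) (\<lambda>p. Inr j \<in> lab p) = max 0 (right_coord s j)"
    unfolding path_props(3)[OF s] using measure_threshold[OF coord_le_1(2)[OF s]] j by simp
qed

lemma left_coord_0: "i \<in> {1..n} \<Longrightarrow> left_coord 0 i = level m i"
  unfolding left_coord_def by simp

lemma right_coord_1: "right_coord 1 j = level z j"
  unfolding right_coord_def by simp

lemma left_coord_1: "i \<in> {1..n} \<Longrightarrow> i \<notin> J e \<Longrightarrow> left_coord 1 i \<le> 0"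
  unfolding left_coord_def using left_slope_nonneg[of i] level_m_nonneg[of i] by simp

text \<open>The endpoints are recognised by their supports, which lie in the flags, and their levels.\<close>

lemma flag_max_level:
  assumes x: "flagged x b h" and \<theta>: "0 < \<theta>" "\<theta> \<le> 1"
  obtains a where "a \<le> b" "\<theta> \<le> level x a" "\<And>i. i \<le> b \<Longrightarrow> \<theta> \<le> level x i \<Longrightarrow> i \<le> a"
proof -
  have xK: "x \<in> K" using x unfolding flagged_def by simp
  define a where "a = Max {i. i \<le> b \<and> \<theta> \<le> level x i}"
  have "0 \<in> {i. i \<le> b \<and> \<theta> \<le> level x i}" using mass_True[OF xK] \<theta> by simp
  then have "a \<in> {i. i \<le> b \<and> \<theta> \<le> level x i}" unfolding a_def by (intro Max_in) auto
  moreover have "i \<le> a" if "i \<le> b" "\<theta> \<le> level x i" for i unfolding a_def using that by (intro Max_ge) auto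
  ultimately show ?thesis using that by blast
qed

text \<open>At the time \<open>0\<close> the right generators have coefficients at most \<open>0\<close>, and the others are meets with elements of
  the flag of \<open>m\<close>.\<close>

lemma elt_0:
  assumes \<theta>: "0 < \<theta>" "\<theta> \<le> 1"
  shows "elt 0 \<theta> \<in> k ` {..n}"
proof -
  obtain a where a: "a \<le> n" "\<theta> \<le> level m a" "\<And>i. i \<le> n \<Longrightarrow> \<theta> \<le> level m i \<Longrightarrow> i \<le> a"
    using flag_max_level[OF m_flagged \<theta>] by blast
  have kL: "i \<le> n \<Longrightarrow> k i \<in> L" "j \<le> n' \<Longrightarrow> k' j \<in> L" for i j
    using flag_in[OF flag_k] flag_in[OF flag_k'] by auto
  have E: "elt 0 \<theta> \<in> L" using elt_lub(1) \<theta> by simp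
  have le: "elt 0 \<theta> \<le> k a"
  proof (rule elt_lub(3))
    fix x assume "x \<in> upper 0 \<theta>"
    then have x: "x \<in> gen" "\<theta> \<le> fst (snd x)" unfolding upper_def coeff_def by auto
    have "\<exists>i w. i \<le> n \<and> w \<in> L \<and> fst x = k i \<sqinter> w \<and> \<theta> \<le> level m i"
    proof -
      consider "x \<in> gen_mid" | "x \<in> gen_left" | "x \<in> gen_right" using x(1) unfolding gen_def by blast
      then show ?thesis
      proof cases
        case 1
        then obtain i j where "i \<le> n" "j \<le> n'" "x = (k i \<sqinter> k' j, level m i, level z j)" unfolding gen_mid_def by auto
        then show ?thesis using x(2) kL by (intro exI[of _ i] exI[of _ "k' j"]) auto
      next
        case 2 then show ?thesis using x(2) left_chain(1) unfolding gen_left_def by fastforce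
      next
        case 3
        then obtain j B \<eta> where "j \<le> n'" "(B, \<eta>) \<in> right_chain" "x = (k' j \<sqinter> B, - \<eta> * level z j, level z j)" unfolding gen_right_def by auto
        then have "(B, \<eta>) \<in> right_chain" "fst (snd x) = - \<eta> * level z j" by auto
        then have "fst (snd x) \<le> 0" using right_chain(4) level_z_nonneg[of j] by simp
        then show ?thesis using x(2) \<theta> by simp
      qed
    qed
    then obtain i w where i: "i \<le> n" "w \<in> L" "fst x = k i \<sqinter> w" "\<theta> \<le> level m i" by blast
    have "k i \<sqinter> w \<le> k i" using i kL by simp
    also have "k i \<le> k a" using a(3)[OF i(1,4)] a(1) by (rule flag_mono[OF flag_k])
    finally show "fst x \<le> k a" using i(3) by simp
  qed (use \<theta> a kL in auto)
  have "{1..a} \<subseteq> J (elt 0 \<theta>)"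
  proof
    fix i assume i: "i \<in> {1..a}"
    then have i': "i \<in> {1..n}" using a(1) by simp
    have "\<theta> \<le> level m i" using a(2) level_antimono[OF mK, of i a] i by simp
    then have "Inl i \<in> lab (elt 0 \<theta>)" using label_iff(1)[of 0 \<theta> i] \<theta>(1) i' left_coord_0[OF i'] by simp
    then show "i \<in> J (elt 0 \<theta>)" unfolding label_def by auto
  qed
  then have "card {1..a} \<le> card (J (elt 0 \<theta>))" by (intro card_mono) auto
  also have "\<dots> = rk (elt 0 \<theta> \<sqinter> c)" using card_jumps[OF flag_k E] .
  also have "\<dots> \<le> rk (elt 0 \<theta>)" using E cL by (intro rk_mono) auto
  finally have "rk (k a) \<le> rk (elt 0 \<theta>)" using flag_rk[OF flag_k a(1)] by simp
  then have "elt 0 \<theta> = k a" using rk_eqD[OF E kL(1)[OF a(1)] le] by simp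
  then show ?thesis using a(1) by blast
qed

lemma elt_1:
  assumes \<theta>: "0 < \<theta>" "\<theta> \<le> 1"
  shows "elt 1 \<theta> \<in> k' ` {..n'}"
proof -
  obtain a where a: "a \<le> n'" "\<theta> \<le> level z a" "\<And>i. i \<le> n' \<Longrightarrow> \<theta> \<le> level z i \<Longrightarrow> i \<le> a"
    using flag_max_level[OF z_flagged \<theta>] by blast
  have kL: "i \<le> n \<Longrightarrow> k i \<in> L" "j \<le> n' \<Longrightarrow> k' j \<in> L" for i j
    using flag_in[OF flag_k] flag_in[OF flag_k'] by auto
  have E: "elt 1 \<theta> \<in> L" using elt_lub(1) \<theta> by simp
  have le: "elt 1 \<theta> \<le> k' a"
  proof (rule elt_lub(3))
    fix x assume "x \<in> upper 1 \<theta>"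
    then have x: "x \<in> gen" "\<theta> \<le> snd (snd x)" unfolding upper_def coeff_def by auto
    have "\<exists>i w. i \<le> n' \<and> w \<in> L \<and> fst x = k' i \<sqinter> w \<and> \<theta> \<le> level z i"
    proof -
      consider "x \<in> gen_mid" | "x \<in> gen_left" | "x \<in> gen_right" using x(1) unfolding gen_def by blast
      then show ?thesis
      proof cases
        case 1
        then obtain i j where "i \<le> n" "j \<le> n'" "x = (k i \<sqinter> k' j, level m i, level z j)" unfolding gen_mid_def by auto
        then show ?thesis using x(2) kL meet_commute by auto
      next
        case 3 then show ?thesis using x(2) right_chain(1) unfolding gen_right_def by fastforce
      next
        case 2
        then obtain j B \<eta> where "j \<le> n" "(B, \<eta>) \<in> left_chain" "x = (k j \<sqinter> B, level m j, - \<eta> * level m j)" unfolding gen_left_def by auto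
        then have "(B, \<eta>) \<in> left_chain" "snd (snd x) = - \<eta> * level m j" by auto
        then have "snd (snd x) \<le> 0" using left_chain(4) level_m_nonneg[of j] by simp
        then show ?thesis using x(2) \<theta> by simp
      qed
    qed
    then obtain i w where i: "i \<le> n'" "w \<in> L" "fst x = k' i \<sqinter> w" "\<theta> \<le> level z i" by blast
    have "k' i \<sqinter> w \<le> k' i" using i kL by simp
    also have "k' i \<le> k' a" using a(3)[OF i(1,4)] a(1) by (rule flag_mono[OF flag_k'])
    finally show "fst x \<le> k' a" using i(3) by simp
  qed (use \<theta> a kL in auto)
  have "c \<sqinter> k' a \<le> elt 1 \<theta>"
  proof -
    have "(c \<sqinter> k' a, level m n, level z a) \<in> upper 1 \<theta>"
      using a unfolding upper_def gen_def gen_mid_def coeff_def by force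
    then show ?thesis using elt_lub(2)[of 1 \<theta>] \<theta> by fastforce
  qed
  then have "J' (c \<sqinter> k' a) \<subseteq> J' (elt 1 \<theta>)" using cL kL a E by (intro jumps_mono[OF flag_k']) auto
  then have 1: "J' c \<inter> {1..a} \<subseteq> J' (elt 1 \<theta>)" using jumps_meet_flag[OF flag_k' cL a(1)] by simp
  have "{1..a} \<subseteq> J' (elt 1 \<theta>)"
  proof
    fix j assume j: "j \<in> {1..a}"
    show "j \<in> J' (elt 1 \<theta>)"
    proof (cases "j \<in> J' c")
      case True
      then show ?thesis using 1 j by blast
    next
      case False
      then have j': "j \<in> {1..n'} - J' c" using a(1) j by simp
      have "\<theta> \<le> level z j" using a(2) level_antimono[OF zK, of j a] j by simp
      then have "Inr j \<in> lab (elt 1 \<theta>)" using label_iff(2)[of 1 \<theta> j] \<theta>(1) j' right_coord_1 by simp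
      then show ?thesis unfolding label_def by auto
    qed
  qed
  then have "card {1..a} \<le> card (J' (elt 1 \<theta>))" by (intro card_mono) auto
  also have "\<dots> = rk (elt 1 \<theta> \<sqinter> c')" using card_jumps[OF flag_k' E] .
  also have "\<dots> \<le> rk (elt 1 \<theta>)" using E c'L by (intro rk_mono) auto
  finally have "rk (k' a) \<le> rk (elt 1 \<theta>)" using flag_rk[OF flag_k' a(1)] by simp
  then have "elt 1 \<theta> = k' a" using rk_eqD[OF E kL(2)[OF a(1)] le] by simp
  then show ?thesis using a(1) by blast
qed

lemma label_sub: "lab x \<subseteq> Inl ` {1..n} \<union> Inr ` ({1..n'} - J' c)"
  unfolding label_def by (intro Un_mono image_mono Diff_mono jumps_sub order_refl)

lemma path_0: "path 0 = m"
proof -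
  have fl: "flagged (path 0) n k"
    unfolding flagged_def using path_props(1,2)[of 0] elt_0 flag_k by force
  have "level (path 0) i = level m i" if i: "i \<in> {1..n}" for i
  proof -
    have "level (path 0) i = mass (path 0) (\<lambda>p. Inl i \<in> lab p)"
      using mass_jumps_flagged[OF fl i] unfolding label_def by (simp add: image_iff)
    then show ?thesis using path_coords(1)[of 0 i] i left_coord_0[OF i] level_m_nonneg[of i] by simp
  qed
  then have "(sdist (path 0) m)\<^sup>2 = 0" using sdist_flagged[OF fl m_flagged] by simp
  then show ?thesis using sdist_eq_0[OF flagged_adjacent[OF fl m_flagged]] by simp
qed

lemma path_1: "path 1 = z"
proof -
  have fl: "flagged (path 1) n' k'"
    unfolding flagged_def using path_props(1,2)[of 1] elt_1 flag_k' by force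
  have a: "adjacent (path 1) z" by (rule flagged_adjacent[OF fl z_flagged])
  have c: "card (lab p) = rk p" if p: "p \<in> supp (path 1) \<union> supp z" for p
  proof -
    obtain j where j: "j \<le> n'" "p = k' j" using p fl z_flagged unfolding flagged_def by blast
    have pL: "p \<in> L" using j flag_in[OF flag_k'] by simp
    have "card (J' p - J' c) = card (J' p) - card (J' p \<inter> J' c)" by (rule card_Diff_subset_Int) simp
    moreover have "card (J' p \<inter> J' c) = rk (c \<sqinter> k' j)"
      using card_jumps_Int[OF flag_k' cL j(1)] jumps_flag[OF flag_k' j(1)] j by (simp add: Int_commute)
    moreover have "card (J p) = rk (k' j \<sqinter> c)" using card_jumps[OF flag_k pL] j by simp
    moreover have "card (J' p) = rk p" using jumps_flag[OF flag_k' j(1)] flag_rk[OF flag_k' j(1)] j by simp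
    moreover have "card (J' p \<inter> J' c) \<le> card (J' p)" by (intro card_mono) auto
    ultimately show ?thesis unfolding label_def by (subst card_Inl_Inr) (auto simp: meet_commute)
  qed
  have "(sdist (path 1) z)\<^sup>2 = (\<Sum>\<omega>\<in>Inl ` {1..n} \<union> Inr ` ({1..n'} - J' c). (mass (path 1) (\<lambda>p. \<omega> \<in> lab p) - mass z (\<lambda>p. \<omega> \<in> lab p))\<^sup>2)"
  proof (rule sdist_labels[OF a])
    fix p q assume pq: "p \<in> supp (path 1) \<union> supp z" "q \<in> supp (path 1) \<union> supp z" "p \<le> q"
    then have "p \<in> L" "q \<in> L" using K_supp(1) zK path_props(1)[of 1] by auto
    then show "lab p \<subseteq> lab q" using label_mono[OF flag_k flag_k'] pq(3) by blast
  qed (use c label_sub in auto)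
  also have "\<dots> = 0"
  proof (intro sum.neutral ballI)
    fix \<omega> :: "nat + nat" assume "\<omega> \<in> Inl ` {1..n} \<union> Inr ` ({1..n'} - J' c)"
    then consider i where "i \<in> {1..n}" "\<omega> = Inl i" | j where "j \<in> {1..n'} - J' c" "\<omega> = Inr j" by blast
    then have "mass (path 1) (\<lambda>p. \<omega> \<in> lab p) = mass z (\<lambda>p. \<omega> \<in> lab p)"
    proof cases
      case (1 i)
      have "mass z (\<lambda>p. \<omega> \<in> lab p) = \<rho> i" unfolding 1 label_def by (intro mass_cong) auto
      moreover have "left_coord 1 i = \<rho> i" if "i \<in> J e" using that unfolding left_coord_def by simp
      ultimately show ?thesis
        using path_coords(1)[of 1 i] left_coord_1[of i] rho_0[of i] mass_nonneg[OF zK, of "\<lambda>p. i \<in> J p"] 1 by (cases "i \<in> J e") auto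
    next
      case (2 j)
      have "mass z (\<lambda>p. \<omega> \<in> lab p) = mass z (\<lambda>p. j \<in> J' p)" unfolding 2 label_def using 2 by (intro mass_cong) auto
      also have "\<dots> = level z j" using mass_jumps_flagged[OF z_flagged] 2 by simp
      finally show ?thesis using path_coords(2)[of 1 j] 2 right_coord_1 level_z_nonneg[of j] by simp
    qed
    then show "(mass (path 1) (\<lambda>p. \<omega> \<in> lab p) - mass z (\<lambda>p. \<omega> \<in> lab p))\<^sup>2 = 0" by simp
  qed
  finally show ?thesis using sdist_eq_0[OF a] by simp
qed

subsection \<open>Speed\<close>

text \<open>The distance between the images of \<open>m\<close> and \<open>z\<close> under the developing map, which turns out to be the
  speed of the path.\<close>

definition reach :: real where
  "reach = L2_set (\<lambda>i. dev z i - dev m i) {0..n}"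

lemma J'c_sub: "J' c \<subseteq> J' q0"
proof -
  have "J' e \<subseteq> J' q0" using e_le_q0 eL q0 by (intro jumps_mono[OF flag_k']) auto
  then show ?thesis using J'_e by simp
qed

lemma slope_common:
  assumes i: "i \<in> {1..n}" "i \<in> J e"
  shows "slope z i = 0"
proof (rule ccontr)
  assume "slope z i \<noteq> 0"
  note sl = slope_in[OF i(1)]
  have "0 < slope z i" using S(2)[OF sl(1)] \<open>slope z i \<noteq> 0\<close> by simp
  then have "J e \<subseteq> J (p (slope z i))" using S(14)[OF sl(1)] eL support_in[OF sl(1)] by (intro jumps_mono[OF flag_k]) auto
  then show False using sl(2) i(2) by blast
qed

text \<open>Both extreme pairs are optimal at \<open>t\<close>, so the objective takes the same value at both.\<close>

lemma block_energy:
  assumes t: "t \<in> \<Lambda>"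
  shows "(\<Sum>j\<in>J' (Q t) - J' (q t). (level z j)\<^sup>2) = t * (\<Sum>i\<in>J (P t) - J (p t). (level m i)\<^sup>2)"
proof -
  have f: "feasible (P t) (q t)" "feasible (p t) (Q t)" using S(3,4)[OF t] unfolding optimal_def by auto
  have eq: "t * (energy m (P t) - energy m (p t)) = energy z (Q t) - energy z (q t)"
    using optimalD[OF S(3)[OF t] f(2)] optimalD[OF S(4)[OF t] f(1)] by (simp add: algebra_simps)
  have sub: "J (p t) \<subseteq> J (P t)" "J' (q t) \<subseteq> J' (Q t)"
    using jumps_mono[OF flag_k support_in(3,1)[OF t] S(5)[OF t]] jumps_mono[OF flag_k' support_in(2,4)[OF t] S(7)[OF t]] by auto
  have "(\<Sum>j\<in>J' (Q t) - J' (q t). (level z j)\<^sup>2) = energy z (Q t) - energy z (q t)"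
    using sub flagged_energy[OF z_flagged] support_in[OF t] by (simp add: sum_diff)
  moreover have "(\<Sum>i\<in>J (P t) - J (p t). (level m i)\<^sup>2) = energy m (P t) - energy m (p t)"
    using sub energy_m support_in[OF t] by (simp add: sum_diff)
  ultimately show ?thesis using eq by simp
qed

lemma reach_squared:
  "reach\<^sup>2 = (\<Sum>i\<in>J e. (\<rho> i - level m i)\<^sup>2) + (\<Sum>i\<in>{1..n} - J e. ((1 + left_slope i) * level m i)\<^sup>2)
      + (\<Sum>j\<in>J' q0 - J' c. (level z j)\<^sup>2)"
proof -
  have "reach\<^sup>2 = (\<Sum>i\<in>{0..n}. (dev z i - dev m i)\<^sup>2)"
    unfolding reach_def L2_set_def by (simp add: sum_nonneg)
  also have "\<dots> = (dev z 0 - dev m 0)\<^sup>2 + (\<Sum>i\<in>{1..n}. (dev z i - dev m i)\<^sup>2)"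
    by (simp add: sum.atLeast_Suc_atMost)
  also have "(dev z 0 - dev m 0)\<^sup>2 = outer z"
  proof -
    have "outer z = energy z q0 - energy z c" by (rule outer_eq[OF z_flagged q0 q0_greatest])
    moreover have "energy z c = energy z e" using energy_meet_top[OF zK cL c'L] flagged_le[OF z_flagged] by simp
    moreover have "energy z e \<le> energy z q0" using energy_mono[OF zK eL(1) q0(1) e_le_q0] .
    ultimately show ?thesis using dev_on_flag(1)[OF m_flagged] unfolding dev_def by simp
  qed
  also have "outer z = (\<Sum>j\<in>J' q0 - J' c. (level z j)\<^sup>2)"
    using outer_eq[OF z_flagged q0 q0_greatest] flagged_energy[OF z_flagged] q0 cL J'c_sub by (simp add: sum_diff)
  also have "(\<Sum>i\<in>{1..n}. (dev z i - dev m i)\<^sup>2) =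
      (\<Sum>i\<in>J e. (\<rho> i - level m i)\<^sup>2) + (\<Sum>i\<in>{1..n} - J e. ((1 + left_slope i) * level m i)\<^sup>2)"
  proof -
    have "(\<Sum>i\<in>{1..n}. (dev z i - dev m i)\<^sup>2) = (\<Sum>i\<in>{1..n} - J e. (dev z i - dev m i)\<^sup>2) + (\<Sum>i\<in>J e. (dev z i - dev m i)\<^sup>2)"
      using jumps_sub by (intro sum.subset_diff) auto
    moreover have "(\<Sum>i\<in>J e. (dev z i - dev m i)\<^sup>2) = (\<Sum>i\<in>J e. (\<rho> i - level m i)\<^sup>2)"
    proof (intro sum.cong refl)
      fix i assume i: "i \<in> J e"
      then have i': "i \<in> {1..n}" using jumps_sub by blast
      then show "(dev z i - dev m i)\<^sup>2 = (\<rho> i - level m i)\<^sup>2"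
        using slope_common[OF i' i] dev_on_flag(2)[OF m_flagged i'] unfolding dev_def by simp
    qed
    moreover have "(\<Sum>i\<in>{1..n} - J e. (dev z i - dev m i)\<^sup>2) = (\<Sum>i\<in>{1..n} - J e. ((1 + left_slope i) * level m i)\<^sup>2)"
    proof (intro sum.cong refl)
      fix i assume i: "i \<in> {1..n} - J e"
      then have "dev z i - dev m i = - ((1 + left_slope i) * level m i)"
        using rho_0[of i] dev_on_flag(2)[OF m_flagged, of i] unfolding dev_def left_slope_def by (simp add: algebra_simps)
      then show "(dev z i - dev m i)\<^sup>2 = ((1 + left_slope i) * level m i)\<^sup>2" by simp
    qed
    ultimately show ?thesis by simp
  qed
  finally show ?thesis by simp
qed

text \<open>If no two generators change their order between \<open>s\<close> and \<open>s'\<close>, then the sets of generators above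
  the thresholds at both times are nested, and so are their joins.\<close>

lemma adjacent_path:
  assumes s: "0 \<le> s" "s \<le> 1" "0 \<le> s'" "s' \<le> 1"
    and order: "\<And>x y. x \<in> gen \<Longrightarrow> y \<in> gen \<Longrightarrow> coeff s y < coeff s x \<Longrightarrow> coeff s' y < coeff s' x"
  shows "adjacent (path s) (path s')"
proof -
  have cmp: "upper s \<theta> \<subseteq> upper s' \<theta>' \<or> upper s' \<theta>' \<subseteq> upper s \<theta>" for \<theta> \<theta>'
  proof (rule ccontr)
    assume "\<not> ?thesis"
    then obtain x y where "x \<in> upper s \<theta>" "x \<notin> upper s' \<theta>'" "y \<in> upper s' \<theta>'" "y \<notin> upper s \<theta>" by blast
    then have "x \<in> gen" "y \<in> gen" "coeff s y < coeff s x" "coeff s' x < coeff s' y"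
      unfolding upper_def by auto
    then show False using order[of x y] by simp
  qed
  have sub: "elt a \<theta> \<le> elt b \<theta>'" if "0 \<le> a" "a \<le> 1" "0 \<le> b" "b \<le> 1" "0 < \<theta>" "0 < \<theta>'" "upper a \<theta> \<subseteq> upper b \<theta>'" for a b \<theta> \<theta>'
    using elt_lub(3)[of a \<theta> "elt b \<theta>'"] elt_lub(1,2)[of b \<theta>'] that by blast
  have "Complete_Partial_Order.chain (\<le>) (elt s ` {0<..1} \<union> elt s' ` {0<..1})"
    unfolding Complete_Partial_Order.chain_def
  proof (intro ballI)
    have same: "elt a \<theta> \<le> elt a \<theta>' \<or> elt a \<theta>' \<le> elt a \<theta>" if "0 \<le> a" "a \<le> 1" "0 < \<theta>" "0 < \<theta>'" for a \<theta> \<theta>'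
      using elt_antimono[of a \<theta> \<theta>'] elt_antimono[of a \<theta>' \<theta>] that by (cases "\<theta> \<le> \<theta>'") auto
    have diff: "elt s \<theta> \<le> elt s' \<theta>' \<or> elt s' \<theta>' \<le> elt s \<theta>" if "0 < \<theta>" "0 < \<theta>'" for \<theta> \<theta>'
      using cmp[of \<theta> \<theta>'] sub[of s s' \<theta> \<theta>'] sub[of s' s \<theta>' \<theta>] s that by blast
    fix x y assume "x \<in> elt s ` {0<..1} \<union> elt s' ` {0<..1}" "y \<in> elt s ` {0<..1} \<union> elt s' ` {0<..1}"
    then obtain a \<theta> b \<theta>' where "x = elt a \<theta>" "a = s \<or> a = s'" "0 < \<theta>" "y = elt b \<theta>'" "b = s \<or> b = s'" "0 < \<theta>'" by auto
    then show "x \<le> y \<or> y \<le> x" using same[of s \<theta> \<theta>'] same[of s' \<theta> \<theta>'] diff[of \<theta> \<theta>'] diff[of \<theta>' \<theta>] s by auto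
  qed
  moreover have "supp (path s) \<union> supp (path s') \<subseteq> elt s ` {0<..1} \<union> elt s' ` {0<..1}"
    using path_props(2)[OF s(1,2)] path_props(2)[OF s(3,4)] by blast
  ultimately have "Complete_Partial_Order.chain (\<le>) (supp (path s) \<union> supp (path s'))"
    by (rule chain_subset)
  then show ?thesis unfolding adjacent_def using path_props(1) s by blast
qed

text \<open>The squared distance is a sum over blocks. Before its breaking time, only the block of \<open>m\<close> moves,
  with speed \<open>1 + sqrt t\<close> times its norm. Afterwards only the block of \<open>z\<close> moves, with speed
  \<open>(1 + sqrt t) / sqrt t\<close> times its norm. The two speeds agree by \<open>block_energy\<close>, so each block
  contributes as much as it does to the square of \<open>reach\<close>.\<close>

lemma sdist_path:
  assumes s: "0 \<le> s" "s \<le> s'" "s' \<le> 1" and a: "adjacent (path s) (path s')"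
    and side: "\<And>t. t \<in> \<Lambda> \<Longrightarrow> s' * (1 + sqrt t) \<le> 1 \<or> 1 \<le> s * (1 + sqrt t)"
  shows "sdist (path s) (path s') = (s' - s) * reach"
proof -
  have s': "0 \<le> s'" "s \<le> 1" using s by auto
  define \<Omega> :: "(nat + nat) set" where "\<Omega> = Inl ` {1..n} \<union> Inr ` ({1..n'} - J' c)"
  have inK: "path s \<in> K" "path s' \<in> K" using path_props(1) s s' by auto
  define f where "f i = (max 0 (left_coord s i) - max 0 (left_coord s' i))\<^sup>2" for i
  define g where "g j = (max 0 (right_coord s j) - max 0 (right_coord s' j))\<^sup>2" for j
  have "(sdist (path s) (path s'))\<^sup>2 = (\<Sum>\<omega>\<in>\<Omega>. (mass (path s) (\<lambda>p. \<omega> \<in> lab p) - mass (path s') (\<lambda>p. \<omega> \<in> lab p))\<^sup>2)"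
  proof (rule sdist_labels[OF a])
    show "finite \<Omega>" unfolding \<Omega>_def by simp
    show "lab x \<subseteq> \<Omega>" for x unfolding \<Omega>_def by (rule label_sub)
    fix x y assume "x \<in> supp (path s) \<union> supp (path s')" "y \<in> supp (path s) \<union> supp (path s')" "x \<le> y"
    moreover from this have "x \<in> L" "y \<in> L" using K_supp(1) inK by blast+
    ultimately show "lab x \<subseteq> lab y" using label_mono[OF flag_k flag_k'] by blast
  next
    fix x assume "x \<in> supp (path s) \<union> supp (path s')"
    then have "x \<in> elt s ` {0<..1} \<union> elt s' ` {0<..1}" using path_props(2) s s' by blast
    then show "card (lab x) = rk x" using label_elt(2) s s' by auto
  qed
  also have "\<dots> = (\<Sum>i\<in>{1..n}. f i) + (\<Sum>j\<in>{1..n'} - J' c. g j)"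
  proof -
    have "(\<Sum>\<omega>\<in>\<Omega>. (mass (path s) (\<lambda>p. \<omega> \<in> lab p) - mass (path s') (\<lambda>p. \<omega> \<in> lab p))\<^sup>2)
       = (\<Sum>\<omega>\<in>Inl ` {1..n}. (mass (path s) (\<lambda>p. \<omega> \<in> lab p) - mass (path s') (\<lambda>p. \<omega> \<in> lab p))\<^sup>2)
       + (\<Sum>\<omega>\<in>Inr ` ({1..n'} - J' c). (mass (path s) (\<lambda>p. \<omega> \<in> lab p) - mass (path s') (\<lambda>p. \<omega> \<in> lab p))\<^sup>2)"
      unfolding \<Omega>_def by (rule sum.union_disjoint) auto
    also have "\<dots> = (\<Sum>i\<in>{1..n}. f i) + (\<Sum>j\<in>{1..n'} - J' c. g j)"
      unfolding f_def g_def using path_coords s s' by (simp add: sum.reindex)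
    finally show ?thesis .
  qed
  also have "(\<Sum>i\<in>{1..n}. f i) = (\<Sum>i\<in>{1..n} - J e. f i) + (\<Sum>i\<in>J e. f i)"
    using jumps_sub by (intro sum.subset_diff) auto
  also have "(\<Sum>i\<in>J e. f i) = (s' - s)\<^sup>2 * (\<Sum>i\<in>J e. (\<rho> i - level m i)\<^sup>2)"
    unfolding sum_distrib_left
  proof (intro sum.cong refl)
    fix i assume i: "i \<in> J e"
    have "0 \<le> left_coord s i" "0 \<le> left_coord s' i"
      unfolding left_coord_def using i s s' level_m_nonneg mass_nonneg[OF zK] by auto
    moreover have "left_coord s i - left_coord s' i = - (s' - s) * (\<rho> i - level m i)"
      unfolding left_coord_def using i by (simp add: algebra_simps)
    ultimately show "f i = (s' - s)\<^sup>2 * (\<rho> i - level m i)\<^sup>2" unfolding f_def by (simp add: power_mult_distrib power2_commute[of s s'])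
  qed
  also have "(\<Sum>j\<in>{1..n'} - J' c. g j) = (\<Sum>j\<in>{1..n'} - J' q0. g j) + (\<Sum>j\<in>J' q0 - J' c. g j)"
  proof -
    have "{1..n'} - J' c - (J' q0 - J' c) = {1..n'} - J' q0" using J'c_sub by blast
    moreover have "J' q0 - J' c \<subseteq> {1..n'} - J' c" using jumps_sub by blast
    ultimately show ?thesis using sum.subset_diff[of "J' q0 - J' c" "{1..n'} - J' c" g] by simp
  qed
  also have "(\<Sum>j\<in>J' q0 - J' c. g j) = (s' - s)\<^sup>2 * (\<Sum>j\<in>J' q0 - J' c. (level z j)\<^sup>2)"
    unfolding sum_distrib_left
  proof (intro sum.cong refl)
    fix j assume j: "j \<in> J' q0 - J' c"
    then have c: "right_coord s j = s * level z j" "right_coord s' j = s' * level z j"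
      unfolding right_coord_def right_slope_def by auto
    then have "0 \<le> right_coord s j" "0 \<le> right_coord s' j" using s s' level_z_nonneg by auto
    moreover have "right_coord s j - right_coord s' j = - (s' - s) * level z j" unfolding c by (simp add: algebra_simps)
    ultimately show "g j = (s' - s)\<^sup>2 * (level z j)\<^sup>2" unfolding g_def by (simp add: power_mult_distrib power2_commute[of s s'])
  qed
  finally have total: "(sdist (path s) (path s'))\<^sup>2 =
      (\<Sum>i\<in>{1..n} - J e. f i) + (s' - s)\<^sup>2 * (\<Sum>i\<in>J e. (\<rho> i - level m i)\<^sup>2) +
      ((\<Sum>j\<in>{1..n'} - J' q0. g j) + (s' - s)\<^sup>2 * (\<Sum>j\<in>J' q0 - J' c. (level z j)\<^sup>2))" .
  have blocks: "(\<Sum>i\<in>{1..n} - J e. f i) + (\<Sum>j\<in>{1..n'} - J' q0. g j) = (s' - s)\<^sup>2 * (\<Sum>i\<in>{1..n} - J e. ((1 + left_slope i) * level m i)\<^sup>2)"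
  proof -
    define A where "A t = (J (P t) - J (p t)) - J e" for t
    define B where "B t = J' (Q t) - J' (q t)" for t
    have Adis: "A t \<inter> A t' = {}" if "t \<in> \<Lambda>" "t' \<in> \<Lambda>" "t \<noteq> t'" for t t'
      using slope_block[OF that(1)] slope_block[OF that(2)] that(3) unfolding A_def by blast
    have UA: "{1..n} - J e = (\<Union>t\<in>\<Lambda>. A t)"
      unfolding A_def using S(11) jumps_sub[of n k] by blast
    have Bq: "B t \<subseteq> {1..n'} - J' q0" if "t \<in> \<Lambda>" for t
      using jumps_mono[OF flag_k' q0(1) support_in(2)[OF that] S(13)[OF that]] jumps_sub[of n' k'] unfolding B_def by blast
    have Bdis: "B t \<inter> B t' = {}" if "t \<in> \<Lambda>" "t' \<in> \<Lambda>" "t \<noteq> t'" for t t'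
      using right_param_eq[OF that(1)] right_param_eq[OF that(2)] Bq[OF that(1)] that(3) unfolding B_def by blast
    have UB: "{1..n'} - J' q0 = (\<Union>t\<in>\<Lambda>. B t)"
    proof
      show "{1..n'} - J' q0 \<subseteq> (\<Union>t\<in>\<Lambda>. B t)" unfolding B_def using S(12) by blast
      show "(\<Union>t\<in>\<Lambda>. B t) \<subseteq> {1..n'} - J' q0" using Bq by blast
    qed
    have fin: "finite (A t)" "finite (B t)" for t unfolding A_def B_def by auto
    have block: "(\<Sum>i\<in>A t. f i) + (\<Sum>j\<in>B t. g j) = (s' - s)\<^sup>2 * (\<Sum>i\<in>A t. ((1 + left_slope i) * level m i)\<^sup>2)"
      if t: "t \<in> \<Lambda>" for t
    proof -
      have t0: "0 \<le> t" using S(2)[OF t] .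
      have A: "left_slope i = sqrt t" "left_coord x i = (1 - x * (1 + sqrt t)) * level m i" if "i \<in> A t" for i x
      proof -
        show "left_slope i = sqrt t" using slope_block[OF t] that unfolding A_def left_slope_def by auto
        then show "left_coord x i = (1 - x * (1 + sqrt t)) * level m i"
          using that unfolding A_def left_coord_def by (simp add: algebra_simps)
      qed
      have fA: "(\<Sum>i\<in>A t. ((1 + left_slope i) * level m i)\<^sup>2) = (1 + sqrt t)\<^sup>2 * (\<Sum>i\<in>A t. (level m i)\<^sup>2)"
        unfolding sum_distrib_left by (intro sum.cong refl) (simp add: A power_mult_distrib)
      show ?thesis
      proof (cases "t = 0")
        case True
        have "B t = {}" using S(15)[OF t True] S(7,8)[OF t] unfolding B_def by auto
        moreover have "f i = (s' - s)\<^sup>2 * ((1 + left_slope i) * level m i)\<^sup>2" if "i \<in> A t" for i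
        proof -
          have c: "left_coord s i = (1 - s) * level m i" "left_coord s' i = (1 - s') * level m i"
            using A(2)[OF that] True by auto
          then have "0 \<le> left_coord s i" "0 \<le> left_coord s' i" using s s' level_m_nonneg by auto
          moreover have "left_coord s i - left_coord s' i = (s' - s) * level m i" unfolding c by (simp add: algebra_simps)
          ultimately show ?thesis unfolding f_def using A(1)[OF that] True by (simp add: power_mult_distrib)
        qed
        ultimately show ?thesis by (simp add: sum_distrib_left)
      next
        case False
        then have tp: "0 < t" "0 < sqrt t" using t0 by auto
        have "J e \<subseteq> J (p t)" using S(14)[OF t tp(1)] eL support_in[OF t] by (intro jumps_mono[OF flag_k]) auto
        then have AE: "A t = J (P t) - J (p t)" unfolding A_def by blast
        have E: "(\<Sum>j\<in>B t. (level z j)\<^sup>2) = t * (\<Sum>i\<in>A t. (level m i)\<^sup>2)" unfolding AE B_def by (rule block_energy[OF t])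
        have B: "right_coord x j = (x * (1 + sqrt t) - 1) / sqrt t * level z j" if "j \<in> B t" for j x
        proof -
          have "right_param j = t" using right_param_eq[OF t] Bq[OF t] that unfolding B_def by blast
          then have "right_slope j = 1 / sqrt t" using Bq[OF t] that unfolding right_slope_def by auto
          moreover have "x - (1 - x) * (1 / y) = (x * (1 + y) - 1) / y" if "0 < y" for y :: real
            using that by (simp add: field_simps)
          ultimately show ?thesis unfolding right_coord_def using tp(2) by simp
        qed
        from side[OF t] show ?thesis
        proof
          assume low: "s' * (1 + sqrt t) \<le> 1"
          have "s * (1 + sqrt t) \<le> s' * (1 + sqrt t)" using s tp by (intro mult_right_mono) auto
          then have low': "s * (1 + sqrt t) \<le> 1" using low by simp
          have "f i = (s' - s)\<^sup>2 * (1 + sqrt t)\<^sup>2 * (level m i)\<^sup>2" if "i \<in> A t" for i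
          proof -
            have "0 \<le> left_coord s i" "0 \<le> left_coord s' i" using A(2)[OF that] low low' level_m_nonneg by auto
            moreover have "left_coord s i - left_coord s' i = (s' - s) * (1 + sqrt t) * level m i"
              unfolding A(2)[OF that] by (simp add: algebra_simps)
            ultimately show ?thesis unfolding f_def by (simp add: power_mult_distrib)
          qed
          moreover have "g j = 0" if "j \<in> B t" for j
          proof -
            have "right_coord s j \<le> 0" "right_coord s' j \<le> 0"
              unfolding B[OF that] using low low' tp level_z_nonneg[of j]
              by (auto intro!: mult_nonpos_nonneg divide_nonpos_pos)
            then show ?thesis unfolding g_def by simp
          qed
          ultimately show ?thesis unfolding fA by (simp add: sum_distrib_left mult.assoc)
        next
          assume high: "1 \<le> s * (1 + sqrt t)"
          have "s * (1 + sqrt t) \<le> s' * (1 + sqrt t)" using s tp by (intro mult_right_mono) auto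
          then have high': "1 \<le> s' * (1 + sqrt t)" using high by simp
          have "f i = 0" if "i \<in> A t" for i
          proof -
            have "left_coord s i \<le> 0" "left_coord s' i \<le> 0"
              unfolding A(2)[OF that] using high high' level_m_nonneg[of i] by (auto intro!: mult_nonpos_nonneg)
            then show ?thesis unfolding f_def by simp
          qed
          moreover have "g j = (s' - s)\<^sup>2 * (1 + sqrt t)\<^sup>2 / t * (level z j)\<^sup>2" if "j \<in> B t" for j
          proof -
            have "0 \<le> right_coord s j" "0 \<le> right_coord s' j" unfolding B[OF that] using high high' tp level_z_nonneg[of j] by auto
            moreover have "right_coord s j - right_coord s' j = - ((s' - s) * (1 + sqrt t) / sqrt t * level z j)"
            proof -
              have "(s * (1 + y) - 1) / y * w - (s' * (1 + y) - 1) / y * w = - ((s' - s) * (1 + y) / y * w)" if "0 < y" for y w :: real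
                using that by (simp add: field_simps)
              then show ?thesis unfolding B[OF that] using tp(2) by blast
            qed
            ultimately show ?thesis unfolding g_def using t0 by (simp add: power_mult_distrib power_divide)
          qed
          then have "(\<Sum>j\<in>B t. g j) = (s' - s)\<^sup>2 * (1 + sqrt t)\<^sup>2 / t * (\<Sum>j\<in>B t. (level z j)\<^sup>2)"
            by (simp add: sum_distrib_left)
          ultimately show ?thesis unfolding fA E using tp by simp
        qed
      qed
    qed
    have "(\<Sum>i\<in>{1..n} - J e. f i) + (\<Sum>j\<in>{1..n'} - J' q0. g j) = (\<Sum>t\<in>\<Lambda>. (\<Sum>i\<in>A t. f i) + (\<Sum>j\<in>B t. g j))"
      unfolding UA UB sum.distrib using S(1) fin Adis Bdis
      by (intro arg_cong2[where f = "(+)"] sum.UNION_disjoint) auto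
    also have "\<dots> = (\<Sum>t\<in>\<Lambda>. (s' - s)\<^sup>2 * (\<Sum>i\<in>A t. ((1 + left_slope i) * level m i)\<^sup>2))"
      by (intro sum.cong refl block)
    also have "\<dots> = (s' - s)\<^sup>2 * (\<Sum>i\<in>{1..n} - J e. ((1 + left_slope i) * level m i)\<^sup>2)"
      unfolding UA sum_distrib_left[symmetric] using S(1) fin Adis
      by (intro arg_cong2[where f = "(*)"] refl sum.UNION_disjoint[symmetric]) auto
    finally show ?thesis .
  qed
  have "(sdist (path s) (path s'))\<^sup>2 = ((s' - s) * reach)\<^sup>2"
    using total blocks unfolding power_mult_distrib reach_squared distrib_left by linarith
  moreover have "0 \<le> (s' - s) * reach" unfolding reach_def using s by simp
  ultimately show ?thesis by (simp add: power2_eq_iff_nonneg sdist_nonneg)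
qed

text \<open>Near every time the order of the coefficients of the generators and the position relative to
  the finitely many breaking times persist.\<close>

lemma path_local:
  assumes s: "0 \<le> s" "s \<le> 1"
  obtains d where "0 < d" "\<And>s'. 0 \<le> s' \<Longrightarrow> s' \<le> 1 \<Longrightarrow> \<bar>s' - s\<bar> < d \<Longrightarrow> adjacent (path s) (path s')"
    "\<And>s'. s \<le> s' \<Longrightarrow> s' \<le> 1 \<Longrightarrow> s' - s < d \<Longrightarrow> sdist (path s) (path s') = (s' - s) * reach"
    "\<And>s'. 0 \<le> s' \<Longrightarrow> s' \<le> s \<Longrightarrow> s - s' < d \<Longrightarrow> sdist (path s') (path s) = (s - s') * reach"
proof -
  have "eventually (\<lambda>s'. \<forall>x\<in>gen. \<forall>y\<in>gen. coeff s y < coeff s x \<longrightarrow> coeff s' y < coeff s' x) (nhds s)"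
  proof (intro eventually_ball_finite finite_gen ballI)
    fix x y assume "x \<in> gen" "y \<in> gen"
    show "eventually (\<lambda>s'. coeff s y < coeff s x \<longrightarrow> coeff s' y < coeff s' x) (nhds s)"
    proof (cases "coeff s y < coeff s x")
      case True
      have "open {s'. coeff s' y < coeff s' x}" unfolding coeff_def by (intro open_Collect_less continuous_intros)
      then have "eventually (\<lambda>s'. s' \<in> {s'. coeff s' y < coeff s' x}) (nhds s)" using True by (intro eventually_nhds_in_open) auto
      then show ?thesis by (rule eventually_mono) auto
    qed simp
  qed
  moreover have "eventually (\<lambda>s'. \<forall>t\<in>\<Lambda>. s * (1 + sqrt t) \<noteq> 1 \<longrightarrow> (s * (1 + sqrt t) < 1 \<longleftrightarrow> s' * (1 + sqrt t) < 1) \<and> s' * (1 + sqrt t) \<noteq> 1) (nhds s)"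
  proof (intro eventually_ball_finite S(1) ballI)
    fix t assume "t \<in> \<Lambda>"
    have o: "open {s'. s' * (1 + sqrt t) < 1}" "open {s'. 1 < s' * (1 + sqrt t)}" by (intro open_Collect_less continuous_intros)+
    show "eventually (\<lambda>s'. s * (1 + sqrt t) \<noteq> 1 \<longrightarrow> (s * (1 + sqrt t) < 1 \<longleftrightarrow> s' * (1 + sqrt t) < 1) \<and> s' * (1 + sqrt t) \<noteq> 1) (nhds s)"
    proof (cases "s * (1 + sqrt t)" "1 :: real" rule: linorder_cases)
      case less
      then have "eventually (\<lambda>s'. s' \<in> {s'. s' * (1 + sqrt t) < 1}) (nhds s)" using o by (intro eventually_nhds_in_open) auto
      then show ?thesis by (rule eventually_mono) (use less in auto)
    next
      case greater
      then have "eventually (\<lambda>s'. s' \<in> {s'. 1 < s' * (1 + sqrt t)}) (nhds s)" using o by (intro eventually_nhds_in_open) auto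
      then show ?thesis by (rule eventually_mono) (use greater in auto)
    qed simp
  qed
  ultimately have "eventually (\<lambda>s'. (\<forall>x\<in>gen. \<forall>y\<in>gen. coeff s y < coeff s x \<longrightarrow> coeff s' y < coeff s' x) \<and>
     (\<forall>t\<in>\<Lambda>. s * (1 + sqrt t) \<noteq> 1 \<longrightarrow> (s * (1 + sqrt t) < 1 \<longleftrightarrow> s' * (1 + sqrt t) < 1) \<and> s' * (1 + sqrt t) \<noteq> 1)) (nhds s)"
    by (rule eventually_conj)
  then obtain d where d: "0 < d" "\<And>s'. dist s' s < d \<Longrightarrow> (\<forall>x\<in>gen. \<forall>y\<in>gen. coeff s y < coeff s x \<longrightarrow> coeff s' y < coeff s' x) \<and>
     (\<forall>t\<in>\<Lambda>. s * (1 + sqrt t) \<noteq> 1 \<longrightarrow> (s * (1 + sqrt t) < 1 \<longleftrightarrow> s' * (1 + sqrt t) < 1) \<and> s' * (1 + sqrt t) \<noteq> 1)"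
    unfolding eventually_nhds_metric by blast
  have adj: "adjacent (path s) (path s')" if "0 \<le> s'" "s' \<le> 1" "\<bar>s' - s\<bar> < d" for s'
    using adjacent_path[OF s that(1,2)] d(2)[of s'] that(3) by (auto simp: dist_real_def)
  have side: "(s' * (1 + sqrt t) \<le> 1 \<and> s * (1 + sqrt t) \<le> 1) \<or> (1 \<le> s * (1 + sqrt t) \<and> 1 \<le> s' * (1 + sqrt t))"
    if "\<bar>s' - s\<bar> < d" "t \<in> \<Lambda>" for s' t
    using d(2)[of s'] that by (cases "s * (1 + sqrt t) = 1") (force simp: dist_real_def)+
  show ?thesis
  proof (rule that[OF d(1) adj])
    fix s' assume s': "s \<le> s'" "s' \<le> 1" "s' - s < d"
    then have "\<bar>s' - s\<bar> < d" by simp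
    then show "sdist (path s) (path s') = (s' - s) * reach"
      using side[of s'] s s' by (intro sdist_path adj) auto
  next
    fix s' assume s': "0 \<le> s'" "s' \<le> s" "s - s' < d"
    then have "\<bar>s' - s\<bar> < d" by simp
    then show "sdist (path s') (path s) = (s - s') * reach"
      using side[of s'] s s' by (intro sdist_path adjacent_sym[OF adj]) auto
  qed auto
qed

text \<open>Near each time the path is a segment of the right length on both sides, so a subdivision by
  bisection turns it into a polygonal path.\<close>

lemma polygonal_path: "polygonal m z reach"
proof -
  define R where "R a b \<longleftrightarrow> (0 \<le> a \<longrightarrow> b \<le> 1 \<longrightarrow> polygonal (path a) (path b) ((b - a) * reach))" for a b
  have "R 0 1"
  proof (induction rule: Bolzano[of 0 1 R, consumes 0])
    show "(0::real) \<le> 1" by simp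
  next
    fix a b c assume R: "R a b" "R b c" and le: "a \<le> b" "b \<le> c"
    show "R a c"
      unfolding R_def
    proof (intro impI)
      assume "0 \<le> a" "c \<le> 1"
      then have "polygonal (path a) (path c) ((b - a) * reach + (c - b) * reach)"
        using R le polygonal_trans unfolding R_def by force
      then show "polygonal (path a) (path c) ((c - a) * reach)" by (simp add: algebra_simps)
    qed
  next
    fix x :: real assume x: "0 \<le> x" "x \<le> 1"
    obtain d where d: "0 < d" "\<And>s'. 0 \<le> s' \<Longrightarrow> s' \<le> 1 \<Longrightarrow> \<bar>s' - x\<bar> < d \<Longrightarrow> adjacent (path x) (path s')"
      "\<And>s'. x \<le> s' \<Longrightarrow> s' \<le> 1 \<Longrightarrow> s' - x < d \<Longrightarrow> sdist (path x) (path s') = (s' - x) * reach"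
      "\<And>s'. 0 \<le> s' \<Longrightarrow> s' \<le> x \<Longrightarrow> x - s' < d \<Longrightarrow> sdist (path s') (path x) = (x - s') * reach"
      by (rule path_local[OF x]) (rule that)
    have "R a b" if ab: "a \<le> x" "x \<le> b" "b - a < d" for a b
      unfolding R_def
    proof (intro impI)
      assume "0 \<le> a" "b \<le> 1"
      then have "adjacent (path a) (path x)" "adjacent (path x) (path b)" "sdist (path a) (path x) = (x - a) * reach"
        "sdist (path x) (path b) = (b - x) * reach"
        using d ab x adjacent_sym by auto
      then have "polygonal (path a) (path b) ((x - a) * reach + (b - x) * reach)"
        using polygonal_adjacent[of "path a" "path x"] polygonal.extend[of "path a" "path x" _ "path b"] by simp
      then show "polygonal (path a) (path b) ((b - a) * reach)" by (simp add: algebra_simps)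
    qed
    then show "\<exists>d>0. \<forall>a b. a \<le> x \<and> x \<le> b \<and> b - a < d \<longrightarrow> R a b" using d(1) by blast
  qed
  then show ?thesis unfolding R_def path_0 path_1 by simp
qed

end

context base_point
begin

lemma polygonal_dev:
  assumes z: "z \<in> K"
  shows "polygonal m z (L2_set (\<lambda>i. dev z i - dev m i) {0..n})"
proof -
  obtain n' k' where fl: "flagged z n' k'" "k' n' \<in> supp z" using ex_flagged[OF adjacent_self[OF z]] by blast
  have c': "k' n' \<in> L" using fl flag_in unfolding flagged_def by auto
  obtain q0 where q0: "q0 \<in> L" "q0 \<le> k' n'" "compat c q0" "\<And>q'. q' \<in> L \<Longrightarrow> q' \<le> k' n' \<Longrightarrow> compat c q' \<Longrightarrow> q' \<le> q0"
    using ex_outer[OF c'] by blast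
  obtain \<Lambda> P p Q q where sup: "is_support z n' k' q0 \<Lambda> P p Q q" using support_exists[OF fl q0] by blast
  interpret support_path L r m n k z n' k' q0 \<Lambda> P p Q q
    by unfold_locales (use fl q0 sup in auto)
  show ?thesis using polygonal_path unfolding reach_def .
qed

end

section \<open>The CAT(0) inequality\<close>

text \<open>Equality in the triangle inequality forces the vectors to be parallel. Squaring the equality gives
  the inner product of the vectors, from which the differences of both sides have norm zero.\<close>

lemma L2_set_triangle_eq:
  fixes u v :: "'a \<Rightarrow> real"
  assumes "finite I" "L2_set (\<lambda>i. u i + v i) I = L2_set u I + L2_set v I" "i \<in> I"
  shows "L2_set u I * v i = L2_set v I * u i"
proof -
  define a where "a = L2_set u I"
  define b where "b = L2_set v I"
  have sq: "(\<Sum>i\<in>I. (u i)\<^sup>2) = a\<^sup>2" "(\<Sum>i\<in>I. (v i)\<^sup>2) = b\<^sup>2" "(\<Sum>i\<in>I. (u i + v i)\<^sup>2) = (a + b)\<^sup>2"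
  proof -
    have L: "(\<Sum>i\<in>I. (f i)\<^sup>2) = (L2_set f I)\<^sup>2" for f :: "'a \<Rightarrow> real"
      unfolding L2_set_def by (simp add: sum_nonneg)
    show "(\<Sum>i\<in>I. (u i)\<^sup>2) = a\<^sup>2" "(\<Sum>i\<in>I. (v i)\<^sup>2) = b\<^sup>2" "(\<Sum>i\<in>I. (u i + v i)\<^sup>2) = (a + b)\<^sup>2"
      unfolding L a_def b_def assms(2) by (rule refl)+
  qed
  have "(\<Sum>i\<in>I. (u i + v i)\<^sup>2) = (\<Sum>i\<in>I. (u i)\<^sup>2) + (\<Sum>i\<in>I. (v i)\<^sup>2) + 2 * (\<Sum>i\<in>I. u i * v i)"
    by (simp add: power2_sum sum.distrib sum_distrib_left algebra_simps)
  then have uv: "(\<Sum>i\<in>I. u i * v i) = a * b" using sq by (simp add: power2_sum)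
  have "(\<Sum>i\<in>I. (a * v i - b * u i)\<^sup>2) = a\<^sup>2 * (\<Sum>i\<in>I. (v i)\<^sup>2) + b\<^sup>2 * (\<Sum>i\<in>I. (u i)\<^sup>2) - 2 * a * b * (\<Sum>i\<in>I. u i * v i)"
    by (simp add: power2_diff power_mult_distrib sum.distrib sum_subtractf sum_distrib_left algebra_simps)
  also have "\<dots> = 0" unfolding sq uv by (simp add: power2_eq_square)
  finally have "(\<Sum>i\<in>I. (a * v i - b * u i)\<^sup>2) = 0" .
  then have "(a * v i - b * u i)\<^sup>2 = 0" using assms(1,3) by (subst (asm) sum_nonneg_eq_0_iff) auto
  then show ?thesis by (simp add: a_def b_def)
qed

lemma L2_set_commute: "L2_set (\<lambda>i. f i - g i) I = L2_set (\<lambda>i. g i - f i) I"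
  unfolding L2_set_def by (simp add: power2_commute)

context base_point
begin

lemma dev_polygonal: "polygonal x y l \<Longrightarrow> L2_set (\<lambda>i. dev x i - dev y i) {0..n} \<le> l"
proof (induction rule: polygonal.induct)
  case (extend x y l z)
  then show ?case
    using dev_lipschitz[OF extend.hyps(2)] L2_set_triangle_ineq[of "\<lambda>i. dev x i - dev y i" "\<lambda>i. dev y i - dev z i" "{0..n}"]
    by simp
qed (simp add: L2_set_def)

lemma dev_isometric:
  assumes "x \<in> K" "y \<in> K" "supp x \<subseteq> supp m" "supp y \<subseteq> supp m"
  shows "L2_set (\<lambda>i. dev x i - dev y i) {0..n} = sdist x y"
proof -
  have f: "flagged x n k" "flagged y n k" using assms m_flagged unfolding flagged_def by auto
  have "(\<Sum>i\<in>{0..n}. (dev x i - dev y i)\<^sup>2) = (\<Sum>i\<in>{1..n}. (level x i - level y i)\<^sup>2)"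
    using dev_on_flag[OF f(1)] dev_on_flag[OF f(2)] by (simp add: sum.atLeast_Suc_atMost)
  then show ?thesis using sdist_flagged[OF f] by (simp add: L2_set_def sdist_nonneg real_sqrt_unique)
qed

end

context modular_semilattice_finite_rank
begin

abbreviation d :: "('a \<Rightarrow> real) \<Rightarrow> ('a \<Rightarrow> real) \<Rightarrow> real" where
  "d \<equiv> orthoscheme_dist L r"

lemma polygonal_in: "polygonal x y l \<Longrightarrow> x \<in> K \<and> y \<in> K"
  by (induction rule: polygonal.induct) (auto simp: adjacent_def)

lemma polygonal_nonneg: "polygonal x y l \<Longrightarrow> 0 \<le> l"
  by (induction rule: polygonal.induct) (auto simp: sdist_nonneg)

lemma polygonal_zero: "polygonal x y l \<Longrightarrow> l = 0 \<Longrightarrow> x = y"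
proof (induction rule: polygonal.induct)
  case (extend x y l z)
  then have "l = 0" "sdist y z = 0" using polygonal_nonneg[OF extend.hyps(1)] sdist_nonneg[of y z] by linarith+
  then show ?case using extend sdist_eq_0 by blast
qed simp

lemma polygonal_sym: "polygonal x y l \<Longrightarrow> polygonal y x l"
proof (induction rule: polygonal.induct)
  case (extend x y l z)
  then show ?case
    using polygonal_trans[OF extend.IH polygonal_adjacent[OF adjacent_sym[OF extend.hyps(2)]]] sdist_sym[OF extend.hyps(2)]
    by (simp add: add.commute)
qed (simp add: polygonal.stay)

lemma polygonal_iff_path:
  assumes "x \<in> K"
  shows "polygonal x y l \<longleftrightarrow> (\<exists>(k::nat) C z. l = (\<Sum>i<k. simplex_dist r (C i) (z i) (z (Suc i))) \<and> z 0 = x \<and> z k = y \<and>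
     (\<forall>i<k. C i \<in> finite_chains L \<and> z i \<in> chain_simplex L (C i) \<and> z (Suc i) \<in> chain_simplex L (C i)))"
    (is "_ \<longleftrightarrow> ?R x y l")
proof
  show "polygonal x y l \<Longrightarrow> ?R x y l"
  proof (induction rule: polygonal.induct)
    case (stay x)
    show ?case by (rule exI[of _ 0], rule exI[of _ "\<lambda>_. {}"], rule exI[of _ "\<lambda>_. x"]) simp
  next
    case (extend x y l w)
    from extend.IH obtain k :: nat and C z where z: "l = (\<Sum>i<k. simplex_dist r (C i) (z i) (z (Suc i)))" "z 0 = x" "z k = y"
      "\<forall>i<k. C i \<in> finite_chains L \<and> z i \<in> chain_simplex L (C i) \<and> z (Suc i) \<in> chain_simplex L (C i)" by blast
    obtain D where D: "D \<in> finite_chains L" "y \<in> chain_simplex L D" "w \<in> chain_simplex L D"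
      using extend.hyps(2) unfolding adjacent_iff by blast
    define C' where "C' = C(k := D)"
    define z' where "z' = z(Suc k := w)"
    have "l + sdist y w = (\<Sum>i<Suc k. simplex_dist r (C' i) (z' i) (z' (Suc i)))"
      using z(1,3) simplex_dist_eq_sdist[OF D] unfolding C'_def z'_def by simp
    moreover have "z' 0 = x" "z' (Suc k) = w" using z(2) unfolding z'_def by auto
    moreover have "\<forall>i<Suc k. C' i \<in> finite_chains L \<and> z' i \<in> chain_simplex L (C' i) \<and> z' (Suc i) \<in> chain_simplex L (C' i)"
      using z(3,4) D unfolding C'_def z'_def by (auto simp: less_Suc_eq)
    ultimately show ?case by blast
  qed
next
  assume "?R x y l"
  then obtain k :: nat and C z where z: "l = (\<Sum>i<k. simplex_dist r (C i) (z i) (z (Suc i)))" "z 0 = x" "z k = y"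
      "\<forall>i<k. C i \<in> finite_chains L \<and> z i \<in> chain_simplex L (C i) \<and> z (Suc i) \<in> chain_simplex L (C i)" by blast
  have "polygonal x (z j) (\<Sum>i<j. simplex_dist r (C i) (z i) (z (Suc i)))" if "j \<le> k" for j
    using that
  proof (induction j)
    case 0
    then show ?case using z(2) polygonal.stay[OF assms] by simp
  next
    case (Suc j)
    then have j: "C j \<in> finite_chains L" "z j \<in> chain_simplex L (C j)" "z (Suc j) \<in> chain_simplex L (C j)" using z(4) by auto
    then have "adjacent (z j) (z (Suc j))" unfolding adjacent_iff by blast
    then show ?case using polygonal.extend[OF Suc.IH] Suc.prems simplex_dist_eq_sdist[OF j] by simp
  qed
  then show "polygonal x y l" using z by blast
qed

lemma d_Inf: "x \<in> K \<Longrightarrow> y \<in> K \<Longrightarrow> d x y = Inf {l. polygonal x y l}"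
  unfolding orthoscheme_dist_def polygonal_iff_path[of x y] by simp

lemma ex_base_point:
  assumes "x \<in> K"
  obtains n k where "base_point L r x n k"
proof -
  obtain n k where "flagged x n k" "k n \<in> supp x" using ex_flagged[OF adjacent_self[OF assms]] by blast
  then have "base_point L r x n k" by unfold_locales
  then show ?thesis using that by blast
qed

lemma d_le: "polygonal x y l \<Longrightarrow> d x y \<le> l"
  using d_Inf[of x y] polygonal_in[of x y l] polygonal_nonneg[of x y] by (auto intro!: cInf_lower bdd_belowI)

text \<open>The images of polygonal paths are not longer than the paths, which bounds all distances from
  below; the path from \<open>x\<close> to \<open>y\<close> constructed from a support attains the bound.\<close>

lemma developing:
  assumes x: "x \<in> K"
  obtains F :: "('a \<Rightarrow> real) \<Rightarrow> nat \<Rightarrow> real" and n :: nat where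
    "\<And>y z. y \<in> K \<Longrightarrow> z \<in> K \<Longrightarrow> L2_set (\<lambda>i. F y i - F z i) {0..n} \<le> d y z"
    "\<And>y. y \<in> K \<Longrightarrow> L2_set (\<lambda>i. F y i - F x i) {0..n} = d x y"
    "\<And>y. y \<in> K \<Longrightarrow> polygonal x y (d x y)"
    "\<And>y z. y \<in> K \<Longrightarrow> z \<in> K \<Longrightarrow> supp y \<subseteq> supp x \<Longrightarrow> supp z \<subseteq> supp x \<Longrightarrow> L2_set (\<lambda>i. F y i - F z i) {0..n} = sdist y z"
proof -
  obtain n k where "base_point L r x n k" using ex_base_point[OF x] by blast
  then interpret base_point L r x n k .
  have ne: "\<exists>l. polygonal y z l" if "y \<in> K" "z \<in> K" for y z
    using polygonal_trans[OF polygonal_dev[OF that(2)] polygonal_sym[OF polygonal_dev[OF that(1)]]] by blast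
  have lower: "L2_set (\<lambda>i. dev y i - dev z i) {0..n} \<le> d y z" if "y \<in> K" "z \<in> K" for y z
    unfolding d_Inf[OF that] using ne[OF that] dev_polygonal by (intro cInf_greatest) auto
  have eq: "L2_set (\<lambda>i. dev y i - dev x i) {0..n} = d x y" if "y \<in> K" for y
    using lower[OF x that] d_le[OF polygonal_dev[OF that]] L2_set_commute[of "dev x" "dev y"] by simp
  show ?thesis
    by (rule that[of dev n]) (use lower eq polygonal_dev dev_isometric in auto)
qed

lemma polygonal_d: "x \<in> K \<Longrightarrow> y \<in> K \<Longrightarrow> polygonal x y (d x y)"
  by (rule developing[of x]) auto

text \<open>A shorter detour is excluded by developing at the midpoint: its support contains those of both ends, so
  that the developing map is isometric on the segment.\<close>

lemma d_sdist:
  assumes a: "adjacent x y"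
  shows "d x y = sdist x y"
proof -
  have xy: "x \<in> K" "y \<in> K" using a unfolding adjacent_def by auto
  define m where "m = seg x y (1/2)"
  have m: "m \<in> K" "supp m = supp x \<union> supp y" unfolding m_def using seg_K[OF a] supp_seg[OF xy, of "1/2"] by auto
  obtain F :: "('a \<Rightarrow> real) \<Rightarrow> nat \<Rightarrow> real" and n :: nat where F:
    "\<And>y z. y \<in> K \<Longrightarrow> z \<in> K \<Longrightarrow> L2_set (\<lambda>i. F y i - F z i) {0..n} \<le> d y z"
    "\<And>y. y \<in> K \<Longrightarrow> L2_set (\<lambda>i. F y i - F m i) {0..n} = d m y"
    "\<And>y. y \<in> K \<Longrightarrow> polygonal m y (d m y)"
    "\<And>y z. y \<in> K \<Longrightarrow> z \<in> K \<Longrightarrow> supp y \<subseteq> supp m \<Longrightarrow> supp z \<subseteq> supp m \<Longrightarrow> L2_set (\<lambda>i. F y i - F z i) {0..n} = sdist y z"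
    by (rule developing[OF m(1)]) (rule that)
  have "sdist x y \<le> d x y" using F(1)[OF xy] F(4)[OF xy] m(2) by simp
  then show ?thesis using d_le[OF polygonal_adjacent[OF a]] by simp
qed

lemma d_triangle: "x \<in> K \<Longrightarrow> y \<in> K \<Longrightarrow> z \<in> K \<Longrightarrow> d x z \<le> d x y + d y z"
  using d_le[OF polygonal_trans[OF polygonal_d polygonal_d]] by blast

lemma d_sym: "d x y = d y x"
proof (cases "x \<in> K \<and> y \<in> K")
  case True
  then show ?thesis using d_le[OF polygonal_sym[OF polygonal_d]] by (intro order_antisym) auto
qed (auto simp: orthoscheme_dist_def)

lemma d_nonneg: "0 \<le> d x y"
proof (cases "x \<in> K \<and> y \<in> K")
  case True
  then show ?thesis using polygonal_nonneg[OF polygonal_d] by blast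
qed (auto simp: orthoscheme_dist_def)

lemma d_self: "x \<in> K \<Longrightarrow> d x x = 0"
  using d_le[OF polygonal.stay] d_nonneg[of x x] by force

lemma d_zero: "x \<in> K \<Longrightarrow> y \<in> K \<Longrightarrow> d x y = 0 \<Longrightarrow> x = y"
  using polygonal_zero[OF polygonal_d] by blast

text \<open>A geodesic is straight near an interior point \<open>p\<close> of one of its segments. Developing at \<open>p\<close>
  preserves its length on both sides of \<open>p\<close>, so its image is a straight segment, and the Euclidean
  identity for this segment becomes the required inequality.\<close>

lemma cat0_generic:
  assumes K: "x \<in> K" "y \<in> K" "z \<in> K" and a: "adjacent a b" "a \<noteq> b" and s: "0 < s" "s < 1"
    and len: "d x y = d x a + d a b + d b y"
    and u: "u = d x a + s * d a b"
  shows "d x y * (d z (seg a b s))\<^sup>2 \<le> (d x y - u) * (d z x)\<^sup>2 + u * (d z y)\<^sup>2 - u * (d x y - u) * d x y"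
proof -
  define p where "p = seg a b s"
  have ab: "a \<in> K" "b \<in> K" using a unfolding adjacent_def by auto
  have p: "p \<in> K" "supp p = supp a \<union> supp b" unfolding p_def using seg_K[OF a(1)] supp_seg[OF ab s] s by auto
  define l where "l = d a b"
  have l: "0 < l" using d_nonneg[of a b] d_zero[OF ab] a(2) unfolding l_def by force
  have ap: "adjacent a p" "adjacent p b"
    unfolding p_def using adjacent_seg[OF a(1), of 0 s] adjacent_seg[OF a(1), of s 1] s by auto
  have dap: "d a p = s * l" "d p b = (1 - s) * l"
  proof -
    have "sdist a p = s * sdist a b" "sdist p b = (1 - s) * sdist a b"
      using sdist_seg[OF a(1), of 0 s] sdist_seg[OF a(1), of s 1] s unfolding p_def by auto
    then show "d a p = s * l" "d p b = (1 - s) * l"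
      unfolding l_def using d_sdist[OF ap(1)] d_sdist[OF ap(2)] d_sdist[OF a(1)] by auto
  qed
  obtain F :: "('a \<Rightarrow> real) \<Rightarrow> nat \<Rightarrow> real" and n :: nat where
    F:
    "\<And>y z. y \<in> K \<Longrightarrow> z \<in> K \<Longrightarrow> L2_set (\<lambda>i. F y i - F z i) {0..n} \<le> d y z"
    "\<And>y. y \<in> K \<Longrightarrow> L2_set (\<lambda>i. F y i - F p i) {0..n} = d p y"
    "\<And>y. y \<in> K \<Longrightarrow> polygonal p y (d p y)"
    "\<And>y z. y \<in> K \<Longrightarrow> z \<in> K \<Longrightarrow> supp y \<subseteq> supp p \<Longrightarrow> supp z \<subseteq> supp p \<Longrightarrow> L2_set (\<lambda>i. F y i - F z i) {0..n} = sdist y z"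
    by (rule developing[OF p(1)]) (rule that)
  define I where "I = {0..n}"
  define N where "N x y = L2_set (\<lambda>i. F x i - F y i) I" for x y
  have Ntri: "N x z \<le> N x y + N y z" for x y z
    using L2_set_triangle_ineq[of "\<lambda>i. F x i - F y i" "\<lambda>i. F y i - F z i" I] unfolding N_def by simp
  have Nle: "N y z \<le> d y z" if "y \<in> K" "z \<in> K" for y z using F(1)[OF that] unfolding N_def I_def .
  have Np: "N y p = d y p" if "y \<in> K" for y using F(2)[OF that] d_sym unfolding N_def I_def by simp
  have Np': "N p y = d p y" if "y \<in> K" for y using F(2)[OF that] L2_set_commute[of "F p" "F y"] unfolding N_def I_def by simp
  have Nab: "N a b = l" using F(4)[OF ab] p(2) d_sdist[OF a(1)] unfolding N_def I_def l_def by simp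
  have dxp: "d x p = d x a + s * l"
  proof (rule order_antisym)
    show "d x p \<le> d x a + s * l" using d_triangle[OF K(1) ab(1) p(1)] dap by simp
    have "d x y \<le> d x p + (d p b + d b y)"
      using d_triangle[OF K(1) p(1) K(2)] d_triangle[OF p(1) ab(2) K(2)] by simp
    then show "d x a + s * l \<le> d x p" using len dap unfolding l_def[symmetric] by (simp add: algebra_simps)
  qed
  have dpy: "d p y = (1 - s) * l + d b y"
  proof (rule order_antisym)
    show "d p y \<le> (1 - s) * l + d b y" using d_triangle[OF p(1) ab(2) K(2)] dap by simp
    have "d x y \<le> d x p + d p y" using d_triangle[OF K(1) p(1) K(2)] .
    then show "(1 - s) * l + d b y \<le> d p y" using len dxp unfolding l_def[symmetric] by (simp add: algebra_simps)
  qed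
  have n1: "N x a = d x a" "N x p = N x a + N a p"
    using Ntri[of x p a] Nle[OF K(1) ab(1)] Np[OF K(1)] Np[OF ab(1)] dxp dap by auto
  have n2: "N b y = d b y" "N p y = N p b + N b y"
    using Ntri[of p y b] Nle[OF ab(2) K(2)] Np'[OF K(2)] Np'[OF ab(2)] dpy dap by auto
  have n3: "N a b = N a p + N p b" using Nab Np[OF ab(1)] Np'[OF ab(2)] dap by (simp add: algebra_simps)
  \<comment> \<open>The images of \<open>x\<close>, \<open>a\<close>, \<open>p\<close>, \<open>b\<close>, \<open>y\<close> satisfy the triangle inequality with equality, so the
    consecutive differences are parallel.\<close>
  have lin: "N x a * (F a i - F p i) = N a p * (F x i - F a i)" "N p b * (F b i - F y i) = N b y * (F p i - F b i)"
      "N a p * (F p i - F b i) = N p b * (F a i - F p i)" if "i \<in> I" for i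
    using L2_set_triangle_eq[of I "\<lambda>i. F x i - F a i" "\<lambda>i. F a i - F p i" i]
      L2_set_triangle_eq[of I "\<lambda>i. F p i - F b i" "\<lambda>i. F b i - F y i" i]
      L2_set_triangle_eq[of I "\<lambda>i. F a i - F p i" "\<lambda>i. F p i - F b i" i] n1(2) n2(2) n3 that
    unfolding N_def I_def by auto
  define D where "D = d x y"
  have D: "D = d x a + l + d b y" using len unfolding D_def l_def by simp
  define w where "w i = (F a i - F b i) / l" for i
  have pos: "F x i - F p i = u * w i" "F p i - F y i = (D - u) * w i" if i: "i \<in> I" for i
  proof -
    have "s * l * (F p i - F b i) = (1 - s) * l * (F a i - F p i)"
      using lin(3)[OF i] Np[OF ab(1)] Np'[OF ab(2)] dap by simp
    then have "l * (s * (F p i - F b i)) = l * ((1 - s) * (F a i - F p i))" by (metis mult.left_commute mult.assoc)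
    then have 0: "s * (F p i - F b i) = (1 - s) * (F a i - F p i)" using l by simp
    have 1: "F a i - F p i = s * l * w i" "F p i - F b i = (1 - s) * l * w i"
    proof -
      have lw: "l * w i = F a i - F b i" using l by (simp add: w_def)
      have "F a i - F p i = s * (F a i - F b i)" "F p i - F b i = (1 - s) * (F a i - F b i)"
        using 0 by (simp_all add: algebra_simps)
      then show "F a i - F p i = s * l * w i" "F p i - F b i = (1 - s) * l * w i"
        by (simp_all only: mult.assoc lw)
    qed
    have "d x a * (s * l * w i) = s * l * (F x i - F a i)"
      using lin(1)[OF i] n1(1) Np[OF ab(1)] dap 1 by simp
    then have "(s * l) * (F x i - F a i) = (s * l) * (d x a * w i)" by (metis mult.left_commute)
    then have 2: "F x i - F a i = d x a * w i" using s l by simp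
    have "(1 - s) * l * (F b i - F y i) = d b y * ((1 - s) * l * w i)"
      using lin(2)[OF i] n2(1) Np'[OF ab(2)] dap 1 by simp
    then have "((1 - s) * l) * (F b i - F y i) = ((1 - s) * l) * (d b y * w i)" by (metis mult.left_commute)
    then have 3: "F b i - F y i = d b y * w i" using s l by simp
    show "F x i - F p i = u * w i" using 1 2 unfolding u l_def[symmetric] by (simp add: algebra_simps)
    show "F p i - F y i = (D - u) * w i" using 1 3 unfolding u D l_def[symmetric] by (simp add: algebra_simps)
  qed
  have Dpos: "0 < D" "0 \<le> u" "0 \<le> D - u"
  proof -
    have "0 \<le> s * l" "s * l \<le> l" using s l by (auto simp: mult_le_cancel_right1)
    moreover have "u = d x a + s * l" unfolding u l_def ..
    ultimately show "0 < D" "0 \<le> u" "0 \<le> D - u" using D l d_nonneg[of x a] d_nonneg[of b y] by linarith+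
  qed
  have sumw: "(\<Sum>i\<in>I. (w i)\<^sup>2) = 1"
  proof -
    have "(\<Sum>i\<in>I. (F a i - F b i)\<^sup>2) = (N a b)\<^sup>2" unfolding N_def L2_set_def by (simp add: sum_nonneg)
    then have "(\<Sum>i\<in>I. (F a i - F b i)\<^sup>2) = l\<^sup>2" using Nab by simp
    then show ?thesis unfolding w_def power_divide sum_divide_distrib[symmetric] using l by simp
  qed
  have Nsq: "(N x y)\<^sup>2 = (\<Sum>i\<in>I. (F x i - F y i)\<^sup>2)" for x y
    unfolding N_def L2_set_def by (simp add: sum_nonneg)
  \<comment> \<open>The coordinates of the theorem of Stewart for the image of \<open>z\<close> and the straight segment.\<close>
  have coord: "D * (F z i - F p i)\<^sup>2 = (D - u) * (F z i - F x i)\<^sup>2 + u * (F z i - F y i)\<^sup>2 - u * (D - u) * D * (w i)\<^sup>2"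
    if i: "i \<in> I" for i
  proof -
    have "F x i = F p i + u * w i" "F y i = F p i - (D - u) * w i" using pos[OF i] by auto
    then show ?thesis by (simp only:) (simp add: power2_eq_square algebra_simps)
  qed
  have "D * (d z p)\<^sup>2 = (\<Sum>i\<in>I. D * (F z i - F p i)\<^sup>2)"
    using Nsq[of z p] Np[OF K(3)] by (simp add: sum_distrib_left)
  also have "\<dots> = (\<Sum>i\<in>I. (D - u) * (F z i - F x i)\<^sup>2 + u * (F z i - F y i)\<^sup>2 - u * (D - u) * D * (w i)\<^sup>2)"
    by (intro sum.cong refl coord)
  also have "\<dots> = (D - u) * (N z x)\<^sup>2 + u * (N z y)\<^sup>2 - u * (D - u) * D * 1"
    unfolding Nsq sumw[symmetric] by (simp only: sum.distrib sum_subtractf sum_distrib_left)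
  also have "\<dots> \<le> (D - u) * (d z x)\<^sup>2 + u * (d z y)\<^sup>2 - u * (D - u) * D * 1"
  proof -
    have "0 \<le> N z x" "0 \<le> N z y" unfolding N_def by auto
    then have "(N z x)\<^sup>2 \<le> (d z x)\<^sup>2" "(N z y)\<^sup>2 \<le> (d z y)\<^sup>2"
      using Nle[OF K(3,1)] Nle[OF K(3,2)] by (auto intro: power_mono)
    then show ?thesis using Dpos by (intro diff_right_mono add_mono mult_left_mono) auto
  qed
  finally show ?thesis unfolding D_def p_def by simp
qed

text \<open>The hypotheses of \<open>cat0_generic\<close> on the point \<open>p\<close> at the distance \<open>u\<close> from \<open>x\<close>.\<close>

definition straight_at :: "('a \<Rightarrow> real) \<Rightarrow> ('a \<Rightarrow> real) \<Rightarrow> real \<Rightarrow> ('a \<Rightarrow> real) \<Rightarrow> bool" where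
  "straight_at x y u p \<longleftrightarrow> (\<exists>a b s. adjacent a b \<and> a \<noteq> b \<and> 0 < s \<and> s < 1 \<and> p = seg a b s \<and>
     d x y = d x a + d a b + d b y \<and> u = d x a + s * d a b)"

text \<open>In a polygonal path whose length is the distance of its ends, all triangle inequalities are equalities,
  so parametrising its segments by length gives a geodesic. The exceptions in \<open>E\<close> are the vertices.\<close>

lemma ex_unit_speed:
  assumes "polygonal x y l" "d x y = l"
  shows "\<exists>h E. h 0 = x \<and> h l = y \<and> (\<forall>u\<in>{0..l}. h u \<in> K) \<and> (\<forall>u\<in>{0..l}. \<forall>v\<in>{0..l}. d (h u) (h v) = \<bar>u - v\<bar>) \<and>
    finite E \<and> (\<forall>u\<in>{0..l} - E. straight_at x y u (h u))"
  using assms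
proof (induction rule: polygonal.induct)
  case (stay x)
  show ?case by (rule exI[of _ "\<lambda>_. x"], rule exI[of _ "{0}"]) (use stay d_self in auto)
next
  case (extend x y l z)
  have K: "x \<in> K" "y \<in> K" "z \<in> K" using polygonal_in[OF extend.hyps(1)] extend.hyps(2) unfolding adjacent_def by auto
  define \<sigma> where "\<sigma> = sdist y z"
  have dyz: "d y z = \<sigma>" unfolding \<sigma>_def by (rule d_sdist[OF extend.hyps(2)])
  have dxz: "d x z = l + \<sigma>" using extend.prems unfolding \<sigma>_def .
  have dxy: "d x y = l" using d_triangle[OF K] d_le[OF extend.hyps(1)] dxz dyz by simp
  have l0: "0 \<le> l" "0 \<le> \<sigma>" using d_nonneg[of x y] d_nonneg[of y z] dxy dyz by auto
  obtain h E where h: "h 0 = x" "h l = y" "\<And>u. u \<in> {0..l} \<Longrightarrow> h u \<in> K"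
    "\<And>u v. u \<in> {0..l} \<Longrightarrow> v \<in> {0..l} \<Longrightarrow> d (h u) (h v) = \<bar>u - v\<bar>" "finite E"
    "\<And>u. u \<in> {0..l} - E \<Longrightarrow> straight_at x y u (h u)"
    using extend.IH[OF dxy] by blast
  show ?case
  proof (cases "\<sigma> = 0")
    case True
    then have "y = z" using d_zero[OF K(2,3)] dyz by simp
    have "l + sdist y z = l" using True unfolding \<sigma>_def by simp
    then show ?thesis using h \<open>y = z\<close> by metis
  next
    case False
    then have \<sigma>: "0 < \<sigma>" using l0 by simp
    have yz: "y \<noteq> z" using False dyz d_self K by auto
    define h' where "h' u = (if u \<le> l then h u else seg y z ((u - l) / \<sigma>))" for u
    define g where "g v = seg y z ((v - l) / \<sigma>)" for v
    have par: "0 \<le> (v - l) / \<sigma>" "(v - l) / \<sigma> \<le> 1" if "v \<in> {l..l + \<sigma>}" for v using that \<sigma> by (auto simp: divide_le_eq)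
    have g: "g v \<in> K" if "v \<in> {l..l + \<sigma>}" for v unfolding g_def using seg_K[OF extend.hyps(2) par[OF that]] .
    have dg: "d (g v) (g w) = \<bar>v - w\<bar>" if "v \<in> {l..l + \<sigma>}" "w \<in> {l..l + \<sigma>}" for v w
    proof -
      have "d (g v) (g w) = \<bar>(v - l) / \<sigma> - (w - l) / \<sigma>\<bar> * \<sigma>"
        unfolding g_def \<sigma>_def[symmetric] using d_sdist[OF adjacent_seg[OF extend.hyps(2) par[OF that(1)] par[OF that(2)]]]
          sdist_seg[OF extend.hyps(2) par[OF that(1)] par[OF that(2)]] by (simp add: \<sigma>_def)
      also have "(v - l) / \<sigma> - (w - l) / \<sigma> = (v - w) / \<sigma>" by (simp add: diff_divide_distrib)
      finally show ?thesis using \<sigma> by simp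
    qed
    have gl: "g l = y" "g (l + \<sigma>) = z" unfolding g_def using \<sigma> by auto
    have mixed: "d (h u) (g v) = v - u" if "u \<in> {0..l}" "v \<in> {l..l + \<sigma>}" for u v
    proof (rule order_antisym)
      have "d (h u) (g v) \<le> d (h u) y + d y (g v)" using d_triangle[OF h(3)[OF that(1)] K(2) g[OF that(2)]] .
      also have "d (h u) y = l - u" using h(4)[OF that(1), of l] h(2) that l0 by simp
      also have "d y (g v) = v - l" using dg[of l v] that gl l0 by simp
      finally show "d (h u) (g v) \<le> v - u" by simp
      have "d x z \<le> d x (h u) + (d (h u) (g v) + d (g v) z)"
        using d_triangle[OF K(1) h(3)[OF that(1)] K(3)] d_triangle[OF h(3)[OF that(1)] g[OF that(2)] K(3)] by simp
      moreover have "d x (h u) = u" using h(4)[of 0 u] h(1) that by simp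
      moreover have "d (g v) z = l + \<sigma> - v" using dg[of v "l + \<sigma>"] that gl l0 by simp
      ultimately show "v - u \<le> d (h u) (g v)" using dxz by simp
    qed
    have h'g: "h' v = g v" if "v \<in> {l..l + \<sigma>}" for v
      using that h(2) gl unfolding h'_def g_def by (cases "v = l") auto
    have h'h: "h' v = h v" if "v \<in> {0..l}" for v using that unfolding h'_def by auto
    have split: "v \<in> {0..l} \<or> v \<in> {l..l + \<sigma>}" if "v \<in> {0..l + \<sigma>}" for v using that by auto
    have straight: "straight_at x z u (h' u)" if u: "u \<in> {0..l + \<sigma>} - (E \<union> {l, l + \<sigma>})" for u
    proof (cases "u < l")
      case True
      then have "straight_at x y u (h u)" using h(6) u by auto
      then obtain a b s where s: "adjacent a b" "a \<noteq> b" "0 < s" "s < 1" "h u = seg a b s"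
        "d x y = d x a + d a b + d b y" "u = d x a + s * d a b" unfolding straight_at_def by blast
      have ab: "a \<in> K" "b \<in> K" using s(1) unfolding adjacent_def by auto
      have "d x z = d x a + d a b + d b z"
      proof (rule order_antisym)
        show "d x z \<le> d x a + d a b + d b z" using d_triangle[OF K(1) ab(1) K(3)] d_triangle[OF ab K(3)] by simp
        show "d x a + d a b + d b z \<le> d x z" using d_triangle[OF ab(2) K(2,3)] s(6) dxy dyz dxz by simp
      qed
      then show ?thesis unfolding straight_at_def using s h'h[of u] True u by (intro exI[of _ a] exI[of _ b] exI[of _ s]) auto
    next
      case False
      define s where "s = (u - l) / \<sigma>"
      have u': "l < u" "u < l + \<sigma>" using False u by auto
      then have s: "0 < s" "s < 1" "s * \<sigma> = u - l" unfolding s_def using \<sigma> by (auto simp: divide_less_eq)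
      have "h' u = seg y z s" unfolding h'_def s_def using u' by simp
      then show ?thesis unfolding straight_at_def using extend.hyps(2) yz s dxy dyz dxz d_self[OF K(3)]
        by (intro exI[of _ y] exI[of _ z] exI[of _ s]) auto
    qed
    have dist: "d (h' u) (h' v) = \<bar>u - v\<bar>" if "u \<in> {0..l + \<sigma>}" "v \<in> {0..l + \<sigma>}" for u v
      using split[OF that(1)] split[OF that(2)]
    proof (elim disjE)
      assume "u \<in> {0..l}" "v \<in> {l..l + \<sigma>}"
      then show ?thesis using mixed[of u v] h'h h'g by simp
    next
      assume "u \<in> {l..l + \<sigma>}" "v \<in> {0..l}"
      then show ?thesis using mixed[of v u] h'h h'g d_sym by simp
    qed (use h(4) dg h'h h'g in auto)
    have inK: "h' u \<in> K" if "u \<in> {0..l + \<sigma>}" for u using split[OF that] h(3) g h'h h'g by auto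
    have ends: "h' 0 = x" "h' (l + \<sigma>) = z" using h'h[of 0] h'g[of "l + \<sigma>"] h(1) gl l0 by auto
    show ?thesis
      unfolding \<sigma>_def[symmetric] using ends inK dist straight h(5)
      by (intro exI[of _ h'] exI[of _ "E \<union> {l, l + \<sigma>}"]) auto
  qed
qed

text \<open>Both sides of the inequality are continuous along the geodesic, so it extends from the interiors of
  the segments to the finitely many vertices.\<close>

lemma cat0_inequality:
  assumes K: "x \<in> K" "y \<in> K"
  obtains h where "h 0 = x" "h (d x y) = y" "\<And>u. u \<in> {0..d x y} \<Longrightarrow> h u \<in> K"
    "\<And>u v. u \<in> {0..d x y} \<Longrightarrow> v \<in> {0..d x y} \<Longrightarrow> d (h u) (h v) = \<bar>u - v\<bar>"
    "\<And>z u. z \<in> K \<Longrightarrow> u \<in> {0..d x y} \<Longrightarrow>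
      d x y * (d z (h u))\<^sup>2 \<le> (d x y - u) * (d z x)\<^sup>2 + u * (d z y)\<^sup>2 - u * (d x y - u) * d x y"
proof -
  define D where "D = d x y"
  have D0: "0 \<le> D" unfolding D_def by (rule d_nonneg)
  obtain h E where h: "h 0 = x" "h D = y" "\<And>u. u \<in> {0..D} \<Longrightarrow> h u \<in> K"
    "\<And>u v. u \<in> {0..D} \<Longrightarrow> v \<in> {0..D} \<Longrightarrow> d (h u) (h v) = \<bar>u - v\<bar>" "finite E"
    "\<And>u. u \<in> {0..D} - E \<Longrightarrow> straight_at x y u (h u)"
    using ex_unit_speed[OF polygonal_d[OF K] refl] unfolding D_def by blast
  have "D * (d z (h u))\<^sup>2 \<le> (D - u) * (d z x)\<^sup>2 + u * (d z y)\<^sup>2 - u * (D - u) * D" if z: "z \<in> K" and u: "u \<in> {0..D}" for z u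
  proof (rule ccontr)
    assume contra: "\<not> ?thesis"
    define \<phi> where "\<phi> v = D * (d z (h v))\<^sup>2 - ((D - v) * (d z x)\<^sup>2 + v * (d z y)\<^sup>2 - v * (D - v) * D)" for v
    have "0 < D"
    proof (rule ccontr)
      assume "\<not> 0 < D"
      then have "D = 0" "u = 0" using D0 u by auto
      then show False using contra by simp
    qed
    have "\<bar>d z (h v) - d z (h w)\<bar> \<le> \<bar>v - w\<bar>" if "v \<in> {0..D}" "w \<in> {0..D}" for v w
      using d_triangle[OF z h(3)[OF that(1)] h(3)[OF that(2)]] d_triangle[OF z h(3)[OF that(2)] h(3)[OF that(1)]] h(4)[OF that] h(4)[OF that(2,1)]
      by (simp add: abs_le_iff)
    then have "continuous_on {0..D} (\<lambda>v. d z (h v))"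
      unfolding continuous_on_iff dist_real_def by (meson order_le_less_trans)
    then have cont: "continuous_on {0..D} \<phi>" unfolding \<phi>_def by (intro continuous_intros)
    have pos: "0 < \<phi> u" using contra unfolding \<phi>_def by simp
    then obtain \<delta> where \<delta>: "0 < \<delta>" "\<And>v. v \<in> {0..D} \<Longrightarrow> \<bar>v - u\<bar> < \<delta> \<Longrightarrow> \<bar>\<phi> v - \<phi> u\<bar> < \<phi> u"
      using cont u unfolding continuous_on_iff dist_real_def by blast
    have bad: "v \<in> E" if v: "v \<in> {0..D}" "\<bar>v - u\<bar> < \<delta>" for v
    proof (rule ccontr)
      assume "v \<notin> E"
      then have "straight_at x y v (h v)" using h(6) v by blast
      then obtain a b s where s: "adjacent a b" "a \<noteq> b" "0 < s" "s < 1" "h v = seg a b s"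
        "d x y = d x a + d a b + d b y" "v = d x a + s * d a b" unfolding straight_at_def by blast
      have "\<phi> v \<le> 0" using cat0_generic[OF K z s(1-4,6,7)] unfolding \<phi>_def s(5) D_def by simp
      then show False using \<delta>(2)[OF v] pos by simp
    qed
    define lo where "lo = max 0 (u - \<delta> / 2)"
    define hi where "hi = min D (u + \<delta> / 2)"
    have "lo < hi" using u \<open>0 < D\<close> \<delta>(1) unfolding lo_def hi_def by auto
    moreover have "{lo..hi} \<subseteq> E"
    proof
      fix v assume "v \<in> {lo..hi}"
      then show "v \<in> E" using \<delta>(1) unfolding lo_def hi_def by (intro bad) auto
    qed
    ultimately show False using h(5) finite_subset infinite_Icc by blast
  qed
  then show ?thesis using that[of h] h unfolding D_def by blast
qed

theorem cat0: "CAT0_space K d"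
proof -
  have metric: "Metric_space K d"
    by unfold_locales (use d_nonneg d_sym d_zero d_self d_triangle in auto)
  have ineq: "\<exists>g. geodesic K d g \<and> g 0 = x \<and> g 1 = y \<and> (\<forall>z\<in>K. \<forall>t\<in>{0..1}.
      (d z (g t))\<^sup>2 \<le> (1 - t) * (d z x)\<^sup>2 + t * (d z y)\<^sup>2 - t * (1 - t) * (d x y)\<^sup>2)"
    if K: "x \<in> K" "y \<in> K" for x y
  proof (cases "d x y = 0")
    case True
    then have "x = y" using d_zero K by blast
    then have "geodesic K d (\<lambda>_. x)" using K d_self unfolding geodesic_def by auto
    then show ?thesis using \<open>x = y\<close> d_self[OF K(1)] by (intro exI[of _ "\<lambda>_. x"]) (auto simp: algebra_simps)
  next
    case False
    define D where "D = d x y"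
    have D: "0 < D" using False d_nonneg[of x y] unfolding D_def by simp
    obtain h where h: "h 0 = x" "h D = y" "\<And>u. u \<in> {0..D} \<Longrightarrow> h u \<in> K"
      "\<And>u v. u \<in> {0..D} \<Longrightarrow> v \<in> {0..D} \<Longrightarrow> d (h u) (h v) = \<bar>u - v\<bar>"
      "\<And>z u. z \<in> K \<Longrightarrow> u \<in> {0..D} \<Longrightarrow> D * (d z (h u))\<^sup>2 \<le> (D - u) * (d z x)\<^sup>2 + u * (d z y)\<^sup>2 - u * (D - u) * D"
      by (rule cat0_inequality[OF K, folded D_def]) (rule that)
    define g where "g t = h (t * D)" for t
    have tD: "t * D \<in> {0..D}" if "t \<in> {0..1}" for t using that D by (auto simp: mult_le_cancel_right1)
    have g01: "g 0 = x" "g 1 = y" unfolding g_def using h by auto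
    have "geodesic K d g"
      unfolding geodesic_def g01 D_def[symmetric]
    proof (intro conjI ballI)
      show "g ` {0..1} \<subseteq> K" unfolding g_def using h(3) tD by blast
      fix s t :: real assume "s \<in> {0..1}" "t \<in> {0..1}"
      then have "d (g s) (g t) = \<bar>s * D - t * D\<bar>" unfolding g_def using h(4) tD by blast
      also have "\<dots> = \<bar>s - t\<bar> * D" using D by (simp add: left_diff_distrib[symmetric] abs_mult)
      finally show "d (g s) (g t) = \<bar>s - t\<bar> * D" .
    qed
    moreover have "(d z (g t))\<^sup>2 \<le> (1 - t) * (d z x)\<^sup>2 + t * (d z y)\<^sup>2 - t * (1 - t) * D\<^sup>2" if "z \<in> K" "t \<in> {0..1}" for z t
    proof -
      have "D * (d z (g t))\<^sup>2 \<le> (D - t * D) * (d z x)\<^sup>2 + t * D * (d z y)\<^sup>2 - t * D * (D - t * D) * D"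
        unfolding g_def using h(5)[OF that(1) tD[OF that(2)]] .
      also have "\<dots> = D * ((1 - t) * (d z x)\<^sup>2 + t * (d z y)\<^sup>2 - t * (1 - t) * D\<^sup>2)"
        by (simp add: power2_eq_square algebra_simps)
      finally show ?thesis using D by simp
    qed
    ultimately show ?thesis using g01 unfolding D_def by blast
  qed
  have "geodesic_space K d" unfolding geodesic_space_def using metric ineq by blast
  moreover have "(d z (g' t))\<^sup>2 \<le> (1 - t) * (d z (g' 0))\<^sup>2 + t * (d z (g' 1))\<^sup>2 - t * (1 - t) * (d (g' 0) (g' 1))\<^sup>2"
    if z: "z \<in> K" and g': "geodesic K d g'" and t: "t \<in> {0..1}" for z g' t
  proof -
    have in01: "(0::real) \<in> {0..1}" "(1::real) \<in> {0..1}" by auto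
    have gK: "g' 0 \<in> K" "g' 1 \<in> K" "g' t \<in> K" using g' t unfolding geodesic_def by auto
    define D where "D = d (g' 0) (g' 1)"
    obtain g where g: "geodesic K d g" "g 0 = g' 0" "g 1 = g' 1"
      "\<And>z t. z \<in> K \<Longrightarrow> t \<in> {0..1} \<Longrightarrow> (d z (g t))\<^sup>2 \<le> (1 - t) * (d z (g' 0))\<^sup>2 + t * (d z (g' 1))\<^sup>2 - t * (1 - t) * D\<^sup>2"
      using ineq[OF gK(1,2)] unfolding D_def by blast
    \<comment> \<open>The inequality at a point of the given geodesic shows that it agrees with the constructed one.\<close>
    have "d (g' t) (g' 0) = t * D" "d (g' t) (g' 1) = (1 - t) * D"
    proof -
      have "d (g' t) (g' s) = \<bar>t - s\<bar> * D" if "s \<in> {0..1}" for s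
        using g' t that unfolding geodesic_def D_def by blast
      from this[OF in01(1)] this[OF in01(2)] show "d (g' t) (g' 0) = t * D" "d (g' t) (g' 1) = (1 - t) * D"
        using t by auto
    qed
    then have "(d (g' t) (g t))\<^sup>2 \<le> (1 - t) * (t * D)\<^sup>2 + t * ((1 - t) * D)\<^sup>2 - t * (1 - t) * D\<^sup>2"
      using g(4)[OF gK(3) t] by simp
    also have "\<dots> = 0" by (simp add: power2_eq_square algebra_simps)
    finally have "d (g' t) (g t) = 0" by simp
    then have "g' t = g t" using d_zero[OF gK(3)] g(1) t unfolding geodesic_def by blast
    then show ?thesis using g(4)[OF z t] unfolding D_def by simp
  qed
  ultimately show ?thesis unfolding CAT0_space_def by blast
qed

end

theorem theorem1p2:
  fixes L :: "'a::order set" and r :: "'a \<Rightarrow> int"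
  assumes "modular_semilattice L r"
    and "bounded_chains L"
  shows "CAT0_space (orthoscheme_complex L) (orthoscheme_dist L r)"
proof -
  interpret modular_semilattice_finite_rank L r by unfold_locales (fact assms)+
  show ?thesis by (rule cat0)
qed

end
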